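(* Let $l\ge2$ and let $\mathcal D=\mathcal D(\mathcal E,\Pi,a,k,g)$ be a quasi-elliptic base system (QEBS). Let $\bar{\mathfrak g}_{\mathcal D}=\mathfrak g^q_{\mathcal D}$ with some $q\in\mathbb C\setminus\{0\}$ if $\mathcal D$ is $A_l^{(1,1)}$ (i.e. the affine Cartan matrix $A$ is of type $A_l^{(1)}$), and $\bar{\mathfrak g}_{\mathcal D}=\mathfrak g_{\mathcal D}$ otherwise. Let $\mathrm D^1(\bar{\mathfrak g}_{\mathcal D})=[\bar{\mathfrak g}_{\mathcal D},\bar{\mathfrak g}_{\mathcal D}]$, and let $\varrho:\mathrm D^1(\bar{\mathfrak g}_{\mathcal D})\to\mathfrak a$ be a central extension of a Lie superalgebra $\mathfrak a$. Then $\varrho$ is a universal central extension (UCE).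
   Context: All vector spaces and Lie superalgebras are over $\mathbb C$. $\mathbb N=\{1,2,\dots\}$. **Central extensions.** For a Lie superalgebra $\mathfrak a$ put $\mathrm D^1(\mathfrak a)=[\mathfrak a,\mathfrak a]$. A Lie superalgebra epimorphism $P:\mathfrak u=\mathfrak u_0\oplus\mathfrak u_1\to\mathfrak a$ is a central extension if $[\ker P,\mathfrak u]=\{0\}$ and $\ker P=(\mathfrak u_0\cap\ker P)\oplus(\mathfrak u_1\cap\ker P)$ (it is not assumed that $\ker P\subset\mathfrak u_0$). A central extension $V:\mathfrak u\to\mathfrak a$ is a UCE if $\mathfrak u=\mathrm D^1(\mathfrak u)$ and for any central extension $W:\mathfrak b\to\mathfrak a$ there is a homomorphism $M:\mathfrak u\to\mathfrak b$ with $W\circ M=V$. **Pre-elliptic base systems.** Fix $l\ge2$. $\mathcal E$ is an $(l+4)$-dimensional $\mathbb C$-vector space with a nondegenerate symmetric bilinear form $J$. Put $\mathcal E^\times=\{x\in\mathcal E\mid J(x,x)\ne0\}$; for $x\in\mathcal E^\times$ put $x^\vee=2x/J(x,x)$ and $s_x(y)=y-J(x^\vee,y)x$. Let $\{\alpha_0,\dots,\alpha_l,\Lambda_\delta,a,\Lambda_a\}$ be a basis of $\mathcal E$ such that: (B1) $A=(J(\alpha_i^\vee,\alpha_j))_{0\le i,j\le l}$ is an (indecomposable) affine type generalized Cartan matrix, numbered as in Kac's book (Tables Aff 1,2,3), i.e. of type $A_l^{(1)},B_l^{(1)},C_l^{(1)},D_l^{(1)},E_{6,7,8}^{(1)},F_4^{(1)},G_2^{(1)},A_{2l}^{(2)},A_{2l-1}^{(2)},D_{l+1}^{(2)},E_6^{(2)}$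 or $D_4^{(3)}$; (B2) $J(\Lambda_\delta,\Lambda_\delta)=J(a,\alpha_i)=J(a,\Lambda_\delta)=J(a,a)=J(\Lambda_a,\alpha_i)=J(\Lambda_a,\Lambda_a)=0$, $J(\Lambda_a,a)=1$, and $J(\Lambda_\delta,\alpha_i)=\frac1r\delta_{i0}$ with $r=2$ if $A=A_{2l}^{(2)}$ (where $\alpha_0$ is the shortest simple root) and $r=1$ otherwise. Let $\Pi=\{\alpha_0,\dots,\alpha_l\}$ and $W=\langle s_\alpha\mid\alpha\in\Pi\rangle$. A function $f$ on $\Pi$ is $W$-invariant if $f(\alpha)=f(\beta)$ whenever $\alpha,\beta\in\Pi$, $\beta=w(\alpha)$, $w\in W$. Let $k:\Pi\to\mathbb N$ be $W$-invariant with $\gcd\{k(\alpha)\mid\alpha\in\Pi\}=1$ and $g:\Pi\to 2^{\mathbb Z}$ (subsets of $\mathbb Z$) be $W$-invariant. Then $\mathcal D=\mathcal D(\mathcal E,\Pi,a,k,g)$ is a pre-elliptic base system (PEBS). Put $$R(k,g)=\bigcup_{w\in W}w\Bigl(\bigcup_{\alpha\in\Pi}\bigl((\alpha+\mathbb Zk(\alpha)a)\cup(2\alpha+g(\alpha)k(\alpha)a)\bigr)\Bigr),$$ where $2\alpha+g(\alpha)k(\alpha)a=\{2\alpha+nk(\alpha)a\mid n\in g(\alpha)\}$ (empty if $g(\alpha)=\emptyset$). **QEBS.** For $\alpha\in\Pi$ let $\Pi_c(\alpha)=\{\beta\in\Pi\mid\beta\ne\alpha,\ J(\beta,\alpha)\ne0\}$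 and $\Pi^B=\{\alpha\in\Pi\mid J(\alpha^\vee,\beta)=-2\ \forall\beta\in\Pi_c(\alpha)\}$. A PEBS is a QEBS if: (KG1) if $\alpha\in\Pi$, $\beta\in\Pi_c(\alpha)$, $J(\beta^\vee,\alpha)=-1$, then $\frac{k(\beta)}{k(\alpha)}\in\mathbb Z$ and $J(\alpha^\vee,\beta)\frac{k(\alpha)}{k(\beta)}\in\mathbb Z$; (KG2) $g(\alpha)=\emptyset$ if $\alpha\notin\Pi^B$; (KG3) if $\alpha\in\Pi^B$ and $\beta\in\Pi_c(\alpha)$, then the set $g(\alpha)\frac{k(\alpha)}{k(\beta)}$ is $\emptyset$, $\mathbb Z$, $2\mathbb Z$ or $2\mathbb Z+1$. **The Lie superalgebra $\mathfrak g_{\mathcal D}$.** For $\alpha\in\Pi$ let $c(\alpha)=2$ if $g(\alpha)=\mathbb Z$ or $2\mathbb Z+1$, and $c(\alpha)=1$ otherwise; $\alpha^*=c(\alpha)\alpha+k(\alpha)a$. For $\alpha\in R(k,g)$ let $p(\alpha)=1$ if $2\alpha\in R(k,g)$ and $p(\alpha)=0$ otherwise. Let $\mathcal A=\{(\alpha,\beta,y)\in\Pi\times\Pi\times\mathbb N\mid\alpha\ne\beta,\ J(\alpha,\beta^\vee)=-1,\ k(\alpha)y=k(\beta)\}$, $\Pi^*=\{\alpha^*\mid\alpha\in\Pi\}$, $\mathcal B_+=\Pi\cup\Pi^*$, $\mathcal B=\mathcal B_+\cup-\mathcal B_+$, $(\mathcal B\times\mathcal B)'=\{(\mu,\nu)\in\mathcal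 B\times\mathcal B\mid\mu\ne\nu,\ \mu+\nu\ne0\}$; for $(\mu,\nu)\in(\mathcal B\times\mathcal B)'$ let $x_{\mu,\nu}=1-J(\mu^\vee,\nu)$ if $J(\mu^\vee,\nu)<0$ and $x_{\mu,\nu}=1$ if $J(\mu^\vee,\nu)\ge0$. $\mathfrak g_{\mathcal D}$ is the Lie superalgebra with generators $h_\sigma$ ($\sigma\in\mathcal E$, even) and $E_\mu$ ($\mu\in\mathcal B$, parity $p(\mu)$) and relations: (SR1) $xh_\sigma+yh_\tau=h_{x\sigma+y\tau}$ ($x,y\in\mathbb C$); (SR2) $[h_\sigma,h_\tau]=0$; (SR3) $[h_\sigma,E_\mu]=J(\sigma,\mu)E_\mu$; (SR4) $[E_\mu,E_{-\mu}]=h_{\mu^\vee}$ for $\mu\in\mathcal B_+$; (SR5) $(\mathrm{ad}E_\mu)^{x_{\mu,\nu}}E_\nu=0$ for $(\mu,\nu)\in(\mathcal B\times\mathcal B)'$; and for $(\alpha,\beta,y)\in\mathcal A$: (SR6) $c(\alpha)(\mathrm{ad}E_{\alpha^*})^yE_\beta=(\mathrm{ad}E_\alpha)^{c(\alpha)y}E_{\beta^*}$; (SR7) $(-1)^{c(\alpha)+1}c(\alpha)(\mathrm{ad}E_{-\alpha^*})^yE_{-\beta}=(\mathrm{ad}E_{-\alpha})^{c(\alpha)y}E_{-\beta^*}$; (SR8) $(\mathrm{ad}E_\alpha)^i(\mathrm{ad}E_{\alpha^*})^{y-i}E_\beta=0$ for $1\le i\le y-1$; (SR9) $(\mathrm{ad}E_{-\alpha})^i(\mathrm{ad}E_{-\alpha^*})^{y-i}E_{-\beta}=0$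 for $1\le i\le y-1$. **$\mathfrak g^q_{\mathcal D}$.** If $A$ is of type $A_l^{(1)}$ (cyclic numbering; then $k\equiv1$, $g\equiv\emptyset$) and $q\in\mathbb C\setminus\{0\}$, $\mathfrak g^q_{\mathcal D}$ is defined by the same generators and relations except that the relations $[E_{\pm\alpha_0^*},E_{\pm\alpha_l}]=[E_{\pm\alpha_0},E_{\pm\alpha_l^*}]$ in (SR6)--(SR7) (arising from both $(\alpha_0,\alpha_l,1)$ and $(\alpha_l,\alpha_0,1)$ in $\mathcal A$) are replaced by $q^{\pm1}[E_{\pm\alpha_0^*},E_{\pm\alpha_l}]=[E_{\pm\alpha_0},E_{\pm\alpha_l^*}]$. *)

theory Defs
  imports
    Complex_Main
    "HOL-Library.Z2"
    "HOL-Algebra.Algebraic_Closure_Type"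
    "HOL-Algebra.AbelCoset"
    "HOL-Algebra.Bij"
    "HOL-Algebra.Generated_Groups"
begin

section \<open>Lie superalgebras over the complex numbers\<close>

abbreviation complex_ring :: "complex ring"
  where "complex_ring \<equiv> ring_of_type_algebra"

text \<open>
  The field \<^const>\<open>mult\<close> inherited from the module record holds the Lie superbracket;
  the inherited field \<^const>\<open>one\<close> is not used. Parities are elements of the field with two elements.
\<close>
record 'a lie_superalg = "(complex, 'a) module" +
  part :: "bit \<Rightarrow> 'a set"

definition koszul :: "bit \<Rightarrow> bit \<Rightarrow> complex"
  where "koszul i j = (if i = 1 \<and> j = 1 then - 1 else 1)"

locale lie_superalgebra = Module.module complex_ring L
  for L :: "'a lie_superalg" (structure) +
  assumes part_submodule: "submodule (part L i) complex_ring L"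
    and carrier_eq: "carrier L = part L 0 <+> part L 1"
    and part_disjoint: "part L 0 \<inter> part L 1 = {\<zero>}"
    and bracket_closed: "\<lbrakk>x \<in> carrier L; y \<in> carrier L\<rbrakk> \<Longrightarrow> x \<otimes> y \<in> carrier L"
    and bracket_add_left: "\<lbrakk>x \<in> carrier L; y \<in> carrier L; z \<in> carrier L\<rbrakk>
          \<Longrightarrow> (x \<oplus> y) \<otimes> z = x \<otimes> z \<oplus> y \<otimes> z"
    and bracket_add_right: "\<lbrakk>x \<in> carrier L; y \<in> carrier L; z \<in> carrier L\<rbrakk>
          \<Longrightarrow> x \<otimes> (y \<oplus> z) = x \<otimes> y \<oplus> x \<otimes> z"
    and bracket_smult_left: "\<lbrakk>x \<in> carrier L; y \<in> carrier L\<rbrakk> \<Longrightarrow> (c \<odot> x) \<otimes> y = c \<odot> (x \<otimes> y)"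
    and bracket_smult_right: "\<lbrakk>x \<in> carrier L; y \<in> carrier L\<rbrakk> \<Longrightarrow> x \<otimes> (c \<odot> y) = c \<odot> (x \<otimes> y)"
    and bracket_part: "\<lbrakk>x \<in> part L i; y \<in> part L j\<rbrakk> \<Longrightarrow> x \<otimes> y \<in> part L (i + j)"
    and bracket_skew: "\<lbrakk>x \<in> part L i; y \<in> part L j\<rbrakk>
          \<Longrightarrow> x \<otimes> y = (- koszul i j) \<odot> (y \<otimes> x)"
    and bracket_jacobi: "\<lbrakk>x \<in> part L i; y \<in> part L j; z \<in> carrier L\<rbrakk>
          \<Longrightarrow> x \<otimes> (y \<otimes> z) = (x \<otimes> y) \<otimes> z \<oplus> koszul i j \<odot> (y \<otimes> (x \<otimes> z))"

definition lsa_hom :: "'a lie_superalg \<Rightarrow> 'b lie_superalg \<Rightarrow> ('a \<Rightarrow> 'b) set" where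
  "lsa_hom L M = {f \<in> carrier L \<rightarrow> carrier M.
     (\<forall>x \<in> carrier L. \<forall>y \<in> carrier L. f (x \<oplus>\<^bsub>L\<^esub> y) = f x \<oplus>\<^bsub>M\<^esub> f y) \<and>
     (\<forall>c. \<forall>x \<in> carrier L. f (c \<odot>\<^bsub>L\<^esub> x) = c \<odot>\<^bsub>M\<^esub> f x) \<and>
     (\<forall>x \<in> carrier L. \<forall>y \<in> carrier L. f (x \<otimes>\<^bsub>L\<^esub> y) = f x \<otimes>\<^bsub>M\<^esub> f y) \<and>
     (\<forall>i. f ` part L i \<subseteq> part M i)}"

definition D1_set :: "'a lie_superalg \<Rightarrow> 'a set" where
  "D1_set L = \<Inter>{H. submodule H complex_ring L \<and>
     {x \<otimes>\<^bsub>L\<^esub> y | x y. x \<in> carrier L \<and> y \<in> carrier L} \<subseteq> H}"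

definition D1 :: "'a lie_superalg \<Rightarrow> 'a lie_superalg" where
  "D1 L = L\<lparr>carrier := D1_set L, part := (\<lambda>i. part L i \<inter> D1_set L)\<rparr>"

definition central_extension :: "'u lie_superalg \<Rightarrow> 'a lie_superalg \<Rightarrow> ('u \<Rightarrow> 'a) \<Rightarrow> bool" where
  "central_extension U A P \<longleftrightarrow>
     lie_superalgebra U \<and> lie_superalgebra A \<and>
     P \<in> lsa_hom U A \<and> P ` carrier U = carrier A \<and>
     (\<forall>z \<in> a_kernel U A P. \<forall>u \<in> carrier U. z \<otimes>\<^bsub>U\<^esub> u = \<zero>\<^bsub>U\<^esub>) \<and>
     a_kernel U A P = (part U 0 \<inter> a_kernel U A P) <+>\<^bsub>U\<^esub> (part U 1 \<inter> a_kernel U A P)"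

text \<open>
  HOL cannot quantify over types inside a formula, so the type \<open>'b\<close> of the carriers of the
  competing central extensions is a parameter; a theorem that concludes \<open>is_UCE TYPE('b) U A V\<close>
  with \<open>'b\<close> schematic asserts the universal property against central extensions of every type.
\<close>
definition is_UCE :: "'b itself \<Rightarrow> 'u lie_superalg \<Rightarrow> 'a lie_superalg \<Rightarrow> ('u \<Rightarrow> 'a) \<Rightarrow> bool" where
  "is_UCE _ U A V \<longleftrightarrow>
     central_extension U A V \<and> carrier U = D1_set U \<and>
     (\<forall>(B :: 'b lie_superalg) W. central_extension B A W \<longrightarrow>
        (\<exists>M \<in> lsa_hom U B. \<forall>u \<in> carrier U. W (M u) = V u))"


section \<open>Lie superalgebras given by generators and relations\<close>

datatype 'x lterm =
    Zero
  | Gen 'x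
  | Add "'x lterm" "'x lterm"
  | Smult complex "'x lterm"
  | Br "'x lterm" "'x lterm"

definition lterms :: "'x set \<Rightarrow> 'x lterm set"
  where "lterms G = {t. set_lterm t \<subseteq> G}"

inductive homog :: "('x \<Rightarrow> bit) \<Rightarrow> bit \<Rightarrow> 'x lterm \<Rightarrow> bool" for p where
  "homog p i Zero"
| "homog p (p x) (Gen x)"
| "homog p i s \<Longrightarrow> homog p i t \<Longrightarrow> homog p i (Add s t)"
| "homog p i t \<Longrightarrow> homog p i (Smult c t)"
| "homog p i s \<Longrightarrow> homog p j t \<Longrightarrow> homog p (i + j) (Br s t)"

text \<open>
  \<open>lcong G p Rel\<close> is the least congruence on the terms over the generators \<open>G\<close> (of parities
  \<open>p\<close>) that contains the laws of Lie superalgebras and the pairs in \<open>Rel\<close>; the quotient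
  is therefore the Lie superalgebra presented by \<open>G\<close> and the relations \<open>s = t\<close>
  for \<open>(s, t) \<in> Rel\<close>.
\<close>
inductive_set lcong :: "'x set \<Rightarrow> ('x \<Rightarrow> bit) \<Rightarrow> ('x lterm \<times> 'x lterm) set \<Rightarrow> ('x lterm \<times> 'x lterm) set"
  for G p Rel where
  relation: "(s, t) \<in> Rel \<Longrightarrow> s \<in> lterms G \<Longrightarrow> t \<in> lterms G \<Longrightarrow> (s, t) \<in> lcong G p Rel"
| refl: "t \<in> lterms G \<Longrightarrow> (t, t) \<in> lcong G p Rel"
| sym: "(s, t) \<in> lcong G p Rel \<Longrightarrow> (t, s) \<in> lcong G p Rel"
| trans: "(s, t) \<in> lcong G p Rel \<Longrightarrow> (t, u) \<in> lcong G p Rel \<Longrightarrow> (s, u) \<in> lcong G p Rel"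
| Add_cong: "(s, s') \<in> lcong G p Rel \<Longrightarrow> (t, t') \<in> lcong G p Rel
    \<Longrightarrow> (Add s t, Add s' t') \<in> lcong G p Rel"
| Smult_cong: "(s, s') \<in> lcong G p Rel \<Longrightarrow> (Smult c s, Smult c s') \<in> lcong G p Rel"
| Br_cong: "(s, s') \<in> lcong G p Rel \<Longrightarrow> (t, t') \<in> lcong G p Rel
    \<Longrightarrow> (Br s t, Br s' t') \<in> lcong G p Rel"
| Add_assoc: "s \<in> lterms G \<Longrightarrow> t \<in> lterms G \<Longrightarrow> u \<in> lterms G
    \<Longrightarrow> (Add (Add s t) u, Add s (Add t u)) \<in> lcong G p Rel"
| Add_commute: "s \<in> lterms G \<Longrightarrow> t \<in> lterms G \<Longrightarrow> (Add s t, Add t s) \<in> lcong G p Rel"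
| Add_Zero: "t \<in> lterms G \<Longrightarrow> (Add t Zero, t) \<in> lcong G p Rel"
| Add_neg: "t \<in> lterms G \<Longrightarrow> (Add t (Smult (- 1) t), Zero) \<in> lcong G p Rel"
| Smult_Add: "s \<in> lterms G \<Longrightarrow> t \<in> lterms G
    \<Longrightarrow> (Smult c (Add s t), Add (Smult c s) (Smult c t)) \<in> lcong G p Rel"
| Smult_plus: "t \<in> lterms G
    \<Longrightarrow> (Smult (c + d) t, Add (Smult c t) (Smult d t)) \<in> lcong G p Rel"
| Smult_Smult: "t \<in> lterms G \<Longrightarrow> (Smult (c * d) t, Smult c (Smult d t)) \<in> lcong G p Rel"
| Smult_one: "t \<in> lterms G \<Longrightarrow> (Smult 1 t, t) \<in> lcong G p Rel"
| Br_Add_left: "s \<in> lterms G \<Longrightarrow> t \<in> lterms G \<Longrightarrow> u \<in> lterms G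
    \<Longrightarrow> (Br (Add s t) u, Add (Br s u) (Br t u)) \<in> lcong G p Rel"
| Br_Add_right: "s \<in> lterms G \<Longrightarrow> t \<in> lterms G \<Longrightarrow> u \<in> lterms G
    \<Longrightarrow> (Br s (Add t u), Add (Br s t) (Br s u)) \<in> lcong G p Rel"
| Br_Smult_left: "s \<in> lterms G \<Longrightarrow> t \<in> lterms G
    \<Longrightarrow> (Br (Smult c s) t, Smult c (Br s t)) \<in> lcong G p Rel"
| Br_Smult_right: "s \<in> lterms G \<Longrightarrow> t \<in> lterms G
    \<Longrightarrow> (Br s (Smult c t), Smult c (Br s t)) \<in> lcong G p Rel"
| skew: "s \<in> lterms G \<Longrightarrow> t \<in> lterms G \<Longrightarrow> homog p i s \<Longrightarrow> homog p j t
    \<Longrightarrow> (Br s t, Smult (- koszul i j) (Br t s)) \<in> lcong G p Rel"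
| jacobi: "s \<in> lterms G \<Longrightarrow> t \<in> lterms G \<Longrightarrow> u \<in> lterms G \<Longrightarrow> homog p i s \<Longrightarrow> homog p j t
    \<Longrightarrow> (Br s (Br t u), Add (Br (Br s t) u) (Smult (koszul i j) (Br t (Br s u)))) \<in> lcong G p Rel"

definition presented_lsa ::
    "'x set \<Rightarrow> ('x \<Rightarrow> bit) \<Rightarrow> ('x lterm \<times> 'x lterm) set \<Rightarrow> 'x lterm set lie_superalg" where
  "presented_lsa G p Rel = (let cls = (\<lambda>t. lcong G p Rel `` {t}) in
     \<lparr>carrier = lterms G // lcong G p Rel,
      monoid.mult = (\<lambda>u v. \<Union>s \<in> u. \<Union>t \<in> v. cls (Br s t)),
      monoid.one = undefined,
      ring.zero = cls Zero,
      ring.add = (\<lambda>u v. \<Union>s \<in> u. \<Union>t \<in> v. cls (Add s t)),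
      module.smult = (\<lambda>c u. \<Union>t \<in> u. cls (Smult c t)),
      part = (\<lambda>i. {cls t | t. t \<in> lterms G \<and> homog p i t})\<rparr>)"


section \<open>Affine generalized Cartan matrices\<close>

text \<open>
  For the families, \<open>l + 1\<close> is the size of the matrix:
  \<open>Tw_A_even\<close>, \<open>Tw_A_odd\<close>, \<open>Tw_D\<close>, \<open>Tw_E6\<close>, \<open>Tw_D4\<close> stand for
  \<open>A\<^sub>2\<^sub>l\<close>, \<open>A\<^sub>2\<^sub>l\<^sub>-\<^sub>1\<close>, \<open>D\<^sub>l\<^sub>+\<^sub>1\<close>, \<open>E\<^sub>6\<close> (all with superscript 2) and \<open>D\<^sub>4\<close> (superscript 3).
\<close>
datatype affine_type =
  Aff_A | Aff_B | Aff_C | Aff_D | Aff_E6 | Aff_E7 | Aff_E8 | Aff_F4 | Aff_G2 |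
  Tw_A_even | Tw_A_odd | Tw_D | Tw_E6 | Tw_D4

fun valid_rank :: "affine_type \<Rightarrow> nat \<Rightarrow> bool" where
  "valid_rank Aff_A l = (l \<ge> 2)"
| "valid_rank Aff_B l = (l \<ge> 3)"
| "valid_rank Aff_C l = (l \<ge> 2)"
| "valid_rank Aff_D l = (l \<ge> 4)"
| "valid_rank Aff_E6 l = (l = 6)"
| "valid_rank Aff_E7 l = (l = 7)"
| "valid_rank Aff_E8 l = (l = 8)"
| "valid_rank Aff_F4 l = (l = 4)"
| "valid_rank Aff_G2 l = (l = 2)"
| "valid_rank Tw_A_even l = (l \<ge> 2)"
| "valid_rank Tw_A_odd l = (l \<ge> 3)"
| "valid_rank Tw_D l = (l \<ge> 2)"
| "valid_rank Tw_E6 l = (l = 4)"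
| "valid_rank Tw_D4 l = (l = 2)"

text \<open>
  A triple \<open>(i, j, m)\<close> in \<open>dynkin_edges\<close> encodes the entries \<open>a i j = - m\<close> and \<open>a j i = - 1\<close>,
  i.e. an \<open>m\<close>-fold edge whose arrow (for \<open>m > 1\<close>) points to the shorter root \<open>i\<close>.
  The numbering of the vertices is the one of Kac, Infinite dimensional Lie algebras,
  Tables Aff 1, 2, 3.
\<close>
definition chain :: "nat \<Rightarrow> nat \<Rightarrow> (nat \<times> nat \<times> int) set"
  where "chain m n = {(i, Suc i, 1) | i. m \<le> i \<and> i < n}"

fun dynkin_edges :: "affine_type \<Rightarrow> nat \<Rightarrow> (nat \<times> nat \<times> int) set" where
  "dynkin_edges Aff_A l = chain 0 l \<union> {(0, l, 1)}"
| "dynkin_edges Aff_B l = chain 1 (l - 1) \<union> {(0, 2, 1), (l, l - 1, 2)}"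
| "dynkin_edges Aff_C l = chain 1 (l - 1) \<union> {(1, 0, 2), (l - 1, l, 2)}"
| "dynkin_edges Aff_D l = chain 1 (l - 1) \<union> {(0, 2, 1), (l - 2, l, 1)}"
| "dynkin_edges Aff_E6 l = chain 1 5 \<union> {(3, 6, 1), (0, 6, 1)}"
| "dynkin_edges Aff_E7 l = chain 0 6 \<union> {(3, 7, 1)}"
| "dynkin_edges Aff_E8 l = chain 0 7 \<union> {(5, 8, 1)}"
| "dynkin_edges Aff_F4 l = {(0, 1, 1), (1, 2, 1), (3, 2, 2), (3, 4, 1)}"
| "dynkin_edges Aff_G2 l = {(0, 1, 1), (2, 1, 3)}"
| "dynkin_edges Tw_A_even l = chain 1 (l - 1) \<union> {(0, 1, 2), (l - 1, l, 2)}"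
| "dynkin_edges Tw_A_odd l = chain 1 (l - 1) \<union> {(0, 2, 1), (l - 1, l, 2)}"
| "dynkin_edges Tw_D l = chain 1 (l - 1) \<union> {(0, 1, 2), (l, l - 1, 2)}"
| "dynkin_edges Tw_E6 l = {(0, 1, 1), (1, 2, 1), (2, 3, 2), (3, 4, 1)}"
| "dynkin_edges Tw_D4 l = {(0, 1, 1), (1, 2, 3)}"

definition affine_cartan :: "affine_type \<Rightarrow> nat \<Rightarrow> nat \<Rightarrow> nat \<Rightarrow> int" where
  "affine_cartan T l i j =
     (if i = j then 2
      else if \<exists>m. (i, j, m) \<in> dynkin_edges T l then - (THE m. (i, j, m) \<in> dynkin_edges T l)
      else if \<exists>m. (j, i, m) \<in> dynkin_edges T l then - 1
      else 0)"


section \<open>Base systems\<close>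

text \<open>
  The space \<open>\<E>\<close> is the whole type \<open>'e\<close> with scalar multiplication \<open>scl\<close>;
  \<open>sroot i\<close> for \<open>i \<le> rnk\<close> are the simple roots, and only the values of \<open>kk\<close> and \<open>gg\<close> on
  simple roots matter.
\<close>
record 'e base_system =
  scl :: "complex \<Rightarrow> 'e \<Rightarrow> 'e"
  form :: "'e \<Rightarrow> 'e \<Rightarrow> complex"
  atype :: affine_type
  rnk :: nat
  sroot :: "nat \<Rightarrow> 'e"
  Lam_delta :: 'e
  avec :: 'e
  Lam_a :: 'e
  kk :: "'e \<Rightarrow> nat"
  gg :: "'e \<Rightarrow> int set"

definition coroot :: "'e::ab_group_add base_system \<Rightarrow> 'e \<Rightarrow> 'e"
  where "coroot D x = scl D (2 / form D x x) x"

definition sref :: "'e::ab_group_add base_system \<Rightarrow> 'e \<Rightarrow> 'e \<Rightarrow> 'e"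
  where "sref D x y = y - scl D (form D (coroot D x) y) x"

definition simple :: "'e::ab_group_add base_system \<Rightarrow> 'e set"
  where "simple D = sroot D ` {0..rnk D}"

definition weyl :: "'e::ab_group_add base_system \<Rightarrow> ('e \<Rightarrow> 'e) set"
  where "weyl D = generate (BijGroup UNIV) (sref D ` simple D)"

definition weyl_invariant :: "'e::ab_group_add base_system \<Rightarrow> ('e \<Rightarrow> 'z) \<Rightarrow> bool" where
  "weyl_invariant D f \<longleftrightarrow>
     (\<forall>\<alpha> \<in> simple D. \<forall>\<beta> \<in> simple D. (\<exists>w \<in> weyl D. \<beta> = w \<alpha>) \<longrightarrow> f \<alpha> = f \<beta>)"

definition basis_list :: "'e base_system \<Rightarrow> 'e list"
  where "basis_list D = map (sroot D) [0..<Suc (rnk D)] @ [Lam_delta D, avec D, Lam_a D]"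

definition rnum :: "'e base_system \<Rightarrow> complex"
  where "rnum D = (if atype D = Tw_A_even then 2 else 1)"

locale pre_elliptic =
  fixes D :: "'e::ab_group_add base_system"
  assumes rank_ge_2: "rnk D \<ge> 2"
    and vector_space: "vector_space (scl D)"
    and form_linear: "Vector_Spaces.linear (scl D) (*) (form D x)"
    and form_sym: "form D x y = form D y x"
    and form_nondegenerate: "(\<And>y. form D x y = 0) \<Longrightarrow> x = 0"
    and basis_distinct: "distinct (basis_list D)"
    and basis_independent: "\<not> Modules.module.dependent (scl D) (set (basis_list D))"
    and basis_span: "Modules.module.span (scl D) (set (basis_list D)) = UNIV"
    and rank_valid: "valid_rank (atype D) (rnk D)"
    and root_nonisotropic: "i \<le> rnk D \<Longrightarrow> form D (sroot D i) (sroot D i) \<noteq> 0"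
    and cartan: "i \<le> rnk D \<Longrightarrow> j \<le> rnk D \<Longrightarrow>
          form D (coroot D (sroot D i)) (sroot D j) = of_int (affine_cartan (atype D) (rnk D) i j)"
    and Lam_delta_Lam_delta: "form D (Lam_delta D) (Lam_delta D) = 0"
    and avec_root: "i \<le> rnk D \<Longrightarrow> form D (avec D) (sroot D i) = 0"
    and avec_Lam_delta: "form D (avec D) (Lam_delta D) = 0"
    and avec_avec: "form D (avec D) (avec D) = 0"
    and Lam_a_root: "i \<le> rnk D \<Longrightarrow> form D (Lam_a D) (sroot D i) = 0"
    and Lam_a_Lam_a: "form D (Lam_a D) (Lam_a D) = 0"
    and Lam_a_avec: "form D (Lam_a D) (avec D) = 1"
    and Lam_delta_root: "i \<le> rnk D \<Longrightarrow>
          form D (Lam_delta D) (sroot D i) = (if i = 0 then 1 / rnum D else 0)"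
    and kk_pos: "\<alpha> \<in> simple D \<Longrightarrow> kk D \<alpha> \<ge> 1"
    and kk_invariant: "weyl_invariant D (kk D)"
    and kk_gcd: "Gcd (kk D ` simple D) = 1"
    and gg_invariant: "weyl_invariant D (gg D)"

definition roots :: "'e::ab_group_add base_system \<Rightarrow> 'e set" where
  "roots D = (\<Union>w \<in> weyl D. w ` (\<Union>\<alpha> \<in> simple D.
     {\<alpha> + scl D (of_int n * of_nat (kk D \<alpha>)) (avec D) | n. True} \<union>
     {scl D 2 \<alpha> + scl D (of_int n * of_nat (kk D \<alpha>)) (avec D) | n. n \<in> gg D \<alpha>}))"

definition simple_adj :: "'e::ab_group_add base_system \<Rightarrow> 'e \<Rightarrow> 'e set"
  where "simple_adj D \<alpha> = {\<beta> \<in> simple D. \<beta> \<noteq> \<alpha> \<and> form D \<beta> \<alpha> \<noteq> 0}"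

definition simple_B :: "'e::ab_group_add base_system \<Rightarrow> 'e set"
  where "simple_B D = {\<alpha> \<in> simple D. \<forall>\<beta> \<in> simple_adj D \<alpha>. form D (coroot D \<alpha>) \<beta> = - 2}"

locale quasi_elliptic = pre_elliptic +
  assumes KG1: "\<lbrakk>\<alpha> \<in> simple D; \<beta> \<in> simple_adj D \<alpha>; form D (coroot D \<beta>) \<alpha> = - 1\<rbrakk> \<Longrightarrow>
        of_nat (kk D \<beta>) / of_nat (kk D \<alpha>) \<in> (\<int> :: complex set) \<and>
        form D (coroot D \<alpha>) \<beta> * (of_nat (kk D \<alpha>) / of_nat (kk D \<beta>)) \<in> \<int>"
    and KG2: "\<lbrakk>\<alpha> \<in> simple D; \<alpha> \<notin> simple_B D\<rbrakk> \<Longrightarrow> gg D \<alpha> = {}"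
    and KG3: "\<lbrakk>\<alpha> \<in> simple_B D; \<beta> \<in> simple_adj D \<alpha>\<rbrakk> \<Longrightarrow>
        {rat_of_int n * (of_nat (kk D \<alpha>) / of_nat (kk D \<beta>)) | n. n \<in> gg D \<alpha>}
          \<in> {{}, \<int>, {2 * z | z. z \<in> \<int>}, {2 * z + 1 | z. z \<in> \<int>}}"


section \<open>The Lie superalgebras attached to a base system\<close>

definition cnum :: "'e base_system \<Rightarrow> 'e \<Rightarrow> nat"
  where "cnum D \<alpha> = (if gg D \<alpha> = UNIV \<or> gg D \<alpha> = {2 * z + 1 | z. True} then 2 else 1)"

definition star :: "'e::ab_group_add base_system \<Rightarrow> 'e \<Rightarrow> 'e"
  where "star D \<alpha> = scl D (of_nat (cnum D \<alpha>)) \<alpha> + scl D (of_nat (kk D \<alpha>)) (avec D)"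

definition root_parity :: "'e::ab_group_add base_system \<Rightarrow> 'e \<Rightarrow> bit"
  where "root_parity D \<alpha> = (if scl D 2 \<alpha> \<in> roots D then 1 else 0)"

definition adm :: "'e::ab_group_add base_system \<Rightarrow> ('e \<times> 'e \<times> nat) set" where
  "adm D = {(\<alpha>, \<beta>, y). \<alpha> \<in> simple D \<and> \<beta> \<in> simple D \<and> y \<ge> 1 \<and> \<alpha> \<noteq> \<beta> \<and>
     form D \<alpha> (coroot D \<beta>) = - 1 \<and> kk D \<alpha> * y = kk D \<beta>}"

definition B_plus :: "'e::ab_group_add base_system \<Rightarrow> 'e set"
  where "B_plus D = simple D \<union> star D ` simple D"

definition B_all :: "'e::ab_group_add base_system \<Rightarrow> 'e set"
  where "B_all D = B_plus D \<union> uminus ` B_plus D"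

text \<open>The pairings of elements of \<open>B_all D\<close> are rational integers for a quasi-elliptic base system.\<close>
definition xnum :: "'e::ab_group_add base_system \<Rightarrow> 'e \<Rightarrow> 'e \<Rightarrow> nat" where
  "xnum D \<mu> \<nu> = (if Re (form D (coroot D \<mu>) \<nu>) < 0
     then nat \<lfloor>1 - Re (form D (coroot D \<mu>) \<nu>)\<rfloor> else 1)"

datatype 'e gen = Hg 'e | Eg 'e

abbreviation "hh \<sigma> \<equiv> Gen (Hg \<sigma>)"
abbreviation "ee \<mu> \<equiv> Gen (Eg \<mu>)"

definition gens :: "'e::ab_group_add base_system \<Rightarrow> 'e gen set"
  where "gens D = range Hg \<union> Eg ` B_all D"

fun gen_parity :: "'e::ab_group_add base_system \<Rightarrow> 'e gen \<Rightarrow> bit" where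
  "gen_parity D (Hg \<sigma>) = 0"
| "gen_parity D (Eg \<mu>) = root_parity D \<mu>"

abbreviation ad_pow :: "'x lterm \<Rightarrow> nat \<Rightarrow> 'x lterm \<Rightarrow> 'x lterm"
  where "ad_pow s n t \<equiv> (Br s ^^ n) t"

definition rels_basic :: "'e::ab_group_add base_system \<Rightarrow> ('e gen lterm \<times> 'e gen lterm) set" where
  "rels_basic D =
     {(Add (Smult x (hh \<sigma>)) (Smult y (hh \<tau>)), hh (scl D x \<sigma> + scl D y \<tau>)) | x y \<sigma> \<tau>. True} \<union>
     {(Br (hh \<sigma>) (hh \<tau>), Zero) | \<sigma> \<tau>. True} \<union>
     {(Br (hh \<sigma>) (ee \<mu>), Smult (form D \<sigma> \<mu>) (ee \<mu>)) | \<sigma> \<mu>. \<mu> \<in> B_all D} \<union>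
     {(Br (ee \<mu>) (ee (- \<mu>)), hh (coroot D \<mu>)) | \<mu>. \<mu> \<in> B_plus D} \<union>
     {(ad_pow (ee \<mu>) (xnum D \<mu> \<nu>) (ee \<nu>), Zero) | \<mu> \<nu>.
        \<mu> \<in> B_all D \<and> \<nu> \<in> B_all D \<and> \<mu> \<noteq> \<nu> \<and> \<mu> + \<nu> \<noteq> 0}"

text \<open>The set \<open>S\<close> of triples is \<open>adm D\<close>, or part of it in the deformed case.\<close>
definition rels_star ::
    "'e::ab_group_add base_system \<Rightarrow> ('e \<times> 'e \<times> nat) set \<Rightarrow> ('e gen lterm \<times> 'e gen lterm) set" where
  "rels_star D S =
     {(Smult (of_nat (cnum D \<alpha>)) (ad_pow (ee (star D \<alpha>)) y (ee \<beta>)),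
       ad_pow (ee \<alpha>) (cnum D \<alpha> * y) (ee (star D \<beta>))) | \<alpha> \<beta> y. (\<alpha>, \<beta>, y) \<in> S} \<union>
     {(Smult ((- 1) ^ (cnum D \<alpha> + 1) * of_nat (cnum D \<alpha>))
         (ad_pow (ee (- star D \<alpha>)) y (ee (- \<beta>))),
       ad_pow (ee (- \<alpha>)) (cnum D \<alpha> * y) (ee (- star D \<beta>))) | \<alpha> \<beta> y. (\<alpha>, \<beta>, y) \<in> S}"

definition rels_mixed :: "'e::ab_group_add base_system \<Rightarrow> ('e gen lterm \<times> 'e gen lterm) set" where
  "rels_mixed D =
     {(ad_pow (ee \<alpha>) i (ad_pow (ee (star D \<alpha>)) (y - i) (ee \<beta>)), Zero) | \<alpha> \<beta> y i.
        (\<alpha>, \<beta>, y) \<in> adm D \<and> 1 \<le> i \<and> i \<le> y - 1} \<union>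
     {(ad_pow (ee (- \<alpha>)) i (ad_pow (ee (- star D \<alpha>)) (y - i) (ee (- \<beta>))), Zero) | \<alpha> \<beta> y i.
        (\<alpha>, \<beta>, y) \<in> adm D \<and> 1 \<le> i \<and> i \<le> y - 1}"

definition g_alg :: "'e::ab_group_add base_system \<Rightarrow> 'e gen lterm set lie_superalg" where
  "g_alg D = presented_lsa (gens D) (gen_parity D)
     (rels_basic D \<union> rels_star D (adm D) \<union> rels_mixed D)"

text \<open>
  For type \<open>Aff_A\<close> the triples for the ordered pairs \<open>(\<alpha>\<^sub>0, \<alpha>\<^sub>l)\<close> and \<open>(\<alpha>\<^sub>l, \<alpha>\<^sub>0)\<close> yield the
  same relations up to skew-symmetry; both are removed and replaced by the deformed ones.
\<close>
definition gq_alg ::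
    "complex \<Rightarrow> 'e::ab_group_add base_system \<Rightarrow> 'e gen lterm set lie_superalg" where
  "gq_alg q D = (let \<alpha>0 = sroot D 0; \<alpha>l = sroot D (rnk D) in
     presented_lsa (gens D) (gen_parity D)
       (rels_basic D \<union> rels_star D (adm D - {(\<alpha>0, \<alpha>l, 1), (\<alpha>l, \<alpha>0, 1)}) \<union> rels_mixed D \<union>
        {(Smult q (Br (ee (star D \<alpha>0)) (ee \<alpha>l)), Br (ee \<alpha>0) (ee (star D \<alpha>l))),
         (Smult (inverse q) (Br (ee (- star D \<alpha>0)) (ee (- \<alpha>l))),
          Br (ee (- \<alpha>0)) (ee (- star D \<alpha>l)))}))"

definition gbar :: "complex \<Rightarrow> 'e::ab_group_add base_system \<Rightarrow> 'e gen lterm set lie_superalg"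
  where "gbar q D = (if atype D = Aff_A then gq_alg q D else g_alg D)"

end

theory Submission
  imports Defs
begin

text \<open>
  Write \<open>u\<close> for the derived algebra of \<open>gbar q D\<close>, generated by the root vectors
  \<open>E\<^sub>\<mu>\<close>. It is perfect because \<open>E\<^sub>\<mu>\<close> is a multiple of \<open>[[E\<^sub>\<nu>, E\<^sub>-\<^sub>\<nu>], E\<^sub>\<mu>]\<close> with
  \<open>\<nu> = \<mu>\<close> or \<open>\<nu> = -\<mu>\<close>. The substance is the lifting property: given a central extension
  \<open>W : B \<rightarrow> A\<close>, the images \<open>x\<^sub>\<mu>\<close> in \<open>A\<close> of the root vectors have to be lifted to elements of \<open>B\<close>
  that satisfy the relations of \<open>u\<close>.

  Brackets in \<open>B\<close> depend only on the images of their arguments in \<open>A\<close>. So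
  \<open>h\<^sub>\<mu> = [z\<^sub>\<mu>, z\<^sub>-\<^sub>\<mu>]\<close> does not depend on the choice of lifts \<open>z\<close>, and the elements \<open>y\<^sub>\<mu>\<close>,
  suitable multiples of \<open>[h\<^sub>\<nu>, z\<^sub>\<mu>]\<close>, are lifts that are eigenvectors of all \<open>h\<^sub>\<nu>\<close> with the
  expected eigenvalues (\<open>cartan_lift\<close>). Each Serre type relation \<open>s = t\<close> between root vectors
  is homogeneous, of a weight on which some \<open>h\<^sub>\<nu>\<close> acts by a nonzero scalar
  (\<open>serre_rels_homogeneous\<close>); for the relations that involve two simple roots this comes down to
  the fact that no entry of the Cartan matrix is \<open>-4\<close> (\<open>pair_regular\<close>). As
  \<open>h\<^sub>\<nu>\<close> annihilates the kernel of \<open>W\<close>, which contains the difference of the two sides, the relation holds for the \<open>y\<^sub>\<mu>\<close> (\<open>lifted_relation\<close>).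

  The relations between the Cartan elements themselves have weight zero and escape this argument.
  There is one coroot for each root \<open>\<alpha>\<^sub>i\<close> and one for each \<open>\<alpha>\<^sub>i*\<close>, but they span a space of
  dimension only \<open>l + 2\<close>; what has to be shown is that the element of \<open>B\<close> dual to the isotropic
  vector \<open>a\<close>, computed from \<open>\<alpha>\<^sub>i\<close> and \<open>\<alpha>\<^sub>i*\<close>, is the same for all \<open>i\<close> (\<open>dual_star\<close>).
  For neighbouring roots this follows by bracketing the two sides of a relation of \<open>rels_star\<close>
  with the two sides of the opposite relation: the bracket of opposite vectors of weight \<open>\<plusminus>\<lambda>\<close> is a
  multiple of the Cartan element dual to \<open>\<lambda>\<close> (\<open>string_pairing\<close>), and the two sides express
  \<open>\<lambda>\<close> in two ways through the simple roots and their starred versions (\<open>dual_edge\<close>). The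
  edges other than the one that carries the parameter \<open>q\<close> connect the diagram
  (\<open>dynkin_connected\<close>).

  It remains to know that \<open>u\<close> is presented by these relations, although \<open>gbar q D\<close> contains
  further Cartan elements, which act on \<open>u\<close> as derivations. A diagonal
  derivation exists on every algebra with weight homogeneous relations, and the semidirect product
  of such an algebra with its derivations satisfies all relations of \<open>gbar q D\<close>. Hence
  root vectors satisfy in \<open>gbar q D\<close> only relations that already hold when \<open>h\<^sub>\<sigma>\<close> acts
  through the projection of \<open>\<sigma>\<close> to the span of the roots and \<open>a\<close> (\<open>lcong_descends\<close>,
  \<open>derived_presentation\<close>).
\<close>

section \<open>Complex modules and linear functionals\<close>

lemma complex_ring_simps [simp]:
  "carrier complex_ring = UNIV"
  "a \<oplus>\<^bsub>complex_ring\<^esub> b = a + b"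
  "a \<otimes>\<^bsub>complex_ring\<^esub> b = a * b"
  "\<zero>\<^bsub>complex_ring\<^esub> = 0"
  "\<one>\<^bsub>complex_ring\<^esub> = 1"
  by (simp_all add: ring_of_type_algebra_def)

lemma cring_complex_ring: "cring complex_ring"
  by (rule cring_from_type_algebra)

lemma complex_ring_minus [simp]: "\<ominus>\<^bsub>complex_ring\<^esub> a = - a"
proof -
  interpret cring complex_ring by (rule cring_complex_ring)
  have "- a = \<ominus>\<^bsub>complex_ring\<^esub> a"
    by (rule minus_equality[of "- a" a, simplified, symmetric])
  then show ?thesis by simp
qed

definition functionals :: "(complex, 'a, 'm) module_scheme \<Rightarrow> ('a \<Rightarrow> complex) set" where
  "functionals M = {\<phi>. (\<forall>x \<in> carrier M. \<forall>y \<in> carrier M. \<phi> (x \<oplus>\<^bsub>M\<^esub> y) = \<phi> x + \<phi> y) \<and>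
     (\<forall>c. \<forall>x \<in> carrier M. \<phi> (c \<odot>\<^bsub>M\<^esub> x) = c * \<phi> x)}"

locale cmodule = Module.module complex_ring M for M (structure)
begin

lemma smult_closed' [simp, intro]: "x \<in> carrier M \<Longrightarrow> c \<odot> x \<in> carrier M"
  using smult_closed by simp

lemma smult_left_add: "x \<in> carrier M \<Longrightarrow> (c + d) \<odot> x = c \<odot> x \<oplus> d \<odot> x"
  using smult_l_distr[of c d x] by simp

lemma smult_right_add: "x \<in> carrier M \<Longrightarrow> y \<in> carrier M \<Longrightarrow> c \<odot> (x \<oplus> y) = c \<odot> x \<oplus> c \<odot> y"
  using smult_r_distr[of c x y] by simp

lemma smult_mult: "x \<in> carrier M \<Longrightarrow> (c * d) \<odot> x = c \<odot> (d \<odot> x)"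
  using smult_assoc1[of c d x] by simp

lemma smult_1 [simp]: "x \<in> carrier M \<Longrightarrow> 1 \<odot> x = x"
  using smult_one[of x] by simp

lemma smult_0 [simp]: "x \<in> carrier M \<Longrightarrow> 0 \<odot> x = \<zero>"
  using smult_l_null[of x] by simp

lemma smult_zero [simp]: "c \<odot> \<zero> = \<zero>"
  using smult_r_null[of c] by simp

lemma minus_smult: "x \<in> carrier M \<Longrightarrow> \<ominus> x = (- 1) \<odot> x"
  using smult_l_minus[of 1 x] by simp

lemma functional_add [simp]:
  "\<phi> \<in> functionals M \<Longrightarrow> x \<in> carrier M \<Longrightarrow> y \<in> carrier M \<Longrightarrow> \<phi> (x \<oplus> y) = \<phi> x + \<phi> y"
  by (simp add: functionals_def)

lemma functional_smult [simp]:
  "\<phi> \<in> functionals M \<Longrightarrow> x \<in> carrier M \<Longrightarrow> \<phi> (c \<odot> x) = c * \<phi> x"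
  by (simp add: functionals_def)

lemma functional_zero [simp]: "\<phi> \<in> functionals M \<Longrightarrow> \<phi> \<zero> = 0"
  using functional_smult[of \<phi> \<zero> 0] by simp

lemma functional_minus [simp]: "\<phi> \<in> functionals M \<Longrightarrow> x \<in> carrier M \<Longrightarrow> \<phi> (\<ominus> x) = - \<phi> x"
  by (simp add: minus_smult)

lemma submoduleI':
  assumes "H \<subseteq> carrier M" "\<zero> \<in> H" "\<And>x y. x \<in> H \<Longrightarrow> y \<in> H \<Longrightarrow> x \<oplus> y \<in> H"
    "\<And>c x. x \<in> H \<Longrightarrow> c \<odot> x \<in> H"
  shows "submodule H complex_ring M"
proof (rule submodule.intro)
  have "\<And>x. x \<in> H \<Longrightarrow> \<ominus> x \<in> H"
    using assms minus_smult by (metis subsetD)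
  then show "subgroup H (add_monoid M)"
    by unfold_locales (use assms in \<open>auto simp: a_inv_def\<close>)
qed (use assms in \<open>auto simp: submodule_axioms_def\<close>)

lemma submodule_simps:
  assumes "submodule H complex_ring M"
  shows "H \<subseteq> carrier M" "\<zero> \<in> H" "x \<in> H \<Longrightarrow> y \<in> H \<Longrightarrow> x \<oplus> y \<in> H" "x \<in> H \<Longrightarrow> c \<odot> x \<in> H"
proof -
  interpret submodule H complex_ring M by fact
  show "H \<subseteq> carrier M" "\<zero> \<in> H" "x \<in> H \<Longrightarrow> y \<in> H \<Longrightarrow> x \<oplus> y \<in> H"
    using subset one_closed m_closed by auto
  show "x \<in> H \<Longrightarrow> c \<odot> x \<in> H"
    by (rule smult_closed) auto
qed

text \<open>
  Linear functionals separate points: a submodule that is maximal among those not containing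
  \<open>x\<close> has codimension one. Together with \<open>functionals_eqI\<close> below this reduces identities
  between linear combinations of vectors to identities between complex numbers.
\<close>
lemma exists_functional:
  assumes x: "x \<in> carrier M" "x \<noteq> \<zero>"
  shows "\<exists>\<phi> \<in> functionals M. \<phi> x \<noteq> 0"
proof -
  define A where "A = {H. submodule H complex_ring M \<and> x \<notin> H}"
  have "{\<zero>} \<in> A"
    using x by (auto simp: A_def intro!: submoduleI')
  have chain: "\<Union>C \<in> A" if "C \<noteq> {}" and C: "subset.chain A C" for C
  proof -
    have sub: "\<And>H. H \<in> C \<Longrightarrow> submodule H complex_ring M" "x \<notin> \<Union>C"
      using C by (auto simp: A_def subset.chain_def)
    have "submodule (\<Union>C) complex_ring M"
    proof (rule submoduleI')
      show "\<Union>C \<subseteq> carrier M" using submodule_simps(1)[OF sub(1)] by blast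
      show "\<zero> \<in> \<Union>C" using submodule_simps(2)[OF sub(1)] \<open>C \<noteq> {}\<close> by blast
      show "c \<odot> y \<in> \<Union>C" if "y \<in> \<Union>C" for c y
        using submodule_simps(4)[OF sub(1)] that by blast
      show "y \<oplus> z \<in> \<Union>C" if yz: "y \<in> \<Union>C" "z \<in> \<Union>C" for y z
      proof -
        obtain H K where HK: "H \<in> C" "K \<in> C" "y \<in> H" "z \<in> K" using yz by blast
        then have "H \<subseteq> K \<or> K \<subseteq> H"
          using C by (auto simp: subset.chain_def)
        then show ?thesis
          using HK submodule_simps(3)[OF sub(1)] by (metis UnionI subsetD)
      qed
    qed
    then show ?thesis using sub(2) by (simp add: A_def)
  qed
  \<comment> \<open>The carrier is \<open>N + \<complex>x\<close>, and the coefficient of \<open>x\<close> is the functional that is looked for.\<close>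
  obtain N where "N \<in> A" and max: "\<And>H. H \<in> A \<Longrightarrow> N \<subseteq> H \<Longrightarrow> H = N"
    using subset_Zorn_nonempty[of A] \<open>{\<zero>} \<in> A\<close> chain by (metis empty_iff)
  then have N: "submodule N complex_ring M" "x \<notin> N" by (auto simp: A_def)
  note Ns = submodule_simps[OF N(1)]
  have split: "\<exists>c. \<exists>n \<in> N. y = n \<oplus> c \<odot> x" if y: "y \<in> carrier M" for y
  proof (cases "y \<in> N")
    case True
    then show ?thesis using x y by (intro exI[of _ 0] bexI[of _ y]) auto
  next
    case False
    define H where "H = {n \<oplus> c \<odot> y | n c. n \<in> N}"
    have H: "submodule H complex_ring M"
    proof (rule submoduleI')
      show "H \<subseteq> carrier M" using Ns(1) y by (auto simp: H_def)
      show "\<zero> \<in> H" unfolding H_def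
        using Ns(1,2) y by (intro CollectI exI[of _ \<zero>] exI[of _ 0]) auto
      show "u \<oplus> v \<in> H" if uv: "u \<in> H" "v \<in> H" for u v
      proof -
        obtain n c m d where "u = n \<oplus> c \<odot> y" "v = m \<oplus> d \<odot> y" "n \<in> N" "m \<in> N"
          using uv unfolding H_def by blast
        moreover from this have "u \<oplus> v = (n \<oplus> m) \<oplus> (c + d) \<odot> y"
          using Ns(1) y by (simp add: smult_left_add a_ac subsetD)
        ultimately show ?thesis using Ns(3) by (auto simp: H_def)
      qed
      show "e \<odot> u \<in> H" if u: "u \<in> H" for e u
      proof -
        obtain n c where "u = n \<oplus> c \<odot> y" "n \<in> N"
          using u unfolding H_def by blast
        moreover from this have "e \<odot> u = e \<odot> n \<oplus> (e * c) \<odot> y"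
          using Ns(1) y by (simp add: smult_right_add smult_mult subsetD)
        ultimately show ?thesis using Ns(4) by (auto simp: H_def)
      qed
    qed
    have "y \<in> H" unfolding H_def
      using Ns(1,2) y by (intro CollectI exI[of _ \<zero>] exI[of _ 1]) auto
    moreover have "N \<subseteq> H"
    proof
      fix n assume "n \<in> N"
      then show "n \<in> H" unfolding H_def
        using Ns(1) y by (intro CollectI exI[of _ n] exI[of _ 0]) auto
    qed
    ultimately have "x \<in> H" using max[of H] H False by (auto simp: A_def)
    then obtain n c where n: "x = n \<oplus> c \<odot> y" "n \<in> N" by (auto simp: H_def)
    have nM: "n \<in> carrier M" using n Ns(1) by blast
    have "c \<noteq> 0" using n N(2) y nM by auto
    have "(- inverse c) \<odot> n \<oplus> inverse c \<odot> x
        = ((- inverse c) \<odot> n \<oplus> inverse c \<odot> n) \<oplus> (inverse c * c) \<odot> y"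
      using nM y by (simp add: n(1) smult_right_add smult_mult a_assoc)
    also have "(- inverse c) \<odot> n \<oplus> inverse c \<odot> n = \<zero>"
      using nM by (simp flip: smult_left_add)
    finally have "y = (- inverse c) \<odot> n \<oplus> inverse c \<odot> x"
      using \<open>c \<noteq> 0\<close> y by simp
    then show ?thesis using Ns(4) n(2) by blast
  qed
  have unique: "c = d" if "n \<oplus> c \<odot> x = m \<oplus> d \<odot> x" "n \<in> N" "m \<in> N" for n m c d
  proof (rule ccontr)
    assume "c \<noteq> d"
    have nm: "n \<in> carrier M" "m \<in> carrier M" using that Ns(1) by auto
    have "(c - d) \<odot> x = c \<odot> x \<oplus> (- d) \<odot> x"
      using x smult_left_add[of x c "- d"] by simp
    also have "\<dots> = (\<ominus> n \<oplus> (n \<oplus> c \<odot> x)) \<oplus> (- d) \<odot> x"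
      using nm x by (simp add: r_neg1)
    also have "\<dots> = (\<ominus> n \<oplus> (m \<oplus> d \<odot> x)) \<oplus> (- d) \<odot> x"
      using that by simp
    also have "\<dots> = (m \<oplus> \<ominus> n) \<oplus> (d \<odot> x \<oplus> (- d) \<odot> x)"
      using nm x by (simp add: a_ac)
    also have "d \<odot> x \<oplus> (- d) \<odot> x = \<zero>"
      using x by (simp flip: smult_left_add)
    finally have "(c - d) \<odot> x = m \<oplus> (- 1) \<odot> n"
      using nm by (simp add: minus_smult)
    then have "(c - d) \<odot> x \<in> N" using Ns(3,4) that by simp
    then have "inverse (c - d) \<odot> ((c - d) \<odot> x) \<in> N" by (rule Ns(4))
    then show False using N(2) x \<open>c \<noteq> d\<close> by (simp flip: smult_mult)
  qed
  define \<phi> where "\<phi> y = (THE c. \<exists>n \<in> N. y = n \<oplus> c \<odot> x)" for y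
  have \<phi>: "\<phi> (n \<oplus> c \<odot> x) = c" if "n \<in> N" for n c
    unfolding \<phi>_def using unique that by (intro the_equality) auto
  have "\<phi> \<in> functionals M"
    unfolding functionals_def
  proof (intro CollectI conjI ballI allI)
    fix y z assume yz: "y \<in> carrier M" "z \<in> carrier M"
    obtain c n d m where *: "y = n \<oplus> c \<odot> x" "z = m \<oplus> d \<odot> x" "n \<in> N" "m \<in> N"
      using split[OF yz(1)] split[OF yz(2)] by blast
    have "y \<oplus> z = (n \<oplus> m) \<oplus> (c + d) \<odot> x"
      using * Ns(1) x by (simp add: smult_left_add a_ac subsetD)
    then show "\<phi> (y \<oplus> z) = \<phi> y + \<phi> z"
      using * Ns(3) by (simp add: \<phi>)
  next
    fix e y assume y: "y \<in> carrier M"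
    obtain c n where *: "y = n \<oplus> c \<odot> x" "n \<in> N"
      using split[OF y] by blast
    have "e \<odot> y = e \<odot> n \<oplus> (e * c) \<odot> x"
      using * Ns(1) x by (simp add: smult_right_add smult_mult subsetD)
    then show "\<phi> (e \<odot> y) = e * \<phi> y"
      using * Ns(4) by (simp add: \<phi>)
  qed
  moreover have "\<phi> x = 1"
    using \<phi>[of \<zero> 1] Ns(2) x by simp
  ultimately show ?thesis by (intro bexI[of _ \<phi>]) auto
qed

lemma functionals_eqI:
  assumes "x \<in> carrier M" "y \<in> carrier M" "\<And>\<phi>. \<phi> \<in> functionals M \<Longrightarrow> \<phi> x = \<phi> y"
  shows "x = y"
proof (rule ccontr)
  assume "x \<noteq> y"
  then have "x \<oplus> (- 1) \<odot> y \<noteq> \<zero>"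
    using assms(1,2) by (metis minus_smult minus_equality minus_minus a_inv_closed a_comm)
  then obtain \<phi> where "\<phi> \<in> functionals M" "\<phi> (x \<oplus> (- 1) \<odot> y) \<noteq> 0"
    using exists_functional[of "x \<oplus> (- 1) \<odot> y"] assms(1,2) by auto
  then show False using assms by simp
qed

end

section \<open>Algebras satisfying the Lie superalgebra identities\<close>

text \<open>
  These are the axioms of a Lie superalgebra except for the decomposition of the carrier into the two
  parts. A presented algebra satisfies them for arbitrary relations, whereas its parts
  intersect trivially only if the relations respect parities.
\<close>
locale bracket_superalgebra = cmodule L for L :: "'a lie_superalg" (structure) +
  assumes part_carrier: "x \<in> part L i \<Longrightarrow> x \<in> carrier L"
    and brk_closed [simp, intro]: "x \<in> carrier L \<Longrightarrow> y \<in> carrier L \<Longrightarrow> x \<otimes> y \<in> carrier L"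
    and brk_add_left: "\<lbrakk>x \<in> carrier L; y \<in> carrier L; z \<in> carrier L\<rbrakk>
          \<Longrightarrow> (x \<oplus> y) \<otimes> z = x \<otimes> z \<oplus> y \<otimes> z"
    and brk_add_right: "\<lbrakk>x \<in> carrier L; y \<in> carrier L; z \<in> carrier L\<rbrakk>
          \<Longrightarrow> x \<otimes> (y \<oplus> z) = x \<otimes> y \<oplus> x \<otimes> z"
    and brk_smult_left: "\<lbrakk>x \<in> carrier L; y \<in> carrier L\<rbrakk> \<Longrightarrow> (c \<odot> x) \<otimes> y = c \<odot> (x \<otimes> y)"
    and brk_smult_right: "\<lbrakk>x \<in> carrier L; y \<in> carrier L\<rbrakk> \<Longrightarrow> x \<otimes> (c \<odot> y) = c \<odot> (x \<otimes> y)"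
    and brk_skew: "\<lbrakk>x \<in> part L i; y \<in> part L j\<rbrakk> \<Longrightarrow> x \<otimes> y = (- koszul i j) \<odot> (y \<otimes> x)"
    and brk_jacobi: "\<lbrakk>x \<in> part L i; y \<in> part L j; z \<in> carrier L\<rbrakk>
          \<Longrightarrow> x \<otimes> (y \<otimes> z) = (x \<otimes> y) \<otimes> z \<oplus> koszul i j \<odot> (y \<otimes> (x \<otimes> z))"
begin

lemma brk_zero [simp]: "x \<in> carrier L \<Longrightarrow> x \<otimes> \<zero> = \<zero>" "x \<in> carrier L \<Longrightarrow> \<zero> \<otimes> x = \<zero>"
  using brk_smult_left[of x x 0] brk_smult_right[of x x 0]
    brk_smult_left[of \<zero> x 0] brk_smult_right[of x \<zero> 0] by simp_all

lemmas brk_linear = brk_add_left brk_add_right brk_smult_left brk_smult_right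

end

sublocale lie_superalgebra \<subseteq> bracket_superalgebra
proof unfold_locales
  fix x i assume "x \<in> part L i"
  moreover have "cmodule L" by (intro cmodule.intro module_axioms)
  ultimately show "x \<in> carrier L"
    using cmodule.submodule_simps(1)[of L, OF _ part_submodule] by blast
qed (fact bracket_closed bracket_add_left bracket_add_right bracket_smult_left
      bracket_smult_right bracket_skew bracket_jacobi)+

section \<open>Algebras given by generators and relations\<close>

lemma lterms_simps [simp]:
  "Zero \<in> lterms G" "Gen x \<in> lterms G \<longleftrightarrow> x \<in> G"
  "Add s t \<in> lterms G \<longleftrightarrow> s \<in> lterms G \<and> t \<in> lterms G"
  "Smult c t \<in> lterms G \<longleftrightarrow> t \<in> lterms G"
  "Br s t \<in> lterms G \<longleftrightarrow> s \<in> lterms G \<and> t \<in> lterms G"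
  by (auto simp: lterms_def)

lemma lcong_lterms: "(s, t) \<in> lcong G p R \<Longrightarrow> s \<in> lterms G \<and> t \<in> lterms G"
  by (induction rule: lcong.induct) auto

definition term_class :: "'x set \<Rightarrow> ('x \<Rightarrow> bit) \<Rightarrow> ('x lterm \<times> 'x lterm) set \<Rightarrow> 'x lterm \<Rightarrow> 'x lterm set"
  where "term_class G p R t = lcong G p R `` {t}"

lemma term_class_eq_iff:
  assumes "s \<in> lterms G" "t \<in> lterms G"
  shows "term_class G p R s = term_class G p R t \<longleftrightarrow> (s, t) \<in> lcong G p R"
proof
  assume "term_class G p R s = term_class G p R t"
  moreover have "t \<in> term_class G p R t" using assms by (simp add: term_class_def lcong.refl)
  ultimately show "(s, t) \<in> lcong G p R" by (auto simp: term_class_def)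
qed (auto simp: term_class_def intro: lcong.sym lcong.trans)

lemma term_class_eqI: "(s, t) \<in> lcong G p R \<Longrightarrow> term_class G p R s = term_class G p R t"
  using lcong_lterms term_class_eq_iff by blast

lemma presented_ops:
  "s \<in> lterms G \<Longrightarrow> t \<in> lterms G \<Longrightarrow>
    term_class G p R s \<oplus>\<^bsub>presented_lsa G p R\<^esub> term_class G p R t = term_class G p R (Add s t)"
  "s \<in> lterms G \<Longrightarrow> t \<in> lterms G \<Longrightarrow>
    term_class G p R s \<otimes>\<^bsub>presented_lsa G p R\<^esub> term_class G p R t = term_class G p R (Br s t)"
  "t \<in> lterms G \<Longrightarrow> c \<odot>\<^bsub>presented_lsa G p R\<^esub> term_class G p R t = term_class G p R (Smult c t)"
proof -
  have self: "u \<in> lterms G \<Longrightarrow> u \<in> term_class G p R u" for u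
    by (simp add: term_class_def lcong.refl)
  have rep: "u \<in> term_class G p R v \<Longrightarrow> (v, u) \<in> lcong G p R" for u v
    by (auto simp: term_class_def)
  show "term_class G p R s \<oplus>\<^bsub>presented_lsa G p R\<^esub> term_class G p R t = term_class G p R (Add s t)"
    if "s \<in> lterms G" "t \<in> lterms G"
    unfolding presented_lsa_def Let_def
    using self[OF that(1)] self[OF that(2)]
    by (simp flip: term_class_def) (use rep term_class_eqI lcong.Add_cong in blast)
  show "term_class G p R s \<otimes>\<^bsub>presented_lsa G p R\<^esub> term_class G p R t = term_class G p R (Br s t)"
    if "s \<in> lterms G" "t \<in> lterms G"
    unfolding presented_lsa_def Let_def
    using self[OF that(1)] self[OF that(2)]
    by (simp flip: term_class_def) (use rep term_class_eqI lcong.Br_cong in blast)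
  show "c \<odot>\<^bsub>presented_lsa G p R\<^esub> term_class G p R t = term_class G p R (Smult c t)"
    if "t \<in> lterms G"
    unfolding presented_lsa_def Let_def
    using self[OF that]
    by (simp flip: term_class_def) (use rep term_class_eqI lcong.Smult_cong in blast)
qed

lemma presented_carrier: "carrier (presented_lsa G p R) = term_class G p R ` lterms G"
  by (auto simp: presented_lsa_def Let_def quotient_def term_class_def)

lemma presented_zero: "\<zero>\<^bsub>presented_lsa G p R\<^esub> = term_class G p R Zero"
  by (auto simp: presented_lsa_def Let_def term_class_def)

lemma presented_part:
  "part (presented_lsa G p R) i = {term_class G p R t | t. t \<in> lterms G \<and> homog p i t}"
  by (auto simp: presented_lsa_def Let_def term_class_def)

lemma presented_bracket_superalgebra: "bracket_superalgebra (presented_lsa G p R)"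
proof -
  let ?L = "presented_lsa G p R"
  let ?c = "term_class G p R"
  note ops = presented_ops presented_zero
  have ex: "x \<in> carrier ?L \<Longrightarrow> \<exists>t \<in> lterms G. x = ?c t" for x
    by (auto simp: presented_carrier)
  have car: "t \<in> lterms G \<Longrightarrow> ?c t \<in> carrier ?L" for t
    by (auto simp: presented_carrier)
  have ag: "abelian_group ?L"
  proof (rule abelian_groupI)
    fix x y z assume "x \<in> carrier ?L" "y \<in> carrier ?L" "z \<in> carrier ?L"
    then obtain r s t where "x = ?c r" "y = ?c s" "z = ?c t" "r \<in> lterms G" "s \<in> lterms G" "t \<in> lterms G"
      by (metis ex)
    then show "x \<oplus>\<^bsub>?L\<^esub> y \<oplus>\<^bsub>?L\<^esub> z = x \<oplus>\<^bsub>?L\<^esub> (y \<oplus>\<^bsub>?L\<^esub> z)"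
      by (simp add: ops term_class_eq_iff lcong.Add_assoc)
  next
    fix x y assume "x \<in> carrier ?L" "y \<in> carrier ?L"
    then obtain r s where *: "x = ?c r" "y = ?c s" "r \<in> lterms G" "s \<in> lterms G"
      by (metis ex)
    then show "x \<oplus>\<^bsub>?L\<^esub> y \<in> carrier ?L" by (simp add: ops car)
    show "x \<oplus>\<^bsub>?L\<^esub> y = y \<oplus>\<^bsub>?L\<^esub> x"
      using * by (simp add: ops term_class_eq_iff lcong.Add_commute)
  next
    show "\<zero>\<^bsub>?L\<^esub> \<in> carrier ?L" by (simp add: ops car)
  next
    fix x assume "x \<in> carrier ?L"
    then obtain t where *: "x = ?c t" "t \<in> lterms G" using ex by blast
    have "(Add Zero t, t) \<in> lcong G p R" "(Add (Smult (- 1) t) t, Zero) \<in> lcong G p R"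
      using *(2) by (auto intro: lcong.trans[OF lcong.Add_commute] lcong.Add_Zero lcong.Add_neg)
    then show "\<zero>\<^bsub>?L\<^esub> \<oplus>\<^bsub>?L\<^esub> x = x" "\<exists>y \<in> carrier ?L. y \<oplus>\<^bsub>?L\<^esub> x = \<zero>\<^bsub>?L\<^esub>"
      using * by (auto simp: ops car term_class_eqI intro!: bexI[of _ "?c (Smult (- 1) t)"])
  qed
  have "Module.module complex_ring ?L"
  proof (rule moduleI[OF cring_complex_ring ag])
    fix c d x y assume "x \<in> carrier ?L" "y \<in> carrier ?L"
    then obtain r s where *: "x = ?c r" "y = ?c s" "r \<in> lterms G" "s \<in> lterms G"
      by (metis ex)
    then show "c \<odot>\<^bsub>?L\<^esub> (x \<oplus>\<^bsub>?L\<^esub> y) = c \<odot>\<^bsub>?L\<^esub> x \<oplus>\<^bsub>?L\<^esub> c \<odot>\<^bsub>?L\<^esub> y"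
      by (simp add: ops term_class_eq_iff lcong.Smult_Add)
  next
    fix c d x assume "x \<in> carrier ?L"
    then obtain r where *: "x = ?c r" "r \<in> lterms G"
      by (metis ex)
    then show "c \<odot>\<^bsub>?L\<^esub> x \<in> carrier ?L" by (simp add: ops car)
    show "(c \<oplus>\<^bsub>complex_ring\<^esub> d) \<odot>\<^bsub>?L\<^esub> x = c \<odot>\<^bsub>?L\<^esub> x \<oplus>\<^bsub>?L\<^esub> d \<odot>\<^bsub>?L\<^esub> x"
      "(c \<otimes>\<^bsub>complex_ring\<^esub> d) \<odot>\<^bsub>?L\<^esub> x = c \<odot>\<^bsub>?L\<^esub> (d \<odot>\<^bsub>?L\<^esub> x)"
      "\<one>\<^bsub>complex_ring\<^esub> \<odot>\<^bsub>?L\<^esub> x = x"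
      using * by (simp_all add: ops term_class_eq_iff lcong.Smult_plus lcong.Smult_Smult lcong.Smult_one)
  qed
  then interpret cmodule ?L by (rule cmodule.intro)
  show ?thesis
  proof unfold_locales
    fix x i assume "x \<in> part ?L i"
    then show "x \<in> carrier ?L" by (auto simp: presented_part presented_carrier)
  next
    fix x y z assume "x \<in> carrier ?L" "y \<in> carrier ?L" "z \<in> carrier ?L"
    then obtain r s t where *: "x = ?c r" "y = ?c s" "z = ?c t" "r \<in> lterms G" "s \<in> lterms G" "t \<in> lterms G"
      by (metis ex)
    show "(x \<oplus>\<^bsub>?L\<^esub> y) \<otimes>\<^bsub>?L\<^esub> z = x \<otimes>\<^bsub>?L\<^esub> z \<oplus>\<^bsub>?L\<^esub> y \<otimes>\<^bsub>?L\<^esub> z"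
      "x \<otimes>\<^bsub>?L\<^esub> (y \<oplus>\<^bsub>?L\<^esub> z) = x \<otimes>\<^bsub>?L\<^esub> y \<oplus>\<^bsub>?L\<^esub> x \<otimes>\<^bsub>?L\<^esub> z"
      using * by (simp_all add: ops term_class_eq_iff lcong.Br_Add_left lcong.Br_Add_right)
  next
    fix x y c assume "x \<in> carrier ?L" "y \<in> carrier ?L"
    then obtain r s where *: "x = ?c r" "y = ?c s" "r \<in> lterms G" "s \<in> lterms G"
      by (metis ex)
    show "x \<otimes>\<^bsub>?L\<^esub> y \<in> carrier ?L" using * by (simp add: ops car)
    show "c \<odot>\<^bsub>?L\<^esub> x \<otimes>\<^bsub>?L\<^esub> y = c \<odot>\<^bsub>?L\<^esub> (x \<otimes>\<^bsub>?L\<^esub> y)" "x \<otimes>\<^bsub>?L\<^esub> (c \<odot>\<^bsub>?L\<^esub> y) = c \<odot>\<^bsub>?L\<^esub> (x \<otimes>\<^bsub>?L\<^esub> y)"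
      using * by (simp_all add: ops term_class_eq_iff lcong.Br_Smult_left lcong.Br_Smult_right)
  next
    fix x y i j assume "x \<in> part ?L i" "y \<in> part ?L j"
    then obtain r s where *: "x = ?c r" "y = ?c s" "r \<in> lterms G" "s \<in> lterms G" "homog p i r" "homog p j s"
      by (auto simp: presented_part)
    then show "x \<otimes>\<^bsub>?L\<^esub> y = (- koszul i j) \<odot>\<^bsub>?L\<^esub> (y \<otimes>\<^bsub>?L\<^esub> x)"
      by (simp add: ops term_class_eq_iff lcong.skew)
  next
    fix x y z i j assume "x \<in> part ?L i" "y \<in> part ?L j" "z \<in> carrier ?L"
    then obtain r s t where *: "x = ?c r" "y = ?c s" "r \<in> lterms G" "s \<in> lterms G" "homog p i r" "homog p j s"
       "z = ?c t" "t \<in> lterms G"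
      using ex[of z] by (auto simp: presented_part)
    then show "x \<otimes>\<^bsub>?L\<^esub> (y \<otimes>\<^bsub>?L\<^esub> z) = (x \<otimes>\<^bsub>?L\<^esub> y) \<otimes>\<^bsub>?L\<^esub> z \<oplus>\<^bsub>?L\<^esub> koszul i j \<odot>\<^bsub>?L\<^esub> (y \<otimes>\<^bsub>?L\<^esub> (x \<otimes>\<^bsub>?L\<^esub> z))"
      by (simp add: ops term_class_eq_iff lcong.jacobi)
  qed
qed

section \<open>Evaluation of terms in a Lie superalgebra\<close>

fun term_eval :: "'a lie_superalg \<Rightarrow> ('x \<Rightarrow> 'a) \<Rightarrow> 'x lterm \<Rightarrow> 'a" where
  "term_eval L f Zero = \<zero>\<^bsub>L\<^esub>"
| "term_eval L f (Gen x) = f x"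
| "term_eval L f (Add s t) = term_eval L f s \<oplus>\<^bsub>L\<^esub> term_eval L f t"
| "term_eval L f (Smult c t) = c \<odot>\<^bsub>L\<^esub> term_eval L f t"
| "term_eval L f (Br s t) = term_eval L f s \<otimes>\<^bsub>L\<^esub> term_eval L f t"

context bracket_superalgebra
begin

lemma term_eval_closed:
  assumes "\<And>x. x \<in> G \<Longrightarrow> f x \<in> carrier L" "t \<in> lterms G"
  shows "term_eval L f t \<in> carrier L"
  using assms(2) by (induction t) (auto simp: assms(1))

end

context lie_superalgebra
begin

lemma part_zero: "\<zero> \<in> part L i"
  and part_add: "x \<in> part L i \<Longrightarrow> y \<in> part L i \<Longrightarrow> x \<oplus> y \<in> part L i"
  and part_smult: "x \<in> part L i \<Longrightarrow> c \<odot> x \<in> part L i"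
  using submodule_simps[OF part_submodule] by auto

lemma term_eval_part:
  assumes "\<And>x. x \<in> G \<Longrightarrow> f x \<in> part L (p x)" "homog p i t" "t \<in> lterms G"
  shows "term_eval L f t \<in> part L i"
  using assms(2,3)
proof (induction)
  case (5 i s j t)
  then have "term_eval L f s \<in> part L i" "term_eval L f t \<in> part L j" by simp_all
  then show ?case using bracket_part by simp
qed (simp_all add: assms(1) part_zero part_add part_smult)

text \<open>
  The universal property of a presented algebra: \<open>lcong\<close> is the least congruence, and in a Lie
  superalgebra all its closure rules hold.
\<close>
lemma term_eval_lcong:
  assumes "(s, t) \<in> lcong G p R"
    and f: "\<And>x. x \<in> G \<Longrightarrow> f x \<in> part L (p x)"
    and R: "\<And>s t. (s, t) \<in> R \<Longrightarrow> s \<in> lterms G \<Longrightarrow> t \<in> lterms G \<Longrightarrow> term_eval L f s = term_eval L f t"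
  shows "term_eval L f s = term_eval L f t"
proof -
  have cl: "term_eval L f t \<in> carrier L" if "t \<in> lterms G" for t
    using term_eval_closed[of G f t] f part_carrier that by blast
  note pt = term_eval_part[of G f p, OF f]
  from assms(1) show ?thesis
  proof (induction rule: lcong.induct)
    case (Add_neg t)
    then show ?case
      using cl[of t] by (simp flip: minus_smult add: r_neg)
  next
    case (skew s t i j)
    then show ?case using brk_skew[of _ i _ j] pt by simp
  next
    case (jacobi s t u i j)
    then show ?case using brk_jacobi[of _ i _ j] pt cl by simp
  qed (auto simp: R cl brk_linear smult_left_add smult_right_add smult_mult a_assoc intro: a_comm)
qed

end

section \<open>Adjoining diagonal derivations\<close>

fun diag_der :: "('x \<Rightarrow> complex) \<Rightarrow> 'x lterm \<Rightarrow> 'x lterm" where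
  "diag_der w Zero = Zero"
| "diag_der w (Gen x) = Smult (w x) (Gen x)"
| "diag_der w (Add s t) = Add (diag_der w s) (diag_der w t)"
| "diag_der w (Smult c t) = Smult c (diag_der w t)"
| "diag_der w (Br s t) = Add (Br (diag_der w s) t) (Br s (diag_der w t))"

text \<open>
  Every vector is a weight of \<^term>\<open>Zero\<close>, so that a relation \<open>t = 0\<close> can be homogeneous of any weight.
\<close>
inductive term_weight :: "('x \<Rightarrow> 'e::ab_group_add) \<Rightarrow> 'e \<Rightarrow> 'x lterm \<Rightarrow> bool" for wt where
  "term_weight wt \<mu> Zero"
| "term_weight wt (wt x) (Gen x)"
| "term_weight wt \<mu> s \<Longrightarrow> term_weight wt \<mu> t \<Longrightarrow> term_weight wt \<mu> (Add s t)"
| "term_weight wt \<mu> t \<Longrightarrow> term_weight wt \<mu> (Smult c t)"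
| "term_weight wt \<mu> s \<Longrightarrow> term_weight wt \<nu> t \<Longrightarrow> term_weight wt (\<mu> + \<nu>) (Br s t)"

text \<open>
  The component of a term along the derivations when each generator \<open>x\<close> is sent to
  \<open>x + tp x\<close> in the semidirect product of the presented algebra with a space of derivations; brackets
  have no such component because the derivations commute.
\<close>
fun top_part :: "(complex \<Rightarrow> 'e \<Rightarrow> 'e::ab_group_add) \<Rightarrow> ('x \<Rightarrow> 'e) \<Rightarrow> 'x lterm \<Rightarrow> 'e" where
  "top_part sc tp Zero = 0"
| "top_part sc tp (Gen x) = tp x"
| "top_part sc tp (Add s t) = top_part sc tp s + top_part sc tp t"
| "top_part sc tp (Smult c t) = sc c (top_part sc tp t)"
| "top_part sc tp (Br s t) = 0"

lemma diag_der_lterms [simp]: "t \<in> lterms G \<Longrightarrow> diag_der w t \<in> lterms G"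
  by (induction t) auto

lemma diag_der_homog: "homog p i t \<Longrightarrow> homog p i (diag_der w t)"
proof (induction rule: homog.induct)
  case (5 i s j t)
  then show ?case
    unfolding diag_der.simps by (metis homog.intros(3,5))
qed (simp_all add: homog.intros)

text \<open>
  A vector \<open>\<sigma>\<close> acts on the algebra presented by \<open>R\<close> as the diagonal derivation with eigenvalue
  \<open>J \<sigma> (wt x)\<close> on the generator \<open>x\<close>; homogeneity of \<open>R\<close> makes this well defined. Only even
  generators may have a component along the derivations, which are even.
\<close>
locale derivation_extension =
  fixes G :: "'x set" and p :: "'x \<Rightarrow> bit" and R :: "('x lterm \<times> 'x lterm) set"
    and sc :: "complex \<Rightarrow> 'e::ab_group_add \<Rightarrow> 'e" and J :: "'e \<Rightarrow> 'e \<Rightarrow> complex"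
    and wt :: "'x \<Rightarrow> 'e" and tp :: "'x \<Rightarrow> 'e"
  assumes vector_space: "vector_space sc"
    and J_add_left: "J (\<sigma> + \<tau>) \<mu> = J \<sigma> \<mu> + J \<tau> \<mu>"
    and J_scale_left: "J (sc c \<sigma>) \<mu> = c * J \<sigma> \<mu>"
    and J_add_right: "J \<sigma> (\<mu> + \<nu>) = J \<sigma> \<mu> + J \<sigma> \<nu>"
    and tp_even: "p x = 1 \<Longrightarrow> tp x = 0"
    and R_weight: "(s, t) \<in> R \<Longrightarrow> \<exists>\<mu>. term_weight wt \<mu> s \<and> term_weight wt \<mu> t"
begin

sublocale V: vector_space sc by (rule vector_space)

abbreviation L where "L \<equiv> presented_lsa G p R"

abbreviation cls where "cls \<equiv> term_class G p R"

sublocale L: bracket_superalgebra "presented_lsa G p R"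
  by (rule presented_bracket_superalgebra)

abbreviation der where "der \<sigma> \<equiv> diag_der (\<lambda>x. J \<sigma> (wt x))"

lemma J_zero_left: "J 0 \<mu> = 0"
  using J_add_left[of 0 0 \<mu>] by simp

lemma cls_closed [simp]: "t \<in> lterms G \<Longrightarrow> cls t \<in> carrier L"
  by (auto simp: presented_carrier)

lemma cls_part: "t \<in> lterms G \<Longrightarrow> homog p i t \<Longrightarrow> cls t \<in> part L i"
  by (auto simp: presented_part)

lemma cls_simps [simp]:
  "cls Zero = \<zero>\<^bsub>L\<^esub>"
  "s \<in> lterms G \<Longrightarrow> t \<in> lterms G \<Longrightarrow> cls (Add s t) = cls s \<oplus>\<^bsub>L\<^esub> cls t"
  "s \<in> lterms G \<Longrightarrow> t \<in> lterms G \<Longrightarrow> cls (Br s t) = cls s \<otimes>\<^bsub>L\<^esub> cls t"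
  "t \<in> lterms G \<Longrightarrow> cls (Smult c t) = c \<odot>\<^bsub>L\<^esub> cls t"
  by (simp_all add: presented_ops presented_zero)

lemma der_weight:
  assumes "term_weight wt \<mu> t" "t \<in> lterms G"
  shows "cls (der \<sigma> t) = J \<sigma> \<mu> \<odot>\<^bsub>L\<^esub> cls t"
  using assms
proof (induction)
  case (4 \<mu> t c)
  then show ?case by (simp flip: L.smult_mult add: mult.commute)
next
  case (5 \<mu> s \<nu> t)
  then show ?case by (simp add: J_add_right L.smult_left_add L.brk_linear)
qed (simp_all add: L.smult_right_add)

lemma der_cong:
  assumes "(s, t) \<in> lcong G p R"
  shows "cls (der \<sigma> s) = cls (der \<sigma> t)"
  using assms
proof (induction rule: lcong.induct)
  case (relation s t)
  then obtain \<mu> where "term_weight wt \<mu> s" "term_weight wt \<mu> t"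
    using R_weight by blast
  moreover have "cls s = cls t"
    using relation by (intro term_class_eqI lcong.relation)
  ultimately show ?case using relation by (simp add: der_weight)
next
  case (Add_cong s s' t t')
  then show ?case using lcong_lterms[of s s'] lcong_lterms[of t t'] by simp
next
  case (Smult_cong s s' c)
  then show ?case using lcong_lterms[of s s'] by simp
next
  case (Br_cong s s' t t')
  then have "cls s = cls s'" "cls t = cls t'" by (simp_all add: term_class_eqI)
  then show ?case
    using Br_cong lcong_lterms[of s s'] lcong_lterms[of t t'] by simp
next
  case (Add_neg t)
  then show ?case by (simp flip: L.minus_smult add: L.r_neg)
next
  case (skew s t i j)
  have pt: "cls s \<in> part L i" "cls t \<in> part L j" "cls (der \<sigma> s) \<in> part L i" "cls (der \<sigma> t) \<in> part L j"
    using skew by (simp_all add: cls_part diag_der_homog)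
  show ?case
    using skew L.brk_skew[OF pt(3,2)] L.brk_skew[OF pt(1,4)]
    by (simp add: L.smult_right_add L.a_comm)
next
  case (jacobi s t u i j)
  have pt: "cls s \<in> part L i" "cls t \<in> part L j" "cls (der \<sigma> s) \<in> part L i" "cls (der \<sigma> t) \<in> part L j"
    using jacobi by (simp_all add: cls_part diag_der_homog)
  have cl: "cls u \<in> carrier L" "cls (der \<sigma> u) \<in> carrier L" "cls s \<in> carrier L" "cls t \<in> carrier L"
    "cls (der \<sigma> s) \<in> carrier L"  "cls (der \<sigma> t) \<in> carrier L"
    using jacobi by simp_all
  show ?case
    using jacobi
    by (simp, intro L.functionals_eqI)
      (simp_all add: cl L.brk_linear L.brk_jacobi[OF pt(1,2)] L.brk_jacobi[OF pt(3,2)] L.brk_jacobi[OF pt(1,4)]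
        algebra_simps)
qed (simp_all add: L.brk_linear L.smult_left_add L.smult_right_add L.smult_mult L.a_ac)

lemma der_commute:
  assumes "t \<in> lterms G"
  shows "cls (der \<sigma> (der \<tau> t)) = cls (der \<tau> (der \<sigma> t))"
  using assms
proof (induction t)
  case (Gen x)
  then show ?case by (simp flip: L.smult_mult add: mult.commute)
next
  case (Br s t)
  then show ?case by (simp add: L.a_ac)
qed simp_all

lemma der_zero: "t \<in> lterms G \<Longrightarrow> cls (der 0 t) = \<zero>\<^bsub>L\<^esub>"
  by (induction t) (simp_all add: J_zero_left)

lemma der_der_zero: "t \<in> lterms G \<Longrightarrow> cls (der \<sigma> (der 0 t)) = \<zero>\<^bsub>L\<^esub>"
  using der_commute[of t \<sigma> 0] by (simp add: der_zero)

lemma der_add: "t \<in> lterms G \<Longrightarrow> cls (der (\<sigma> + \<tau>) t) = cls (der \<sigma> t) \<oplus>\<^bsub>L\<^esub> cls (der \<tau> t)"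
  by (induction t) (simp_all add: J_add_left L.smult_left_add L.smult_right_add L.a_ac L.brk_linear)

lemma der_scale: "t \<in> lterms G \<Longrightarrow> cls (der (sc c \<sigma>) t) = c \<odot>\<^bsub>L\<^esub> cls (der \<sigma> t)"
  by (induction t) (simp_all add: J_scale_left L.smult_right_add L.brk_linear mult.commute flip: L.smult_mult)

abbreviation top where "top \<equiv> top_part sc tp"

text \<open>
  With \<open>top\<close>, these are the two coordinates of the image of a term under the map
  \<open>x \<mapsto> (x, tp x)\<close> into the semidirect product, whose bracket is
  \<open>[(s, \<sigma>), (t, \<tau>)] = ([s, t] + \<sigma>(t) - \<tau>(s), 0)\<close>.
\<close>
fun reduct :: "'x lterm \<Rightarrow> 'x lterm" where
  "reduct Zero = Zero"
| "reduct (Gen x) = Gen x"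
| "reduct (Add s t) = Add (reduct s) (reduct t)"
| "reduct (Smult c t) = Smult c (reduct t)"
| "reduct (Br s t) = Add (Br (reduct s) (reduct t))
     (Add (der (top s) (reduct t)) (Smult (- 1) (der (top t) (reduct s))))"

lemma reduct_lterms [simp]: "t \<in> lterms G \<Longrightarrow> reduct t \<in> lterms G"
  by (induction t) auto

lemma top_odd: "homog p i t \<Longrightarrow> i = 1 \<Longrightarrow> top t = 0"
  by (induction rule: homog.induct) (auto simp: tp_even)

lemma L_part:
  "\<zero>\<^bsub>L\<^esub> \<in> part L i"
  "x \<in> part L i \<Longrightarrow> y \<in> part L i \<Longrightarrow> x \<oplus>\<^bsub>L\<^esub> y \<in> part L i"
  "x \<in> part L i \<Longrightarrow> c \<odot>\<^bsub>L\<^esub> x \<in> part L i"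
  "x \<in> part L i \<Longrightarrow> y \<in> part L j \<Longrightarrow> x \<otimes>\<^bsub>L\<^esub> y \<in> part L (i + j)"
proof -
  show "\<zero>\<^bsub>L\<^esub> \<in> part L i"
    unfolding cls_simps(1)[symmetric] by (rule cls_part) (auto intro: homog.intros)
  show "c \<odot>\<^bsub>L\<^esub> x \<in> part L i" if x: "x \<in> part L i"
  proof -
    obtain t where "x = cls t" "t \<in> lterms G" "homog p i t"
      using x by (auto simp: presented_part)
    then show ?thesis
      using cls_part[of "Smult c t" i] by (simp add: homog.intros)
  qed
  show "x \<oplus>\<^bsub>L\<^esub> y \<in> part L i" if xy: "x \<in> part L i" "y \<in> part L i"
  proof -
    obtain s t where "x = cls s" "s \<in> lterms G" "homog p i s" "y = cls t" "t \<in> lterms G" "homog p i t"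
      using xy by (auto simp: presented_part)
    then show ?thesis
      using cls_part[of "Add s t" i] by (simp add: homog.intros)
  qed
  show "x \<otimes>\<^bsub>L\<^esub> y \<in> part L (i + j)" if xy: "x \<in> part L i" "y \<in> part L j"
  proof -
    obtain s t where "x = cls s" "s \<in> lterms G" "homog p i s" "y = cls t" "t \<in> lterms G" "homog p j t"
      using xy by (auto simp: presented_part)
    moreover from this have "cls (Br s t) \<in> part L (i + j)"
      by (metis cls_part homog.intros(5) lterms_simps(5))
    ultimately show ?thesis by (simp only: cls_simps)
  qed
qed

lemma der_part:
  assumes "t \<in> lterms G" "cls t \<in> part L i"
  shows "cls (der \<sigma> t) \<in> part L i"
proof -
  obtain r where r: "cls t = cls r" "r \<in> lterms G" "homog p i r"
    using assms by (auto simp: presented_part)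
  then have "cls (der \<sigma> t) = cls (der \<sigma> r)"
    using assms by (simp add: term_class_eq_iff der_cong)
  then show ?thesis using r by (simp add: cls_part diag_der_homog)
qed

text \<open>
  The term itself need not be homogeneous: for odd \<open>s\<close> the summand \<open>der 0 (reduct t)\<close> of the reduct of
  \<open>Br s t\<close> has the parity of \<open>t\<close>. In the quotient it vanishes.
\<close>
lemma reduct_part: "homog p i t \<Longrightarrow> t \<in> lterms G \<Longrightarrow> cls (reduct t) \<in> part L i"
proof (induction rule: homog.induct)
  case (5 i s j t)
  have *: "cls (der (top s) (reduct t)) \<in> part L (i + j)"
  proof (cases "i = 0")
    case True
    have "cls (der (top s) (reduct t)) \<in> part L j" using 5 by (simp add: der_part)
    then show ?thesis unfolding True by (simp only: add_0)
  next
    case False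
    then have "top s = 0" using top_odd[of i s] 5 by simp
    then show ?thesis using 5 by (simp add: der_zero L_part)
  qed
  have **: "cls (der (top t) (reduct s)) \<in> part L (i + j)"
  proof (cases "j = 0")
    case True
    have "cls (der (top t) (reduct s)) \<in> part L i" using 5 by (simp add: der_part)
    then show ?thesis unfolding True by (simp only: add_0_right)
  next
    case False
    then have "top t = 0" using top_odd[of j t] 5 by simp
    then show ?thesis using 5 by (simp add: der_zero L_part)
  qed
  have "cls (reduct s) \<otimes>\<^bsub>L\<^esub> cls (reduct t) \<in> part L (i + j)"
    using 5 by (intro L_part(4)) simp_all
  moreover have "cls (reduct (Br s t)) = cls (reduct s) \<otimes>\<^bsub>L\<^esub> cls (reduct t) \<oplus>\<^bsub>L\<^esub>
      (cls (der (top s) (reduct t)) \<oplus>\<^bsub>L\<^esub> (- 1) \<odot>\<^bsub>L\<^esub> cls (der (top t) (reduct s)))"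
    using 5 by simp
  ultimately show ?case using * ** L_part(2,3) by metis
qed (simp_all add: L_part cls_part homog.intros)

text \<open>
  The semidirect product satisfies the Lie superalgebra identities, so a congruence for the relations
  \<open>R'\<close> maps to an equality in it as soon as the relations of \<open>R'\<close> do. In the identities that involve
  Koszul signs, a sign \<open>-1\<close> occurs only for two odd terms, and these have no component along the
  derivations.
\<close>
lemma reduct_cong:
  assumes "(s, t) \<in> lcong G p R'"
    and R': "\<And>s t. (s, t) \<in> R' \<Longrightarrow> s \<in> lterms G \<Longrightarrow> t \<in> lterms G \<Longrightarrow>
        cls (reduct s) = cls (reduct t) \<and> top s = top t"
  shows "cls (reduct s) = cls (reduct t) \<and> top s = top t"
  using assms(1)
proof (induction rule: lcong.induct)
  case (Add_cong s s' t t')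
  then show ?case using lcong_lterms[of s s'] lcong_lterms[of t t'] by simp
next
  case (Smult_cong s s' c)
  then show ?case using lcong_lterms[of s s'] by simp
next
  case (Br_cong s s' t t')
  have lt: "s \<in> lterms G" "s' \<in> lterms G" "t \<in> lterms G" "t' \<in> lterms G"
    using lcong_lterms[of s s'] lcong_lterms[of t t'] Br_cong by simp_all
  then have "cls (der \<sigma> (reduct s)) = cls (der \<sigma> (reduct s'))"
    "cls (der \<sigma> (reduct t)) = cls (der \<sigma> (reduct t'))" for \<sigma>
    using Br_cong by (auto intro!: der_cong simp flip: term_class_eq_iff)
  then show ?case using Br_cong lt by simp
next
  case (Add_neg t)
  then show ?case by (simp flip: L.minus_smult add: L.r_neg)
next
  case (Br_Add_left s t u)
  then show ?case
    by (simp, intro L.functionals_eqI) (simp_all add: L.brk_linear der_add algebra_simps)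
next
  case (Br_Add_right s t u)
  then show ?case
    by (simp, intro L.functionals_eqI) (simp_all add: L.brk_linear der_add algebra_simps)
next
  case (Br_Smult_left s t c)
  then show ?case
    by (simp, intro L.functionals_eqI) (simp_all add: L.brk_linear der_scale algebra_simps)
next
  case (Br_Smult_right s t c)
  then show ?case
    by (simp, intro L.functionals_eqI) (simp_all add: L.brk_linear der_scale algebra_simps)
next
  case (skew s t i j)
  have pt: "cls (reduct s) \<in> part L i" "cls (reduct t) \<in> part L j"
    using skew by (simp_all add: reduct_part)
  have cl: "cls (reduct s) \<in> carrier L" "cls (reduct t) \<in> carrier L"
    using skew by simp_all
  have "koszul i j = 1 \<or> top s = 0 \<and> top t = 0"
    using skew top_odd by (auto simp: koszul_def)
  then have "cls (reduct (Br s t)) = cls (reduct (Smult (- koszul i j) (Br t s)))"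
  proof
    assume "koszul i j = 1"
    then show ?thesis using skew L.brk_skew[OF pt]
      by (simp, intro L.functionals_eqI) simp_all
  next
    assume "top s = 0 \<and> top t = 0"
    then show ?thesis using skew L.brk_skew[OF pt] cl
      by (simp add: der_zero)
  qed
  then show ?case by simp
next
  case (jacobi s t u i j)
  define S T U where "S = reduct s" and "T = reduct t" and "U = reduct u"
  have lt: "S \<in> lterms G" "T \<in> lterms G" "U \<in> lterms G"
    using jacobi by (simp_all add: S_def T_def U_def)
  have pt: "cls S \<in> part L i" "cls T \<in> part L j" "cls (der \<sigma> S) \<in> part L i" for \<sigma>
    using jacobi by (simp_all add: reduct_part S_def T_def der_part)
  define k where "k = koszul i j"
  note J = L.brk_jacobi[OF pt(1,2), folded k_def]
  note sk = L.brk_skew[OF pt(3,2), folded k_def]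
  have cases: "k = 1 \<or> k = - 1 \<and> top s = 0 \<and> top t = 0"
    using jacobi top_odd by (auto simp: koszul_def k_def)
  have "cls (reduct (Br s (Br t u))) = cls (reduct (Add (Br (Br s t) u) (Smult k (Br t (Br s u)))))"
    using cases
  proof
    assume k: "k = 1"
    show ?thesis
      using jacobi
      by (simp flip: S_def T_def U_def add: lt k, intro L.functionals_eqI)
        (simp_all add: lt L.brk_linear J k sk der_zero der_commute[of _ "top s" "top u"]
           der_commute[of _ "top t" "top u"]  der_commute[of _ "top t" "top s"] algebra_simps)
  next
    assume k: "k = - 1 \<and> top s = 0 \<and> top t = 0"
    show ?thesis
      using jacobi
      by (simp flip: S_def T_def U_def add: lt k, intro L.functionals_eqI)
        (simp_all add: lt L.brk_linear J k sk der_zero der_der_zero algebra_simps)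
  qed
  then show ?case by (simp add: k_def)
qed (simp_all add: R' L.brk_linear L.smult_left_add L.smult_right_add L.smult_mult L.a_ac
    V.scale_right_distrib V.scale_left_distrib add_ac)

lemma reduct_top_free:
  assumes "t \<in> lterms {x \<in> G. tp x = 0}"
  shows "cls (reduct t) = cls t \<and> top t = 0"
proof -
  have "t \<in> lterms G" using assms by (auto simp: lterms_def)
  then show ?thesis
    using assms by (induction t) (simp_all add: der_zero)
qed

text \<open>
  Terms in generators without derivation component lie in the first factor of the semidirect product,
  so a consequence of \<open>R'\<close> between such terms is already a consequence of \<open>R\<close>.
\<close>
lemma lcong_descends:
  assumes "(s, t) \<in> lcong G p R'"
    and R': "\<And>s t. (s, t) \<in> R' \<Longrightarrow> s \<in> lterms G \<Longrightarrow> t \<in> lterms G \<Longrightarrow>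
        cls (reduct s) = cls (reduct t) \<and> top s = top t"
    and "s \<in> lterms {x \<in> G. tp x = 0}" "t \<in> lterms {x \<in> G. tp x = 0}"
  shows "(s, t) \<in> lcong G p R"
proof -
  have "cls s = cls t"
    using reduct_cong[OF assms(1) R'] reduct_top_free[OF assms(3)] reduct_top_free[OF assms(4)] by simp
  then show ?thesis
    using lcong_lterms[OF assms(1)] by (simp add: term_class_eq_iff)
qed

end

section \<open>Root strings\<close>

text \<open>
  If \<open>[e, f] = h\<close> and \<open>w\<close> is annihilated by \<open>e\<close> with \<open>h\<close>-eigenvalue \<open>m\<close>, then \<open>e\<close> maps the
  \<open>n\<close>-th vector of the string \<open>w, [f, w], [f, [f, w]], \<dots>\<close> to \<open>string_coeff \<epsilon> m n\<close> times the
  preceding one, where \<open>\<epsilon>\<close> is \<open>1\<close> for even \<open>e\<close> and \<open>-1\<close> for odd \<open>e\<close>. In the even case this is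
  the familiar \<open>n (m - n + 1)\<close>.
\<close>
fun string_coeff :: "complex \<Rightarrow> complex \<Rightarrow> nat \<Rightarrow> complex" where
  "string_coeff \<epsilon> m 0 = 0"
| "string_coeff \<epsilon> m (Suc n) = m - 2 * of_nat n + \<epsilon> * string_coeff \<epsilon> m n"

lemma string_coeff_1: "- e * 2 / P * r = e * string_coeff \<epsilon> (- 2 * r / P) (Suc 0)"
  by simp

lemma string_step: "P \<noteq> 0 \<Longrightarrow> - e * 2 / P * (r + n * P) = e * (- 2 * r / P - 2 * n)" for n :: complex
  by (simp add: divide_simps) (simp add: algebra_simps)?

lemma koszul_commute: "koszul i j = koszul j i"
  by (auto simp: koszul_def)

lemma koszul_square [simp]: "koszul i j * (koszul i j * c) = c"
  by (auto simp: koszul_def)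

lemma koszul_cases: "koszul i j = 1 \<or> koszul i j = - 1"
  by (auto simp: koszul_def)

lemma koszul_even [simp]: "koszul 0 j = 1" "koszul j 0 = 1"
  by (auto simp: koszul_def)

context lie_superalgebra
begin

lemma part_decomposition:
  assumes "x \<in> carrier L"
  obtains x0 x1 where "x = x0 \<oplus> x1" "x0 \<in> part L 0" "x1 \<in> part L 1"
  using assms unfolding carrier_eq set_add_def' by auto

text \<open>
  The Jacobi identity needs a homogeneous second argument only because of its sign, and the sign is
  trivial for even \<open>h\<close>.
\<close>
lemma even_derivation:
  assumes h: "h \<in> part L 0" and u: "u \<in> carrier L" and v: "v \<in> carrier L"
  shows "h \<otimes> (u \<otimes> v) = (h \<otimes> u) \<otimes> v \<oplus> u \<otimes> (h \<otimes> v)"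
proof -
  obtain u0 u1 where *: "u = u0 \<oplus> u1" "u0 \<in> part L 0" "u1 \<in> part L 1"
    using part_decomposition[OF u] .
  note J = bracket_jacobi[OF h *(2) v] bracket_jacobi[OF h *(3) v]
  have cl: "u0 \<in> carrier L" "u1 \<in> carrier L" "h \<in> carrier L"
    using * h part_carrier by auto
  show ?thesis
    unfolding *(1) using cl v by (simp add: brk_linear J a_ac)
qed

text \<open>
  Here \<open>e, f\<close> and \<open>v, w\<close> are pairs of opposite root vectors for two roots \<open>\<mu>\<close> and \<open>\<nu>\<close>
  whose difference is not a root; \<open>te\<close> and \<open>tv\<close> are the Cartan elements dual to these roots, and \<open>P = (\<mu>, \<mu>)\<close>,
  \<open>r = (\<mu>, \<nu>)\<close>. Two parallel strings grow from \<open>v\<close> and \<open>w\<close>.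
\<close>
context
  fixes e f v w te tv :: 'a and i j :: bit and P r \<kappa> :: complex
  assumes part: "e \<in> part L i" "f \<in> part L i" "v \<in> part L j" "w \<in> part L j"
      "te \<in> part L 0" "tv \<in> part L 0"
    and P: "P \<noteq> 0"
    and ef: "e \<otimes> f = (2 / P) \<odot> te" and vw: "v \<otimes> w = \<kappa> \<odot> tv"
    and te: "te \<otimes> e = P \<odot> e" "te \<otimes> f = (- P) \<odot> f" "te \<otimes> v = r \<odot> v" "te \<otimes> w = (- r) \<odot> w"
    and tv: "tv \<otimes> f = (- r) \<odot> f"
    and ew: "e \<otimes> w = \<zero>" and fv: "f \<otimes> v = \<zero>"
begin

private abbreviation "x n \<equiv> (((\<otimes>) e) ^^ n) v"
private abbreviation "y n \<equiv> (((\<otimes>) f) ^^ n) w"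
private abbreviation "par n \<equiv> (((+) i) ^^ n) j"
private abbreviation "\<epsilon> \<equiv> koszul i i"
private abbreviation "c n \<equiv> string_coeff \<epsilon> (- 2 * r / P) n"

private fun kap :: "nat \<Rightarrow> complex" where
  "kap 0 = \<kappa>"
| "kap (Suc n) = - koszul i (par n) * c (Suc n) * kap n"

private lemma xy_part: "x n \<in> part L (par n)" "y n \<in> part L (par n)"
proof (induction n)
  case (Suc n)
  {
    case 1
    show ?case unfolding funpow.simps o_apply by (rule bracket_part) (fact part Suc)+
  next
    case 2
    show ?case unfolding funpow.simps o_apply by (rule bracket_part) (fact part Suc)+
  }
qed (simp_all add: part)

private lemma cl [simp]: "x n \<in> carrier L" "y n \<in> carrier L" "e \<in> carrier L" "f \<in> carrier L"
    "te \<in> carrier L" "tv \<in> carrier L" "v \<in> carrier L" "w \<in> carrier L"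
  using xy_part part part_carrier by blast+

private lemma te_x: "te \<otimes> x n = (r + of_nat n * P) \<odot> x n"
proof (induction n)
  case (Suc n)
  have "te \<otimes> x (Suc n) = (te \<otimes> e) \<otimes> x n \<oplus> e \<otimes> (te \<otimes> x n)"
    by (simp add: even_derivation part)
  also have "\<dots> = (r + of_nat (Suc n) * P) \<odot> x (Suc n)"
    unfolding Suc te by (intro functionals_eqI) (simp_all add: brk_linear algebra_simps)
  finally show ?case .
qed (simp add: te)

private lemma te_y: "te \<otimes> y n = (- r - of_nat n * P) \<odot> y n"
proof (induction n)
  case (Suc n)
  have "te \<otimes> y (Suc n) = (te \<otimes> f) \<otimes> y n \<oplus> f \<otimes> (te \<otimes> y n)"
    by (simp add: even_derivation part)
  also have "\<dots> = (- r - of_nat (Suc n) * P) \<odot> y (Suc n)"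
    unfolding Suc te by (intro functionals_eqI) (simp_all add: brk_linear algebra_simps)
  finally show ?case .
qed (simp add: te)

private lemma xS: "x (Suc n) = e \<otimes> x n" and yS: "y (Suc n) = f \<otimes> y n"
  by simp_all

private lemma e_y: "e \<otimes> y (Suc n) = c (Suc n) \<odot> y n"
proof (induction n)
  case 0
  have "e \<otimes> y (Suc 0) = (e \<otimes> f) \<otimes> w \<oplus> \<epsilon> \<odot> (f \<otimes> (e \<otimes> w))"
    by (simp add: bracket_jacobi[OF part(1,2)])
  then show ?case
    using P by (simp add: ew ef brk_linear te flip: smult_mult)
next
  case (Suc n)
  have "e \<otimes> y (Suc (Suc n)) = (e \<otimes> f) \<otimes> y (Suc n) \<oplus> \<epsilon> \<odot> (f \<otimes> (e \<otimes> y (Suc n)))"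
    using bracket_jacobi[OF part(1,2), of "y (Suc n)"] by simp
  also have "\<dots> = ((2 / P) * (- r - of_nat (Suc n) * P)) \<odot> y (Suc n) \<oplus> (\<epsilon> * c (Suc n)) \<odot> y (Suc n)"
    unfolding Suc ef brk_smult_left[OF cl(5) cl(2)] te_y
    by (simp only: smult_mult cl smult_closed' brk_closed brk_smult_right yS)
  also have "\<dots> = c (Suc (Suc n)) \<odot> y (Suc n)"
    using P by (simp flip: smult_left_add add: field_simps)
  finally show ?case .
qed

private lemma f_e: "f \<otimes> e = (- \<epsilon> * 2 / P) \<odot> te"
  using bracket_skew[OF part(2,1)] by (simp add: ef flip: smult_mult)

private lemma f_x: "f \<otimes> x (Suc n) = (\<epsilon> * c (Suc n)) \<odot> x n"
proof (induction n)
  case 0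
  have "f \<otimes> x (Suc 0) = (f \<otimes> e) \<otimes> v \<oplus> \<epsilon> \<odot> (e \<otimes> (f \<otimes> v))"
    by (simp add: bracket_jacobi[OF part(2,1)])
  also have "(f \<otimes> e) \<otimes> v = (- \<epsilon> * 2 / P * r) \<odot> v"
    unfolding f_e brk_smult_left[OF cl(5) cl(7)] te by (simp only: smult_mult cl)
  also have "- \<epsilon> * 2 / P * r = \<epsilon> * c (Suc 0)"
    by (rule string_coeff_1)
  also have "(\<epsilon> * c (Suc 0)) \<odot> v \<oplus> \<epsilon> \<odot> (e \<otimes> (f \<otimes> v)) = (\<epsilon> * c (Suc 0)) \<odot> x 0"
    by (simp add: fv del: string_coeff.simps)
  finally show ?case .
next
  case (Suc n)
  have "f \<otimes> x (Suc (Suc n)) = (f \<otimes> e) \<otimes> x (Suc n) \<oplus> \<epsilon> \<odot> (e \<otimes> (f \<otimes> x (Suc n)))"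
    using bracket_jacobi[OF part(2,1), of "x (Suc n)"] by simp
  also have "\<dots> = ((- \<epsilon> * 2 / P) * (r + of_nat (Suc n) * P)) \<odot> x (Suc n) \<oplus> c (Suc n) \<odot> x (Suc n)"
    unfolding Suc f_e brk_smult_left[OF cl(5) cl(1)] te_x
    by (intro functionals_eqI)
      (simp_all only: smult_closed' cl xS brk_smult_right brk_closed functional_add functional_smult
        a_closed mult.assoc koszul_square)
  also have "\<dots> = (\<epsilon> * c (Suc (Suc n))) \<odot> x (Suc n)"
  proof -
    have "- \<epsilon> * 2 / P * (r + of_nat (Suc n) * P) = \<epsilon> * (- 2 * r / P - 2 * of_nat (Suc n))"
      by (rule string_step[OF P])
    then have "- \<epsilon> * 2 / P * (r + of_nat (Suc n) * P) + c (Suc n) = \<epsilon> * c (Suc (Suc n))"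
      unfolding string_coeff.simps(2)[of _ _ "Suc n"] by (simp only: distrib_left koszul_square)
    then show ?thesis using smult_left_add[OF cl(1)] by metis
  qed
  finally show ?case .
qed

private lemma f_t: "f \<otimes> te = P \<odot> f" "f \<otimes> tv = r \<odot> f"
  using bracket_skew[OF part(2,5)] bracket_skew[OF part(2,6)] by (simp_all add: te tv flip: smult_mult)

private lemma pairing:
  "x n \<otimes> y n = kap n \<odot> (of_nat n \<odot> te \<oplus> tv) \<and>
   x n \<otimes> y (Suc n) = (kap (Suc n) * P / 2) \<odot> f"
proof (induction n)
  case 0
  have "v \<otimes> f = \<zero>" using bracket_skew[OF part(3,2)] by (simp add: fv)
  then have "x 0 \<otimes> y (Suc 0) = (koszul j i * \<kappa> * r) \<odot> f"
    using bracket_jacobi[OF part(3,2), of w] by (simp add: vw brk_linear f_t mult_ac flip: smult_mult)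
  then show ?case using P by (simp add: vw koszul_commute mult_ac)
next
  case (Suc n)
  let ?T = "of_nat n \<odot> te \<oplus> tv"
  have A: "x (Suc n) \<otimes> y (Suc n) = kap (Suc n) \<odot> (of_nat (Suc n) \<odot> te \<oplus> tv)"
  proof -
    have "e \<otimes> (x n \<otimes> y (Suc n)) = x (Suc n) \<otimes> y (Suc n) \<oplus> koszul i (par n) \<odot> (x n \<otimes> (e \<otimes> y (Suc n)))"
      using bracket_jacobi[OF part(1) xy_part(1)[of n], of "y (Suc n)"] by simp
    then have *: "(kap (Suc n) * P / 2) \<odot> (e \<otimes> f) =
        x (Suc n) \<otimes> y (Suc n) \<oplus> koszul i (par n) \<odot> (c (Suc n) \<odot> (kap n \<odot> ?T))"
      unfolding e_y using Suc by (simp add: brk_linear del: string_coeff.simps kap.simps funpow.simps)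
    show ?thesis
    proof (rule functionals_eqI)
      fix \<phi> assume \<phi>: "\<phi> \<in> functionals L"
      show "\<phi> (x (Suc n) \<otimes> y (Suc n)) = \<phi> (kap (Suc n) \<odot> (of_nat (Suc n) \<odot> te \<oplus> tv))"
      proof -
        have "kap (Suc n) * \<phi> te =
            \<phi> (x (Suc n) \<otimes> y (Suc n)) + (koszul i (par n) * c (Suc n) * kap n) * \<phi> ?T"
          using arg_cong[OF *, of \<phi>] \<phi> P
          by (simp add: ef del: string_coeff.simps funpow.simps kap.simps functional_add)
            (simp del: string_coeff.simps funpow.simps kap.simps)
        moreover have "koszul i (par n) * c (Suc n) * kap n = - kap (Suc n)" by simp
        ultimately show ?thesis
          using \<phi> by (simp del: string_coeff.simps funpow.simps kap.simps add: algebra_simps)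
      qed
    qed (use cl in \<open>simp_all del: funpow.simps kap.simps\<close>)
  qed
  have B: "x (Suc n) \<otimes> y (Suc (Suc n)) = (kap (Suc (Suc n)) * P / 2) \<odot> f"
  proof -
    let ?k = "koszul i (par (Suc n))"
    have "x (Suc n) \<otimes> f = (- ?k) \<odot> (f \<otimes> x (Suc n))"
      using bracket_skew[OF xy_part(1)[of "Suc n"] part(2)] koszul_commute by metis
    then have xf: "x (Suc n) \<otimes> f = (- ?k * \<epsilon> * c (Suc n)) \<odot> x n"
      unfolding f_x by (simp del: string_coeff.simps funpow.simps flip: smult_mult add: mult_ac)
    have "x (Suc n) \<otimes> y (Suc (Suc n)) = x (Suc n) \<otimes> (f \<otimes> y (Suc n))" by simp
    also have "\<dots> = (x (Suc n) \<otimes> f) \<otimes> y (Suc n) \<oplus> ?k \<odot> (f \<otimes> (x (Suc n) \<otimes> y (Suc n)))"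
      using bracket_jacobi[OF xy_part(1)[of "Suc n"] part(2), of "y (Suc n)"] koszul_commute
      by (metis cl(2))
    also have "\<dots> = (- ?k * \<epsilon> * c (Suc n)) \<odot> ((kap (Suc n) * P / 2) \<odot> f) \<oplus>
        ?k \<odot> (kap (Suc n) \<odot> ((of_nat (Suc n) * P + r) \<odot> f))"
      unfolding xf A using Suc
      by (simp add: brk_linear f_t smult_left_add smult_mult del: string_coeff.simps funpow.simps kap.simps of_nat_Suc)
    also have "\<dots> = (kap (Suc (Suc n)) * P / 2) \<odot> f"
      using P by (intro functionals_eqI)
        (simp_all del: funpow.simps kap.simps(2) add: kap.simps(2)[of "Suc n"] field_simps)
    finally show ?thesis .
  qed
  show ?case using A B by blast
qed

text \<open>
  The bracket of the two string vectors of opposite weights \<open>\<plusminus>(n \<mu> + \<nu>)\<close> is a multiple of the Cartan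
  element dual to \<open>n \<mu> + \<nu>\<close>, as it would follow from an invariant form. Without one, it is proved
  by induction on \<open>n\<close>, simultaneously with the value of the bracket of neighbouring string vectors,
  which is a multiple of \<open>f\<close>.
\<close>
lemma string_pairing:
  assumes "\<kappa> \<noteq> 0" "\<And>k. k \<in> {1..n} \<Longrightarrow> string_coeff (koszul i i) (- 2 * r / P) k \<noteq> 0"
  shows "\<exists>d. d \<noteq> 0 \<and> (((\<otimes>) e) ^^ n) v \<otimes> (((\<otimes>) f) ^^ n) w = d \<odot> (of_nat n \<odot> te \<oplus> tv)"
proof (intro exI conjI)
  have "kap k \<noteq> 0" if "k \<le> n" for k
    using that
  proof (induction k)
    case (Suc k)
    moreover have "koszul i (par k) \<noteq> 0" using koszul_cases[of i "par k"] by auto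
    ultimately show ?case using assms(2)[of "Suc k"] by (simp del: string_coeff.simps)
  qed (simp add: assms)
  then show "kap n \<noteq> 0" by blast
qed (use pairing in blast)

end

end

lemma string_coeff_nonzero:
  assumes "\<epsilon> = 1 \<or> \<epsilon> = - 1" "m \<in> {1, 2, 3}" "k \<in> {1..n}" "of_nat n \<le> Re m"
  shows "string_coeff \<epsilon> m k \<noteq> 0"
proof -
  have "n \<le> 3" using assms(2,4) by auto
  then have "k = 1 \<or> k = 2 \<or> k = 3" using assms(3) by auto
  then show ?thesis
    using assms by (auto simp: numeral_2_eq_2 numeral_3_eq_3)
qed

section \<open>Lifting generators through a central extension\<close>

lemma lsa_homD:
  assumes "f \<in> lsa_hom L M"
  shows "x \<in> carrier L \<Longrightarrow> f x \<in> carrier M"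
    "x \<in> carrier L \<Longrightarrow> y \<in> carrier L \<Longrightarrow> f (x \<oplus>\<^bsub>L\<^esub> y) = f x \<oplus>\<^bsub>M\<^esub> f y"
    "x \<in> carrier L \<Longrightarrow> f (c \<odot>\<^bsub>L\<^esub> x) = c \<odot>\<^bsub>M\<^esub> f x"
    "x \<in> carrier L \<Longrightarrow> y \<in> carrier L \<Longrightarrow> f (x \<otimes>\<^bsub>L\<^esub> y) = f x \<otimes>\<^bsub>M\<^esub> f y"
    "x \<in> part L i \<Longrightarrow> f x \<in> part M i"
  using assms unfolding lsa_hom_def by (auto 0 3)

context lie_superalgebra
begin

lemma part_both: "x \<in> part L 0 \<Longrightarrow> x \<in> part L 1 \<Longrightarrow> x = \<zero>"
  using part_disjoint by blast

lemma part_distinct: "x \<in> part L i \<Longrightarrow> x \<in> part L j \<Longrightarrow> i \<noteq> j \<Longrightarrow> x = \<zero>"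
  by (cases i; cases j) (simp_all add: part_both)

lemma homogeneous_summand:
  assumes x: "x \<in> part L 0" and z: "z \<in> part L 1" and sum: "x \<oplus> z \<in> part L i"
  shows "i = 0 \<and> x \<oplus> z = x \<or> i = 1 \<and> x \<oplus> z = z"
proof -
  note cl = part_carrier[OF x] part_carrier[OF z]
  show ?thesis
  proof (cases "i = 0")
    case True
    have "z = (x \<oplus> z) \<oplus> (- 1) \<odot> x" using cl by (intro functionals_eqI) simp_all
    then have "z \<in> part L 0" using True sum part_add part_smult[OF x] by metis
    then have "z = \<zero>" using z part_both by blast
    then show ?thesis using True cl by simp
  next
    case False
    then have i: "i = 1" by simp
    have "x = (x \<oplus> z) \<oplus> (- 1) \<odot> z" using cl by (intro functionals_eqI) simp_all
    then have "x \<in> part L 1" using i sum part_add part_smult[OF z] by metis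
    then have "x = \<zero>" using x part_both by blast
    then show ?thesis using i cl by simp
  qed
qed

text \<open>
  The eigenvalue equation equates vectors of different parities.
\<close>
lemma odd_eigenvector_zero:
  assumes "h \<in> part L 1" "x \<in> part L i" "h \<otimes> x = c \<odot> x" "c \<noteq> 0"
  shows "x = \<zero>"
proof -
  have "h \<otimes> x \<in> part L (1 + i)" using assms bracket_part by blast
  moreover have "h \<otimes> x \<in> part L i" using assms(2,3) by (simp add: part_smult)
  moreover have "1 + i \<noteq> i" by (cases i) simp_all
  ultimately have "c \<odot> x = \<zero>" using part_distinct assms(3) by metis
  then have "inverse c \<odot> (c \<odot> x) = \<zero>" by simp
  then show ?thesis using assms part_carrier[OF assms(2)] by (simp flip: smult_mult)
qed

end

locale central_extension_of = B: lie_superalgebra B + A: lie_superalgebra A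
  for B :: "'b lie_superalg" (structure) and A :: "'a lie_superalg" +
  fixes W :: "'b \<Rightarrow> 'a"
  assumes central: "central_extension B A W"
begin

lemma hom: "W \<in> lsa_hom B A" and surj: "W ` carrier B = carrier A"
  using central by (auto simp: central_extension_def)

lemmas W_simps = lsa_homD(1-4)[OF hom]
lemmas W_part = lsa_homD(5)[OF hom]

lemma W_zero: "W \<zero> = \<zero>\<^bsub>A\<^esub>"
  using W_simps(1)[of "\<zero>"] W_simps(3)[of "\<zero>" 0] by simp

lemma kernel_iff: "z \<in> a_kernel B A W \<longleftrightarrow> z \<in> carrier B \<and> W z = \<zero>\<^bsub>A\<^esub>"
  by (auto simp: a_kernel_def')

lemma kernel_left: "z \<in> a_kernel B A W \<Longrightarrow> u \<in> carrier B \<Longrightarrow> z \<otimes> u = \<zero>"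
  using central by (auto simp: central_extension_def)

text \<open>
  The definition of a central extension asks for the vanishing of \<open>[z, u]\<close> only. Skew symmetry gives
  \<open>[u, z] = 0\<close> for homogeneous \<open>z\<close>; this is where the homogeneity of the kernel enters.
\<close>
lemma kernel_right:
  assumes z: "z \<in> a_kernel B A W" and u: "u \<in> carrier B"
  shows "u \<otimes> z = \<zero>"
proof -
  have homogeneous: "u \<otimes> z = \<zero>" if "z \<in> a_kernel B A W" "z \<in> part B j" for z j
  proof -
    obtain u0 u1 where *: "u = u0 \<oplus> u1" "u0 \<in> part B 0" "u1 \<in> part B 1"
      using B.part_decomposition[OF u] .
    have "u0 \<otimes> z = \<zero>" "u1 \<otimes> z = \<zero>"
      using B.brk_skew[OF *(2) that(2)] B.brk_skew[OF *(3) that(2)] kernel_left[OF that(1)]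
        *(2,3) B.part_carrier by auto
    then show ?thesis
      using * B.part_carrier that by (simp add: B.brk_add_left)
  qed
  obtain z0 z1 where "z = z0 \<oplus> z1" "z0 \<in> part B 0 \<inter> a_kernel B A W" "z1 \<in> part B 1 \<inter> a_kernel B A W"
    using z central unfolding central_extension_def set_add_def' by blast
  then show ?thesis
    using homogeneous[of z0 0] homogeneous[of z1 1] B.part_carrier[of z0 0] B.part_carrier[of z1 1] u
    by (simp add: B.brk_add_right)
qed

text \<open>
  The bracket of \<open>B\<close> factors through \<open>A\<close>, because fibres of \<open>W\<close> are cosets of a central ideal.
\<close>
lemma bracket_fibre:
  assumes "x \<in> carrier B" "y \<in> carrier B" "u \<in> carrier B" "W x = W y"
  shows "x \<otimes> u = y \<otimes> u" "u \<otimes> x = u \<otimes> y"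
proof -
  define z where "z = x \<oplus> (- 1) \<odot> y"
  have W0: "W y \<oplus>\<^bsub>A\<^esub> (- 1) \<odot>\<^bsub>A\<^esub> W y = \<zero>\<^bsub>A\<^esub>"
    using W_simps(1)[OF assms(2)] by (simp flip: A.minus_smult add: A.r_neg)
  then have z: "z \<in> a_kernel B A W"
    using assms by (simp add: z_def kernel_iff W_simps)
  have x: "x = y \<oplus> z"
    using assms by (intro B.functionals_eqI) (simp_all add: z_def)
  have zc: "z \<in> carrier B" using z kernel_iff by blast
  show "x \<otimes> u = y \<otimes> u" "u \<otimes> x = u \<otimes> y"
    unfolding x using assms zc kernel_left[OF z] kernel_right[OF z] by (simp_all add: B.brk_linear)
qed

lemma homogeneous_lift:
  assumes x: "x \<in> part A i"
  shows "\<exists>y \<in> part B i. W y = x"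
proof -
  obtain z where z: "z \<in> carrier B" "W z = x"
    using x surj A.part_carrier by (metis imageE)
  obtain z0 z1 where *: "z = z0 \<oplus> z1" "z0 \<in> part B 0" "z1 \<in> part B 1"
    using B.part_decomposition[OF z(1)] .
  have W: "x = W z0 \<oplus>\<^bsub>A\<^esub> W z1" "W z0 \<in> part A 0" "W z1 \<in> part A 1"
    using * z(2) W_part B.part_carrier by (auto simp: W_simps)
  show ?thesis
    using A.homogeneous_summand[OF W(2,3), of i] x W(1) *(2,3) by auto
qed

lemma W_term_eval:
  assumes "\<And>x. x \<in> G \<Longrightarrow> f x \<in> carrier B" "t \<in> lterms G"
  shows "W (term_eval B f t) = term_eval A (\<lambda>x. W (f x)) t"
  using assms(2) B.term_eval_closed[of G f] assms(1)
  by (induction t) (simp_all add: W_simps W_zero)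

context
  fixes S Sp :: "'e::ab_group_add set" and p :: "'e \<Rightarrow> bit" and n :: "'e \<Rightarrow> 'e \<Rightarrow> complex"
    and x :: "'e \<Rightarrow> 'a"
  assumes x_part: "\<And>\<mu>. \<mu> \<in> S \<Longrightarrow> x \<mu> \<in> part A (p \<mu>)"
    and Sp: "\<And>\<mu>. \<mu> \<in> Sp \<Longrightarrow> \<mu> \<in> S \<and> - \<mu> \<in> S"
    and x_cartan: "\<And>\<mu> \<nu>. \<mu> \<in> Sp \<Longrightarrow> \<nu> \<in> S \<Longrightarrow>
          (x \<mu> \<otimes>\<^bsub>A\<^esub> x (- \<mu>)) \<otimes>\<^bsub>A\<^esub> x \<nu> = n \<mu> \<nu> \<odot>\<^bsub>A\<^esub> x \<nu>"
    and n_self: "\<And>\<mu>. \<mu> \<in> Sp \<Longrightarrow> n \<mu> \<mu> \<noteq> 0"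
    and n_minus: "\<And>\<mu> \<nu>. \<mu> \<in> Sp \<Longrightarrow> n \<mu> (- \<nu>) = - n \<mu> \<nu>"
    and n_nonzero: "\<And>\<nu>. \<nu> \<in> S \<Longrightarrow> \<exists>\<mu> \<in> Sp. n \<mu> \<nu> \<noteq> 0"
begin

text \<open>
  If \<open>[z, z']\<close> is even this is the Jacobi identity. If it is odd, then so is its image in
  \<open>A\<close>, and \<open>x \<mu>\<close> is an eigenvector of this image with nonzero eigenvalue. This forces \<open>x \<mu> = 0\<close>, so
  that \<open>[z, z']\<close> lies in the kernel.
\<close>
lemma cartan_derivation:
  assumes \<mu>: "\<mu> \<in> Sp"
    and z: "z \<in> part B (p \<mu>)" "z' \<in> part B (p (- \<mu>))" "W z = x \<mu>" "W z' = x (- \<mu>)"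
    and uv: "u \<in> carrier B" "v \<in> carrier B"
  shows "(z \<otimes> z') \<otimes> (u \<otimes> v) =
      ((z \<otimes> z') \<otimes> u) \<otimes> v \<oplus> u \<otimes> ((z \<otimes> z') \<otimes> v)"
proof (cases "p \<mu> + p (- \<mu>) = 0")
  case True
  then show ?thesis
    using B.bracket_part[OF z(1,2)] uv by (simp only: B.even_derivation)
next
  case False
  then have odd: "p \<mu> + p (- \<mu>) = 1" by (metis bit_not_zero_iff)
  have S: "\<mu> \<in> S" "- \<mu> \<in> S" using Sp \<mu> by auto
  have "x \<mu> \<otimes>\<^bsub>A\<^esub> x (- \<mu>) \<in> part A 1"
    using A.bracket_part[OF x_part x_part, OF S] by (simp only: odd)
  then have "x \<mu> = \<zero>\<^bsub>A\<^esub>"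
    using A.odd_eigenvector_zero[OF _ x_part[OF S(1)] x_cartan[OF \<mu> S(1)] n_self[OF \<mu>]] by blast
  then have W0: "W (z \<otimes> z') = W \<zero>"
    using z B.part_carrier A.part_carrier[OF x_part[OF S(2)]] by (simp add: W_simps W_zero)
  have H: "(z \<otimes> z') \<otimes> u = \<zero>" if "u \<in> carrier B" for u
    using bracket_fibre(1)[OF _ _ that W0] z B.part_carrier that by simp
  show ?thesis using H uv by simp
qed

text \<open>
  Arbitrary lifts \<open>z\<close> are eigenvectors of the elements \<open>H \<mu> = [z \<mu>, z (-\<mu>)]\<close> only modulo the kernel,
  but applying \<open>H \<mu>\<close> once more erases the error. The new elements \<open>y\<close> differ from \<open>z\<close> by kernel
  elements, so they give rise to the same \<open>H \<mu>\<close>.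
\<close>
lemma cartan_lift:
  obtains y where "\<And>\<mu>. \<mu> \<in> S \<Longrightarrow> y \<mu> \<in> part B (p \<mu>)" "\<And>\<mu>. \<mu> \<in> S \<Longrightarrow> W (y \<mu>) = x \<mu>"
    "\<And>\<mu> \<nu>. \<mu> \<in> Sp \<Longrightarrow> \<nu> \<in> S \<Longrightarrow> (y \<mu> \<otimes> y (- \<mu>)) \<otimes> y \<nu> = n \<mu> \<nu> \<odot> y \<nu>"
proof -
  obtain z where z: "\<And>\<mu>. \<mu> \<in> S \<Longrightarrow> z \<mu> \<in> part B (p \<mu>) \<and> W (z \<mu>) = x \<mu>"
    using homogeneous_lift[OF x_part] by metis
  have zc: "\<mu> \<in> S \<Longrightarrow> z \<mu> \<in> carrier B" for \<mu> using z B.part_carrier by blast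
  define H where "H \<mu> = z \<mu> \<otimes> z (- \<mu>)" for \<mu>
  have Hc: "\<mu> \<in> Sp \<Longrightarrow> H \<mu> \<in> carrier B" for \<mu> using Sp zc by (simp add: H_def)
  have der: "H \<mu> \<otimes> (u \<otimes> v) = (H \<mu> \<otimes> u) \<otimes> v \<oplus> u \<otimes> (H \<mu> \<otimes> v)"
    if "\<mu> \<in> Sp" "u \<in> carrier B" "v \<in> carrier B" for \<mu> u v
    unfolding H_def using that Sp z by (intro cartan_derivation) auto
  have WH: "W (H \<mu> \<otimes> z \<nu>) = W (n \<mu> \<nu> \<odot> z \<nu>)" if "\<mu> \<in> Sp" "\<nu> \<in> S" for \<mu> \<nu>
    using that Sp zc z x_cartan by (simp add: H_def W_simps)
  have HH: "H \<sigma> \<otimes> H \<mu> = \<zero>" if "\<sigma> \<in> Sp" "\<mu> \<in> Sp" for \<sigma> \<mu>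
  proof -
    have S: "\<mu> \<in> S" "- \<mu> \<in> S" using Sp that by auto
    note zS = zc[OF S(1)] zc[OF S(2)]
    have "H \<sigma> \<otimes> H \<mu> = (H \<sigma> \<otimes> z \<mu>) \<otimes> z (- \<mu>) \<oplus> z \<mu> \<otimes> (H \<sigma> \<otimes> z (- \<mu>))"
      unfolding H_def[of \<mu>] using der that zS by blast
    also have "\<dots> = (n \<sigma> \<mu> \<odot> z \<mu>) \<otimes> z (- \<mu>) \<oplus> z \<mu> \<otimes> (n \<sigma> (- \<mu>) \<odot> z (- \<mu>))"
      using bracket_fibre(1)[OF _ _ zS(2) WH[OF that(1) S(1)]]
        bracket_fibre(2)[OF _ _ zS(1) WH[OF that(1) S(2)]] zS Hc[OF that(1)] by simp
    also have "\<dots> = \<zero>"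
      using zS n_minus[OF that(1)] by (intro B.functionals_eqI) (simp_all add: B.brk_linear)
    finally show ?thesis .
  qed
  obtain m where m: "\<And>\<nu>. \<nu> \<in> S \<Longrightarrow> m \<nu> \<in> Sp \<and> n (m \<nu>) \<nu> \<noteq> 0"
    using n_nonzero by metis
  define y where "y \<nu> = inverse (n (m \<nu>) \<nu>) \<odot> (H (m \<nu>) \<otimes> z \<nu>)" for \<nu>
  have yc: "y \<nu> \<in> carrier B" if "\<nu> \<in> S" for \<nu>
    using m[OF that] Hc zc[OF that] by (simp add: y_def)
  have Wy: "W (y \<nu>) = x \<nu>" if "\<nu> \<in> S" for \<nu>
  proof -
    have "W (y \<nu>) = inverse (n (m \<nu>) \<nu>) \<odot>\<^bsub>A\<^esub> (n (m \<nu>) \<nu> \<odot>\<^bsub>A\<^esub> x \<nu>)"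
      using WH[of "m \<nu>" \<nu>] m[OF that] Hc zc[OF that] that z by (simp add: y_def W_simps)
    then show ?thesis
      using m[OF that] A.part_carrier[OF x_part[OF that]] by (simp flip: A.smult_mult)
  qed
  have ypart: "y \<nu> \<in> part B (p \<nu>)" if \<nu>: "\<nu> \<in> S" for \<nu>
  proof -
    let ?\<mu> = "m \<nu>"
    have \<mu>: "?\<mu> \<in> Sp" using m[OF \<nu>] by blast
    then have S: "?\<mu> \<in> S" "- ?\<mu> \<in> S" using Sp by auto
    have Hp: "H ?\<mu> \<in> part B (p ?\<mu> + p (- ?\<mu>))"
      unfolding H_def by (rule B.bracket_part) (use z S in auto)
    have "H ?\<mu> \<otimes> z \<nu> \<in> part B (p \<nu>)"
    proof (cases "p ?\<mu> + p (- ?\<mu>) = 0")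
      case True
      then have "H ?\<mu> \<otimes> z \<nu> \<in> part B (0 + p \<nu>)"
        using Hp z[OF \<nu>] B.bracket_part by metis
      then show ?thesis by (simp only: add_0)
    next
      case False
      then have odd: "p ?\<mu> + p (- ?\<mu>) = 1" by (metis bit_not_zero_iff)
      have "W (H ?\<mu>) = x ?\<mu> \<otimes>\<^bsub>A\<^esub> x (- ?\<mu>)"
        using z S zc by (simp add: H_def W_simps)
      then have "x ?\<mu> \<otimes>\<^bsub>A\<^esub> x (- ?\<mu>) \<in> part A 1" using W_part[OF Hp] unfolding odd by simp
      then have "x \<nu> = \<zero>\<^bsub>A\<^esub>"
        using A.odd_eigenvector_zero[OF _ x_part[OF \<nu>] x_cartan[OF \<mu> \<nu>]] m[OF \<nu>] by blast
      then have "H ?\<mu> \<otimes> z \<nu> = \<zero>"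
        using bracket_fibre(2)[of "z \<nu>" "\<zero>" "H ?\<mu>"] z[OF \<nu>] zc[OF \<nu>] Hc[OF \<mu>] by (simp add: W_zero)
      then show ?thesis by (simp add: B.part_zero)
    qed
    then show ?thesis unfolding y_def by (rule B.part_smult)
  qed
  have yH: "y \<mu> \<otimes> y (- \<mu>) = H \<mu>" if "\<mu> \<in> Sp" for \<mu>
  proof -
    have S: "\<mu> \<in> S" "- \<mu> \<in> S" using Sp that by auto
    then show ?thesis
      unfolding H_def using bracket_fibre(1)[of "y \<mu>" "z \<mu>" "y (- \<mu>)"] bracket_fibre(2)[of "y (- \<mu>)" "z (- \<mu>)" "z \<mu>"]
      using Wy z yc zc by simp
  qed
  have "(y \<sigma> \<otimes> y (- \<sigma>)) \<otimes> y \<nu> = n \<sigma> \<nu> \<odot> y \<nu>" if \<sigma>: "\<sigma> \<in> Sp" and \<nu>: "\<nu> \<in> S" for \<sigma> \<nu>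
  proof -
    let ?\<mu> = "m \<nu>"
    have \<mu>: "?\<mu> \<in> Sp" using m[OF \<nu>] by blast
    note c = Hc[OF \<mu>] Hc[OF \<sigma>] zc[OF \<nu>]
    have "H \<sigma> \<otimes> (H ?\<mu> \<otimes> z \<nu>) = H ?\<mu> \<otimes> (H \<sigma> \<otimes> z \<nu>)"
      using der[OF \<sigma> c(1,3)] HH[OF \<sigma> \<mu>] c by simp
    also have "\<dots> = H ?\<mu> \<otimes> (n \<sigma> \<nu> \<odot> z \<nu>)"
      using bracket_fibre(2)[OF _ _ c(1) WH[OF \<sigma> \<nu>]] c by simp
    finally show ?thesis
      unfolding yH[OF \<sigma>] unfolding y_def using c by (simp add: B.brk_linear mult.commute flip: B.smult_mult)
  qed
  with ypart Wy show ?thesis using that by blast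
qed

text \<open>
  The two sides have the same image in \<open>A\<close>, hence the same bracket with \<open>[y \<mu>, y (-\<mu>)]\<close>. On both,
  this bracket is multiplication by the nonzero scalar \<open>n \<mu> \<nu>\<close>.
\<close>
lemma lifted_relation:
  assumes y: "\<And>\<mu>. \<mu> \<in> S \<Longrightarrow> y \<mu> \<in> part B (p \<mu>)" "\<And>\<mu>. \<mu> \<in> S \<Longrightarrow> W (y \<mu>) = x \<mu>"
    and y_cartan: "\<And>\<nu>. \<nu> \<in> S \<Longrightarrow> (y \<mu> \<otimes> y (- \<mu>)) \<otimes> y \<nu> = n \<mu> \<nu> \<odot> y \<nu>"
    and f: "\<And>g. g \<in> G \<Longrightarrow> wt g \<in> S \<and> f g = y (wt g)"
    and st: "s \<in> lterms G" "t \<in> lterms G" "term_weight wt \<nu> s" "term_weight wt \<nu> t"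
    and \<mu>: "\<mu> \<in> Sp" "n \<mu> \<nu> \<noteq> 0"
    and n_add: "\<And>\<nu> \<nu>'. n \<mu> (\<nu> + \<nu>') = n \<mu> \<nu> + n \<mu> \<nu>'"
    and eq: "term_eval A (\<lambda>g. x (wt g)) s = term_eval A (\<lambda>g. x (wt g)) t"
  shows "term_eval B f s = term_eval B f t"
proof -
  let ?H = "y \<mu> \<otimes> y (- \<mu>)"
  have S: "\<mu> \<in> S" "- \<mu> \<in> S" using Sp \<mu> by auto
  have Hc: "?H \<in> carrier B" using S y(1) B.part_carrier by blast
  have fc: "f g \<in> carrier B" if "g \<in> G" for g using f[OF that] y(1) B.part_carrier by metis
  note cl = B.term_eval_closed[of G f, OF fc]
  have weight: "?H \<otimes> term_eval B f t = n \<mu> \<nu> \<odot> term_eval B f t"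
    if "term_weight wt \<nu> t" "t \<in> lterms G" for t \<nu>
    using that
  proof (induction)
    case (2 g)
    then show ?case using f y_cartan by simp
  next
    case (5 \<nu> s \<nu>' t)
    have "?H \<otimes> (term_eval B f s \<otimes> term_eval B f t) =
       (?H \<otimes> term_eval B f s) \<otimes> term_eval B f t \<oplus> term_eval B f s \<otimes> (?H \<otimes> term_eval B f t)"
      using S y \<mu> 5 cl by (intro cartan_derivation) auto
    then show ?case using 5 cl by (simp add: B.brk_linear n_add B.smult_left_add)
  qed (use Hc cl in \<open>simp_all add: B.brk_linear B.smult_right_add mult.commute flip: B.smult_mult\<close>)
  have "W (term_eval B f t) = term_eval A (\<lambda>g. x (wt g)) t" if "t \<in> lterms G" for t
  proof -
    have "W (term_eval B f t) = term_eval A (\<lambda>g. W (f g)) t" by (rule W_term_eval[OF fc that])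
    also have "\<dots> = term_eval A (\<lambda>g. x (wt g)) t"
      using that f y(2) by (induction t) auto
    finally show ?thesis .
  qed
  then have "W (term_eval B f s) = W (term_eval B f t)" using st eq by simp
  then have "?H \<otimes> term_eval B f s = ?H \<otimes> term_eval B f t"
    using bracket_fibre(2) cl st Hc by blast
  then have "n \<mu> \<nu> \<odot> term_eval B f s = n \<mu> \<nu> \<odot> term_eval B f t"
    using weight st by simp
  then have "inverse (n \<mu> \<nu>) \<odot> (n \<mu> \<nu> \<odot> term_eval B f s) = inverse (n \<mu> \<nu>) \<odot> (n \<mu> \<nu> \<odot> term_eval B f t)"
    by simp
  then show ?thesis using \<mu>(2) cl st by (simp flip: B.smult_mult)
qed

end

end

section \<open>Connectedness of affine diagrams\<close>

lemma chain_iff: "(i, j, m) \<in> chain a b \<longleftrightarrow> j = Suc i \<and> m = 1 \<and> a \<le> i \<and> i < b"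
  by (auto simp: chain_def)

lemmas dynkin_edges_unfold =
  dynkin_edges.simps Un_iff insert_iff empty_iff chain_iff prod.inject valid_rank.simps

lemma dynkin_edges_antisym:
  "valid_rank T l \<and> (i, j, m) \<in> dynkin_edges T l \<and> (j, i, m') \<in> dynkin_edges T l \<longrightarrow> False"
  by (induct T; unfold dynkin_edges_unfold; presburger)

lemma dynkin_edges_unique:
  "valid_rank T l \<and> (i, j, m) \<in> dynkin_edges T l \<and> (i, j, m') \<in> dynkin_edges T l \<longrightarrow> m' = m"
  by (induct T; unfold dynkin_edges_unfold; presburger)

lemma dynkin_edges_facts:
  assumes "valid_rank T l" "(i, j, m) \<in> dynkin_edges T l"
  shows "i \<le> l" "j \<le> l" "i \<noteq> j" "m \<in> {1, 2, 3}" "(j, i, m') \<notin> dynkin_edges T l"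
    "(i, j, m') \<in> dynkin_edges T l \<Longrightarrow> m' = m"
proof -
  show "i \<le> l" "j \<le> l" "i \<noteq> j" "m \<in> {1, 2, 3}"
    using assms by (cases T; auto simp: chain_iff)+
  show "(j, i, m') \<notin> dynkin_edges T l" "(i, j, m') \<in> dynkin_edges T l \<Longrightarrow> m' = m"
    using assms dynkin_edges_antisym dynkin_edges_unique by blast+
qed

lemma affine_cartan_edge:
  assumes "valid_rank T l" "(i, j, m) \<in> dynkin_edges T l"
  shows "affine_cartan T l i j = - m" "affine_cartan T l j i = - 1"
proof -
  note facts = dynkin_edges_facts[OF assms]
  have the: "(THE m. (i, j, m) \<in> dynkin_edges T l) = m"
    using assms(2) facts(6) by (intro the_equality)
  have ij: "i \<noteq> j" "j \<noteq> i" using facts(3) by simp_all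
  have ex: "\<exists>m. (i, j, m) \<in> dynkin_edges T l" "\<not> (\<exists>m. (j, i, m) \<in> dynkin_edges T l)"
    using assms(2) facts(5) by blast+
  show "affine_cartan T l i j = - m" "affine_cartan T l j i = - 1"
    unfolding affine_cartan_def using ij ex by (simp_all only: if_True if_False the simp_thms)
qed

lemma affine_cartan_range:
  assumes "valid_rank T l" "i \<noteq> j"
  shows "affine_cartan T l i j \<in> {0, - 1, - 2, - 3}"
proof (cases "\<exists>m. (i, j, m) \<in> dynkin_edges T l")
  case True
  then obtain m where m: "(i, j, m) \<in> dynkin_edges T l" by blast
  then show ?thesis
    using affine_cartan_edge(1)[OF assms(1) m] dynkin_edges_facts(4)[OF assms(1) m] by auto
next
  case False
  then show ?thesis
    using assms(2) unfolding affine_cartan_def by (simp only: if_False if_split) simp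
qed

lemma chain_connected:
  assumes "\<And>i j m. (i, j, m) \<in> chain a b \<Longrightarrow> P i = P j" "a \<le> i" "i \<le> b"
  shows "P i = P a"
  using assms(2,3)
proof (induction i rule: dec_induct)
  case (step i)
  then have "P i = P (Suc i)" using assms(1)[of i "Suc i" 1] by (auto simp: chain_def)
  then show ?case using step by simp
qed simp

text \<open>
  In type \<open>A\<close> the edge that closes the cycle is left out: it carries the parameter \<open>q\<close> of the
  deformed relation. The other diagrams are trees.
\<close>
lemma dynkin_connected:
  assumes valid: "valid_rank T l"
    and edge: "\<And>i j m. (i, j, m) \<in> dynkin_edges T l \<Longrightarrow> \<not> (T = Aff_A \<and> i = 0 \<and> j = l) \<Longrightarrow> P i = P j"
    and i: "i \<le> l"
  shows "P i = P 0"
proof -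
  have chain: "P i = P a" if "chain a b \<subseteq> dynkin_edges T l" "T = Aff_A \<Longrightarrow> b = l \<and> a = 0" "a \<le> i" "i \<le> b" for a b i
  proof (rule chain_connected[OF _ that(3,4)])
    fix j k m assume "(j, k, m) \<in> chain a b"
    then show "P j = P k"
      using that(1,2) valid by (intro edge[of j k m]) (auto simp: chain_def)
  qed
  have tail: "P i = P 0"
    if "chain 1 (l - 1) \<subseteq> dynkin_edges T l" "T \<noteq> Aff_A"
      and x: "P 0 = P x" "1 \<le> x" "x \<le> l - 1" and y: "P l = P y" "1 \<le> y" "y \<le> l - 1" for x y
  proof -
    have *: "P k = P 1" if "1 \<le> k" "k \<le> l - 1" for k
      using chain[of 1 "l - 1" k] \<open>chain 1 (l - 1) \<subseteq> dynkin_edges T l\<close> \<open>T \<noteq> Aff_A\<close> that by blast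
    have "P 0 = P 1" "P l = P 1" using *[OF x(2,3)] *[OF y(2,3)] x(1) y(1) by simp_all
    moreover have "i = 0 \<or> i = l \<or> 1 \<le> i \<and> i \<le> l - 1" using i by linarith
    ultimately show ?thesis using *[of i] by metis
  qed
  show ?thesis
  proof (cases T)
    case Aff_A
    then show ?thesis using chain[of 0 l i] i by auto
  next
    case Aff_B
    show ?thesis
    proof (rule tail[where x = "2" and y = "l - 1"])
      show "P 0 = P (2)" using edge[of 0 2 1] Aff_B by simp
      show "P l = P (l - 1)" using edge[of l "l - 1" 2] Aff_B by simp
    qed (use valid Aff_B in auto)
  next
    case Aff_C
    show ?thesis
    proof (rule tail[where x = "1" and y = "l - 1"])
      show "P 0 = P (1)" using edge[of 1 0 2] Aff_C by simp
      show "P l = P (l - 1)" using edge[of "l - 1" l 2] Aff_C by simp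
    qed (use valid Aff_C in auto)
  next
    case Aff_D
    show ?thesis
    proof (rule tail[where x = "2" and y = "l - 2"])
      show "P 0 = P (2)" using edge[of 0 2 1] Aff_D by simp
      show "P l = P (l - 2)" using edge[of "l - 2" l 1] Aff_D by simp
    qed (use valid Aff_D in auto)
  next
    case Aff_E6
    then have l: "l = 6" using valid by simp
    show ?thesis
    proof (rule tail[where x = 3 and y = 3])
      show "P 0 = P 3" using edge[of 0 6 1] edge[of 3 6 1] Aff_E6 by simp
      show "P l = P 3" using edge[of 3 6 1] Aff_E6 l by simp
    qed (use l Aff_E6 in auto)
  next
    case Aff_E7
    then have l: "l = 7" using valid by simp
    have "P 3 = P 7" using edge[of 3 7 1] Aff_E7 by simp
    moreover have *: "k \<le> 6 \<Longrightarrow> P k = P 0" for k using chain[of 0 6 k] Aff_E7 by auto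
    moreover have "i \<le> 6 \<or> i = 7" using i l by linarith
    moreover have "P 3 = P 0" by (rule *) simp
    ultimately show ?thesis by metis
  next
    case Aff_E8
    then have l: "l = 8" using valid by simp
    have "P 5 = P 8" using edge[of 5 8 1] Aff_E8 by simp
    moreover have *: "k \<le> 7 \<Longrightarrow> P k = P 0" for k using chain[of 0 7 k] Aff_E8 by auto
    moreover have "i \<le> 7 \<or> i = 8" using i l by linarith
    moreover have "P 5 = P 0" by (rule *) simp
    ultimately show ?thesis by metis
  next
    case Aff_F4
    then have "i \<in> {0, 1, 2, 3, 4}" using i valid by auto
    then show ?thesis
      using edge[of 0 1 1] edge[of 1 2 1] edge[of 3 2 2] edge[of 3 4 1] Aff_F4 by auto
  next
    case Aff_G2
    then have "i \<in> {0, 1, 2}" using i valid by auto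
    then show ?thesis using edge[of 0 1 1] edge[of 2 1 3] Aff_G2 by auto
  next
    case Tw_A_even
    show ?thesis
    proof (rule tail[where x = "1" and y = "l - 1"])
      show "P 0 = P (1)" using edge[of 0 1 2] Tw_A_even by simp
      show "P l = P (l - 1)" using edge[of "l - 1" l 2] Tw_A_even by simp
    qed (use valid Tw_A_even in auto)
  next
    case Tw_A_odd
    show ?thesis
    proof (rule tail[where x = "2" and y = "l - 1"])
      show "P 0 = P (2)" using edge[of 0 2 1] Tw_A_odd by simp
      show "P l = P (l - 1)" using edge[of "l - 1" l 2] Tw_A_odd by simp
    qed (use valid Tw_A_odd in auto)
  next
    case Tw_D
    show ?thesis
    proof (rule tail[where x = "1" and y = "l - 1"])
      show "P 0 = P (1)" using edge[of 0 1 2] Tw_D by simp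
      show "P l = P (l - 1)" using edge[of l "l - 1" 2] Tw_D by simp
    qed (use valid Tw_D in auto)
  next
    case Tw_E6
    then have "i \<in> {0, 1, 2, 3, 4}" using i valid by auto
    then show ?thesis
      using edge[of 0 1 1] edge[of 1 2 1] edge[of 2 3 2] edge[of 3 4 1] Tw_E6 by auto
  next
    case Tw_D4
    then have "i \<in> {0, 1, 2}" using i valid by auto
    then show ?thesis using edge[of 0 1 1] edge[of 1 2 3] Tw_D4 by auto
  qed
qed

section \<open>Base systems\<close>

context pre_elliptic
begin

sublocale E: vector_space "scl D" by (rule vector_space)

abbreviation J where "J \<equiv> form D"
abbreviation \<alpha> where "\<alpha> \<equiv> sroot D"
abbreviation a where "a \<equiv> avec D"
abbreviation cm where "cm \<equiv> affine_cartan (atype D) (rnk D)"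

lemma J_right [simp]:
  "J x (y + z) = J x y + J x z" "J x (scl D c y) = c * J x y" "J x 0 = 0" "J x (- y) = - J x y"
  "J x (y - z) = J x y - J x z"
proof -
  interpret l: Vector_Spaces.linear "scl D" "(*)" "form D x" by (rule form_linear)
  show "J x (y + z) = J x y + J x z" "J x (scl D c y) = c * J x y" "J x 0 = 0" "J x (- y) = - J x y"
   "J x (y - z) = J x y - J x z"
    by (simp_all add: l.add l.scale l.zero l.neg l.diff)
qed

lemma J_left [simp]:
  "J (y + z) x = J y x + J z x" "J (scl D c y) x = c * J y x" "J 0 x = 0" "J (- y) x = - J y x"
  "J (y - z) x = J y x - J z x"
  using J_right form_sym by metis+

lemma coroot_minus: "coroot D (- x) = - coroot D x"
  by (simp add: coroot_def)

lemma J_coroot: "J (coroot D x) y = 2 / J x x * J x y"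
  by (simp add: coroot_def)

lemma J_a_root [simp]: "i \<le> rnk D \<Longrightarrow> J a (\<alpha> i) = 0" "i \<le> rnk D \<Longrightarrow> J (\<alpha> i) a = 0"
  "J a a = 0"
  using avec_root[of i] form_sym[of a "\<alpha> i"] avec_avec by simp_all

lemma cartan_J:
  assumes "i \<le> rnk D" "j \<le> rnk D"
  shows "2 * J (\<alpha> i) (\<alpha> j) = of_int (cm i j) * J (\<alpha> i) (\<alpha> i)"
  using cartan[OF assms] root_nonisotropic[OF assms(1)] by (simp add: J_coroot field_simps)

lemma cm_zero_iff:
  assumes "i \<le> rnk D" "j \<le> rnk D"
  shows "cm i j = 0 \<longleftrightarrow> J (\<alpha> i) (\<alpha> j) = 0" "cm j i = 0 \<longleftrightarrow> J (\<alpha> i) (\<alpha> j) = 0"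
  using cartan_J[OF assms] cartan_J[OF assms(2,1)] form_sym[of "\<alpha> i" "\<alpha> j"]
    root_nonisotropic[OF assms(1)] root_nonisotropic[OF assms(2)] by auto

lemma sroot_inj: "i \<le> rnk D \<Longrightarrow> j \<le> rnk D \<Longrightarrow> \<alpha> i = \<alpha> j \<Longrightarrow> i = j"
proof -
  have "distinct (map \<alpha> [0..<Suc (rnk D)])"
    using basis_distinct unfolding basis_list_def distinct_append by (rule conjunct1)
  then have "inj_on \<alpha> {0..<Suc (rnk D)}" by (simp only: distinct_map set_upt)
  then show "i \<le> rnk D \<Longrightarrow> j \<le> rnk D \<Longrightarrow> \<alpha> i = \<alpha> j \<Longrightarrow> i = j"
    by (metis inj_onD atLeastLessThan_iff le0 less_Suc_eq_le)
qed

lemma a_not_root: "i \<le> rnk D \<Longrightarrow> \<alpha> i \<noteq> a"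
  using root_nonisotropic[of i] by force

lemma cnum_cases: "cnum D x = 1 \<or> cnum D x = 2"
  by (simp add: cnum_def)

lemma cnum_pos: "cnum D x \<noteq> 0"
  using cnum_cases[of x] by auto

lemma J_star [simp]:
  "i \<le> rnk D \<Longrightarrow> J (star D x) (\<alpha> i) = of_nat (cnum D x) * J x (\<alpha> i)"
  "i \<le> rnk D \<Longrightarrow> J (\<alpha> i) (star D x) = of_nat (cnum D x) * J (\<alpha> i) x"
  "i \<le> rnk D \<Longrightarrow> J a (star D (\<alpha> i)) = 0"
  "i \<le> rnk D \<Longrightarrow> j \<le> rnk D \<Longrightarrow> J (star D (\<alpha> i)) (star D (\<alpha> j)) = of_nat (cnum D (\<alpha> i)) * of_nat (cnum D (\<alpha> j)) * J (\<alpha> i) (\<alpha> j)"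
  by (simp_all add: star_def)

text \<open>
  Up to the radical direction \<open>a\<close>, every element of \<open>B_all D\<close> is a nonzero multiple of a simple root;
  pairings with such elements are therefore computed from the Cartan matrix.
\<close>
lemma B_all_form:
  assumes "\<mu> \<in> B_all D"
  obtains i s k where "i \<le> rnk D" "s \<noteq> 0" "\<mu> = scl D s (\<alpha> i) + scl D k a"
proof -
  have plus: "\<exists>i s k. i \<le> rnk D \<and> s \<noteq> 0 \<and> \<mu> = scl D s (\<alpha> i) + scl D k a" if "\<mu> \<in> B_plus D" for \<mu>
  proof (cases "\<mu> \<in> simple D")
    case True
    then obtain i where "i \<le> rnk D" "\<mu> = \<alpha> i" by (auto simp: simple_def)
    then show ?thesis by (intro exI[of _ i] exI[of _ 1] exI[of _ 0]) auto
  next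
    case False
    then have "\<mu> \<in> star D ` simple D" using that by (auto simp: B_plus_def)
    then obtain i where "i \<le> rnk D" "\<mu> = star D (\<alpha> i)" by (auto simp: simple_def)
    then show ?thesis
      using cnum_pos[of "\<alpha> i"] by (intro exI[of _ i] exI[of _ "of_nat (cnum D (\<alpha> i))"] exI[of _ "of_nat (kk D (\<alpha> i))"])
        (simp add: star_def)
  qed
  from assms consider "\<mu> \<in> B_plus D" | "- \<mu> \<in> B_plus D" by (auto simp: B_all_def)
  then show ?thesis
  proof cases
    case 1
    then show ?thesis using plus that by blast
  next
    case 2
    then obtain i s k where "i \<le> rnk D" "s \<noteq> 0" "- \<mu> = scl D s (\<alpha> i) + scl D k a" using plus by blast
    moreover from this have "\<mu> = scl D (- s) (\<alpha> i) + scl D (- k) a"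
      by (simp add: equation_minus_iff[of \<mu>] minus_equation_iff[of \<mu>])
    ultimately show ?thesis using that[of i "- s" "- k"] by simp
  qed
qed

lemma B_all_nonisotropic:
  assumes "\<mu> \<in> B_all D"
  shows "J \<mu> \<mu> \<noteq> 0"
proof -
  obtain i s k where "i \<le> rnk D" "s \<noteq> 0" "\<mu> = scl D s (\<alpha> i) + scl D k a"
    using B_all_form[OF assms] .
  then show ?thesis using root_nonisotropic[of i] by simp
qed

lemma J_a_B_all:
  assumes "\<mu> \<in> B_all D"
  shows "J a \<mu> = 0"
proof -
  obtain i s k where "i \<le> rnk D" "s \<noteq> 0" "\<mu> = scl D s (\<alpha> i) + scl D k a"
    using B_all_form[OF assms] .
  then show ?thesis by simp
qed

lemma B_all_minus: "- \<mu> \<in> B_all D \<longleftrightarrow> \<mu> \<in> B_all D"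
  by (force simp: B_all_def)

lemma B_plus_B_all: "\<mu> \<in> B_plus D \<Longrightarrow> \<mu> \<in> B_all D"
  by (simp add: B_all_def)

lemma B_plusI: "i \<le> rnk D \<Longrightarrow> \<alpha> i \<in> B_plus D" "i \<le> rnk D \<Longrightarrow> star D (\<alpha> i) \<in> B_plus D"
  by (auto simp: B_plus_def simple_def)

lemma B_plus_cases:
  assumes "\<mu> \<in> B_plus D"
  obtains i where "i \<le> rnk D" "\<mu> = \<alpha> i" | i where "i \<le> rnk D" "\<mu> = star D (\<alpha> i)"
  using assms by (auto simp: B_plus_def simple_def)

lemma J_coroot_self: "\<mu> \<in> B_all D \<Longrightarrow> J (coroot D \<mu>) \<mu> = 2"
  using B_all_nonisotropic by (simp add: J_coroot)

subsection \<open>Weights\<close>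

definition gen_weight :: "'e gen \<Rightarrow> 'e" where
  "gen_weight g = (case g of Hg \<sigma> \<Rightarrow> 0 | Eg \<mu> \<Rightarrow> \<mu>)"

lemma gen_weight_simps [simp]: "gen_weight (Hg \<sigma>) = 0" "gen_weight (Eg \<mu>) = \<mu>"
  by (simp_all add: gen_weight_def)

abbreviation weighted where "weighted \<equiv> term_weight gen_weight"

lemma weighted_gen: "weighted \<mu> (ee \<mu>)" "weighted 0 (hh \<sigma>)"
  using term_weight.intros(2)[of gen_weight "Eg \<mu>"] term_weight.intros(2)[of gen_weight "Hg \<sigma>"] by simp_all

lemma weighted_ad_pow:
  "weighted \<mu> s \<Longrightarrow> weighted \<nu> t \<Longrightarrow> weighted (scl D (of_nat n) \<mu> + \<nu>) (ad_pow s n t)"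
proof (induction n)
  case (Suc n)
  then have "weighted (\<mu> + (scl D (of_nat n) \<mu> + \<nu>)) (ad_pow s (Suc n) t)"
    by (simp add: term_weight.intros)
  moreover have "\<mu> + (scl D (of_nat n) \<mu> + \<nu>) = scl D (of_nat (Suc n)) \<mu> + \<nu>"
    by (simp add: E.scale_left_distrib)
  ultimately show ?case by simp
qed simp

lemma ad_pow_lterms [simp]: "s \<in> lterms G \<Longrightarrow> t \<in> lterms G \<Longrightarrow> ad_pow s n t \<in> lterms G"
  by (induction n) auto

text \<open>
  For a regular weight some Cartan element of the derived algebra acts by a nonzero scalar. The Cartan
  elements \<open>h\<^sub>\<sigma>\<close> with \<open>\<sigma>\<close> outside the span of the roots and \<open>a\<close> must not be used here, since
  they do not lift to a central extension of the derived algebra.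
\<close>
definition regular :: "'e \<Rightarrow> bool" where
  "regular \<nu> \<longleftrightarrow> (\<exists>\<mu> \<in> B_plus D. J (coroot D \<mu>) \<nu> \<noteq> 0)"

lemma regularI: "\<mu> \<in> B_plus D \<Longrightarrow> J \<mu> \<nu> \<noteq> 0 \<Longrightarrow> regular \<nu>"
  unfolding regular_def using B_all_nonisotropic[OF B_plus_B_all] by (fastforce simp: J_coroot)

lemma B_all_regular:
  assumes "\<mu> \<in> B_all D"
  shows "regular \<mu>"
proof -
  have "J \<mu> \<mu> \<noteq> 0" "J (- \<mu>) \<mu> \<noteq> 0" using B_all_nonisotropic[OF assms] by simp_all
  moreover have "\<mu> \<in> B_plus D \<or> - \<mu> \<in> B_plus D" using assms by (auto simp: B_all_def)
  ultimately show ?thesis using regularI by blast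
qed

text \<open>
  Pairing the weight of the relation with the coroot of \<open>\<mu>\<close> gives \<open>2x + r\<close>, where \<open>r\<close> is the pairing
  of \<open>\<nu>\<close> with that coroot and \<open>x\<close> the exponent. The real part is positive because \<open>x\<close> exceeds \<open>- Re r\<close> if this is positive
  and is \<open>1\<close> otherwise.
\<close>
lemma serre_regular:
  assumes "\<mu> \<in> B_all D"
  shows "regular (scl D (of_nat (xnum D \<mu> \<nu>)) \<mu> + \<nu>)"
proof -
  let ?r = "Re (J (coroot D \<mu>) \<nu>)"
  have pos: "0 < 2 * real (xnum D \<mu> \<nu>) + ?r"
  proof (cases "?r < 0")
    case True
    then have "real (xnum D \<mu> \<nu>) = of_int \<lfloor>1 - ?r\<rfloor>" by (simp add: xnum_def)
    then have "- ?r < real (xnum D \<mu> \<nu>)" by linarith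
    then show ?thesis using True by linarith
  qed (simp add: xnum_def)
  have "J (coroot D \<mu>) (scl D (of_nat (xnum D \<mu> \<nu>)) \<mu> + \<nu>) = 2 * of_nat (xnum D \<mu> \<nu>) + J (coroot D \<mu>) \<nu>"
    using J_coroot_self[OF assms] by simp
  then have "Re (J (coroot D \<mu>) (scl D (of_nat (xnum D \<mu> \<nu>)) \<mu> + \<nu>)) \<noteq> 0"
    using pos by (metis Re_complex_of_real complex_Re_of_nat mult_2 of_nat_add plus_complex.simps(1) less_irrefl)
  then have nz: "J (coroot D \<mu>) (scl D (of_nat (xnum D \<mu> \<nu>)) \<mu> + \<nu>) \<noteq> 0" by (metis zero_complex.simps(1))
  from assms consider "\<mu> \<in> B_plus D" | "- \<mu> \<in> B_plus D" by (auto simp: B_all_def)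
  then show ?thesis
  proof cases
    case 1
    then show ?thesis using nz regular_def by blast
  next
    case 2
    then show ?thesis using nz regular_def coroot_minus[of \<mu>] J_left(4) by (metis neg_equal_0_iff_equal)
  qed
qed

end

section \<open>Weights of the defining relations\<close>

definition cartan_rels ::
    "'e::ab_group_add base_system \<Rightarrow> ('e \<Rightarrow> 'e \<Rightarrow> complex) \<Rightarrow> ('e gen lterm \<times> 'e gen lterm) set" where
  "cartan_rels D F =
     {(Add (Smult x (hh \<sigma>)) (Smult y (hh \<tau>)), hh (scl D x \<sigma> + scl D y \<tau>)) | x y \<sigma> \<tau>. True} \<union>
     {(Br (hh \<sigma>) (hh \<tau>), Zero) | \<sigma> \<tau>. True} \<union>
     {(Br (hh \<sigma>) (ee \<mu>), Smult (F \<sigma> \<mu>) (ee \<mu>)) | \<sigma> \<mu>. \<mu> \<in> B_all D} \<union>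
     {(Br (ee \<mu>) (ee (- \<mu>)), hh (coroot D \<mu>)) | \<mu>. \<mu> \<in> B_plus D}"

definition nilpotency_rels :: "'e::ab_group_add base_system \<Rightarrow> ('e gen lterm \<times> 'e gen lterm) set" where
  "nilpotency_rels D = {(ad_pow (ee \<mu>) (xnum D \<mu> \<nu>) (ee \<nu>), Zero) | \<mu> \<nu>.
     \<mu> \<in> B_all D \<and> \<nu> \<in> B_all D \<and> \<mu> \<noteq> \<nu> \<and> \<mu> + \<nu> \<noteq> 0}"

text \<open>
  The triples whose relations in \<open>rels_star\<close> are part of the presentation of \<open>gbar q D\<close>.
\<close>
definition undeformed :: "'e::ab_group_add base_system \<Rightarrow> ('e \<times> 'e \<times> nat) set" where
  "undeformed D = (if atype D = Aff_A
     then adm D - {(sroot D 0, sroot D (rnk D), 1), (sroot D (rnk D), sroot D 0, 1)} else adm D)"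

definition deformed_rels ::
    "complex \<Rightarrow> 'e::ab_group_add base_system \<Rightarrow> ('e gen lterm \<times> 'e gen lterm) set" where
  "deformed_rels q D = (let \<alpha>0 = sroot D 0; \<alpha>l = sroot D (rnk D) in if atype D = Aff_A then
     {(Smult q (Br (ee (star D \<alpha>0)) (ee \<alpha>l)), Br (ee \<alpha>0) (ee (star D \<alpha>l))),
      (Smult (inverse q) (Br (ee (- star D \<alpha>0)) (ee (- \<alpha>l))),
       Br (ee (- \<alpha>0)) (ee (- star D \<alpha>l)))} else {})"

definition serre_rels ::
    "complex \<Rightarrow> 'e::ab_group_add base_system \<Rightarrow> ('e gen lterm \<times> 'e gen lterm) set" where
  "serre_rels q D =
     nilpotency_rels D \<union> rels_star D (undeformed D) \<union> rels_mixed D \<union> deformed_rels q D"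

lemma gbar_presentation:
  "gbar q D = presented_lsa (gens D) (gen_parity D) (cartan_rels D (form D) \<union> serre_rels q D)"
  unfolding gbar_def gq_alg_def g_alg_def rels_basic_def cartan_rels_def serre_rels_def
    nilpotency_rels_def undeformed_def deformed_rels_def Let_def
  by (cases "atype D = Aff_A")
    (simp_all only: simp_thms if_True if_False Un_ac Un_empty_right Un_empty_left)

context quasi_elliptic
begin

lemma cm_range: "i \<noteq> j \<Longrightarrow> cm i j \<in> {0, - 1, - 2, - 3}"
  using affine_cartan_range[OF rank_valid] .

lemma simple_adj_sroot:
  assumes "i \<le> rnk D" "j \<le> rnk D" "i \<noteq> j" "cm i j \<noteq> 0"
  shows "\<alpha> j \<in> simple_adj D (\<alpha> i)"
proof -
  have "J (\<alpha> j) (\<alpha> i) \<noteq> 0" using cm_zero_iff(2)[OF assms(2,1)] assms(4) by simp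
  moreover have "\<alpha> j \<noteq> \<alpha> i" using sroot_inj assms by metis
  ultimately show ?thesis using assms by (simp add: simple_adj_def simple_def)
qed

lemma cnum_one:
  assumes "i \<le> rnk D" "j \<le> rnk D" "i \<noteq> j" "cm i j \<noteq> 0" "cm i j \<noteq> - 2"
  shows "cnum D (\<alpha> i) = 1"
proof -
  have "complex_of_int (cm i j) \<noteq> - 2"
    using assms(5) by (metis of_int_eq_iff of_int_minus of_int_numeral)
  then have "J (coroot D (\<alpha> i)) (\<alpha> j) \<noteq> - 2" using cartan[OF assms(1,2)] by simp
  then have "\<alpha> i \<notin> simple_B D" using simple_adj_sroot[OF assms(1-4)] by (auto simp: simple_B_def)
  then have "gg D (\<alpha> i) = {}" using KG2[of "\<alpha> i"] assms(1) by (simp add: simple_def)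
  then show ?thesis by (auto simp: cnum_def)
qed

lemma kk_sroot_pos: "i \<le> rnk D \<Longrightarrow> kk D (\<alpha> i) > 0"
  using kk_pos[of "\<alpha> i"] by (simp add: simple_def)

text \<open>
  An edge with \<open>cm j i = -1\<close> yields an admissible triple in this direction; the divisibility is the
  first part of \<open>KG1\<close>.
\<close>
lemma edge_ratio:
  assumes ij: "i \<le> rnk D" "j \<le> rnk D" "i \<noteq> j" and cm: "cm j i = - 1"
  obtains y where "kk D (\<alpha> i) * y = kk D (\<alpha> j)" "y \<ge> 1"
proof -
  have "cm i j \<noteq> 0" using cm cm_zero_iff[OF ij(1,2)] by simp
  then have "\<alpha> j \<in> simple_adj D (\<alpha> i)" using simple_adj_sroot ij by blast
  moreover have "J (coroot D (\<alpha> j)) (\<alpha> i) = - 1" using cartan[OF ij(2,1)] cm by simp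
  ultimately have "of_nat (kk D (\<alpha> j)) / of_nat (kk D (\<alpha> i)) \<in> (\<int> :: complex set)"
    using KG1[of "\<alpha> i" "\<alpha> j"] ij by (simp add: simple_def)
  then obtain z :: int where "of_nat (kk D (\<alpha> j)) / of_nat (kk D (\<alpha> i)) = complex_of_int z"
    by (auto elim: Ints_cases)
  then have "complex_of_int (int (kk D (\<alpha> j))) = complex_of_int (z * int (kk D (\<alpha> i)))"
    using kk_sroot_pos[OF ij(1)] by (simp add: divide_eq_eq)
  then have z: "int (kk D (\<alpha> j)) = z * int (kk D (\<alpha> i))" by (simp only: of_int_eq_iff)
  have "z > 0"
    using z kk_sroot_pos[OF ij(1)] kk_sroot_pos[OF ij(2)] by (smt (verit) mult_nonpos_nonneg of_nat_0_less_iff)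
  then have "kk D (\<alpha> i) * nat z = kk D (\<alpha> j)" "nat z \<ge> 1"
    using z by (simp_all add: mult.commute flip: of_nat_eq_iff[where 'a = int])
  then show ?thesis using that by blast
qed

text \<open>
  Besides the shape of an admissible triple this collects the numerical facts on which the
  string calculation rests. The bound on \<open>y\<close> is the second part of \<open>KG1\<close>. The case
  \<open>cnum D \<beta> = 2\<close> needs \<open>m = 2\<close> by \<open>KG2\<close>, and then \<open>y = 1\<close> by \<open>KG3\<close>: since \<open>1 \<in> gg D \<beta>\<close>, the
  set in \<open>KG3\<close> contains \<open>1 / y\<close>, but it consists of integers.
\<close>
lemma adm_cases:
  assumes "(\<beta>, \<gamma>, y) \<in> adm D"
  obtains i j m where "i \<le> rnk D" "j \<le> rnk D" "i \<noteq> j" "\<beta> = \<alpha> i" "\<gamma> = \<alpha> j"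
    "cm j i = - 1" "cm i j = - int m" "m \<in> {1, 2, 3}"
    "cnum D \<gamma> = 1" "1 \<le> y" "kk D \<beta> * y = kk D \<gamma>" "cnum D \<beta> * y \<le> m"
    "cnum D \<beta> = 2 \<Longrightarrow> m = 2 \<and> y = 1"
proof -
  obtain i j where ij: "i \<le> rnk D" "j \<le> rnk D" "\<beta> = \<alpha> i" "\<gamma> = \<alpha> j" "\<beta> \<noteq> \<gamma>"
    using assms by (auto simp: adm_def simple_def)
  have y: "J \<beta> (coroot D \<gamma>) = - 1" "1 \<le> y" "kk D \<beta> * y = kk D \<gamma>"
    using assms by (auto simp: adm_def)
  have ne: "i \<noteq> j" using ij by blast
  have J\<gamma>: "J (coroot D \<gamma>) \<beta> = - 1" using y(1) form_sym by metis
  then have "complex_of_int (cm j i) = complex_of_int (- 1)"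
    using cartan[OF ij(2,1)] ij by simp
  then have cm: "cm j i = - 1" by (simp only: of_int_eq_iff)
  have cm0: "cm i j \<noteq> 0" using cm cm_zero_iff[OF ij(1,2)] by simp
  define m where "m = nat (- cm i j)"
  have m: "cm i j = - int m" "m \<in> {1, 2, 3}" using cm_range[OF ne] cm0 by (auto simp: m_def)
  have adj: "\<gamma> \<in> simple_adj D \<beta>" using simple_adj_sroot[OF ij(1,2) ne cm0] ij by simp
  have c\<gamma>: "cnum D \<gamma> = 1" using cnum_one[OF ij(2,1)] ne cm ij by simp
  have k: "kk D \<beta> > 0" using kk_sroot_pos ij by simp
  have ratio: "of_nat (kk D \<beta>) / of_nat (kk D \<gamma>) = (1 / of_nat y :: 'x::field_char_0)"
    using k by (simp flip: y(3))
  have "J (coroot D \<beta>) \<gamma> * (of_nat (kk D \<beta>) / of_nat (kk D \<gamma>)) \<in> \<int>"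
    using KG1[of \<beta> \<gamma>] adj J\<gamma> ij by (simp add: simple_def)
  then have "- (of_nat m / of_nat y :: complex) \<in> \<int>"
    unfolding ratio using cartan[OF ij(1,2)] ij m by simp
  then obtain z :: int where "- (of_nat m / of_nat y :: complex) = of_int z" by (rule Ints_cases)
  then have "complex_of_nat m / of_nat y = of_int (- z)" by (simp add: minus_equation_iff)
  then have "complex_of_int (int m) = complex_of_int (- z * int y)"
    using y(2) by (simp add: divide_eq_eq)
  then have "int m = - z * int y" by (simp only: of_int_eq_iff)
  then have "int y dvd int m" by simp
  then have "y \<le> m" using m(2) by (auto dest: dvd_imp_le)
  have c2: "m = 2 \<and> y = 1" if c2: "cnum D \<beta> = 2"
  proof -
    have "cm i j = - 2" using cnum_one[OF ij(1,2) ne cm0] c2 ij by auto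
    then have "m = 2" using m by simp
    have g: "1 \<in> gg D \<beta>"
      using c2 unfolding cnum_def by (auto split: if_splits simp: numeral_eq_Suc intro: exI[of _ 0])
    then have "\<beta> \<in> simple_B D" using KG2[of \<beta>] ij by (auto simp: simple_def)
    note K = KG3[OF this adj]
    have sub: "x \<in> \<int>" if "x \<in> Q" "Q \<in> {{}, \<int>, {2 * z | z. z \<in> \<int>}, {2 * z + 1 | z. z \<in> \<int>}}"
      for x :: rat and Q using that by auto
    have "rat_of_int 1 * (of_nat (kk D \<beta>) / of_nat (kk D \<gamma>)) \<in> \<int>"
      by (rule sub[OF _ K]) (use g in blast)
    then have "1 / rat_of_nat y \<in> \<int>" unfolding ratio by simp
    then obtain z :: int where "1 / rat_of_nat y = of_int z" by (auto elim: Ints_cases)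
    then have "rat_of_int 1 = rat_of_int (z * int y)" using y(2) by (simp add: divide_eq_eq)
    then have "1 = z * int y" by (simp only: of_int_eq_iff)
    then have "int y dvd 1" by (metis dvd_triv_right)
    then show ?thesis using \<open>m = 2\<close> by simp
  qed
  have "cnum D \<beta> * y \<le> m"
    using cnum_cases[of \<beta>] \<open>y \<le> m\<close> c2 by auto
  then show ?thesis
    using that[OF ij(1,2) ne ij(3,4) cm m c\<gamma> y(2,3) _ c2] by blast
qed

text \<open>
  Orthogonality to the root \<open>j\<close> forces \<open>N = 2\<close>, and orthogonality to the root \<open>i\<close> then
  \<open>cm i j = -4\<close>. This value occurs only for rank one diagrams.
\<close>
lemma pair_regular:
  assumes "i \<le> rnk D" "j \<le> rnk D" "i \<noteq> j" "cm j i = - 1" "N \<noteq> 2 \<or> cm i j \<noteq> - 4"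
  shows "\<exists>\<gamma> \<in> {\<alpha> i, \<alpha> j}. J \<gamma> (scl D (of_nat N) (\<alpha> i) + \<alpha> j + scl D c a) \<noteq> 0"
proof (rule ccontr)
  let ?\<nu> = "scl D (of_nat N) (\<alpha> i) + \<alpha> j + scl D c a"
  assume "\<not> ?thesis"
  then have 0: "J (\<alpha> i) ?\<nu> = 0" "J (\<alpha> j) ?\<nu> = 0" by auto
  then have "J (coroot D (\<alpha> j)) ?\<nu> = 0" "J (coroot D (\<alpha> i)) ?\<nu> = 0"
    by (simp_all only: J_coroot mult_zero_right)
  moreover have "J (coroot D (\<alpha> j)) a = 0" "J (coroot D (\<alpha> i)) a = 0"
    using assms by (simp_all add: coroot_def)
  moreover have "J (coroot D (\<alpha> j)) (\<alpha> j) = 2" "J (coroot D (\<alpha> i)) (\<alpha> i) = 2"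
    using J_coroot_self B_plus_B_all B_plusI assms by blast+
  ultimately have "of_nat N * complex_of_int (- 1) + 2 = 0" "of_nat N * 2 + complex_of_int (cm i j) = 0"
    using cartan[OF assms(2,1)] cartan[OF assms(1,2)] assms(4) by simp_all
  then have "complex_of_int (int N) = complex_of_int 2" "complex_of_int (2 * int N + cm i j) = complex_of_int 0"
    by simp_all
  then have "int N = 2" "2 * int N + cm i j = 0" by (simp_all only: of_int_eq_iff)
  then show False using assms(5) by auto
qed

lemma regular_pair:
  assumes "i \<le> rnk D" "j \<le> rnk D" "i \<noteq> j" "cm j i = - 1"
  shows "regular (scl D (of_nat N) (\<alpha> i) + \<alpha> j + scl D c a)"
proof -
  have "cm i j \<noteq> - 4" using cm_range[OF assms(3)] by auto
  then obtain \<gamma> where "\<gamma> \<in> {\<alpha> i, \<alpha> j}" "J \<gamma> (scl D (of_nat N) (\<alpha> i) + \<alpha> j + scl D c a) \<noteq> 0"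
    using pair_regular[OF assms] by blast
  then show ?thesis using regularI B_plusI(1) assms by blast
qed

lemma regular_minus: "regular \<nu> \<Longrightarrow> regular (- \<nu>)"
  by (simp add: regular_def)

text \<open>
  The weights of the two sides of a relation in \<open>rels_star\<close>.
\<close>
lemma star_weight:
  assumes "cnum D \<gamma> = 1" "kk D \<beta> * y = kk D \<gamma>"
  shows "scl D (of_nat (cnum D \<beta> * y)) \<beta> + star D \<gamma> = scl D (of_nat y) (star D \<beta>) + \<gamma>"
proof -
  have "scl D (of_nat (kk D \<gamma>)) a = scl D (of_nat y * of_nat (kk D \<beta>)) a"
    by (simp flip: assms(2) add: mult.commute)
  then show ?thesis
    using assms(1) by (simp add: star_def E.scale_right_distrib mult.commute add_ac)
qed

abbreviation Egens where "Egens \<equiv> Eg ` B_all D"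

lemma B_all_simps:
  assumes "i \<le> rnk D"
  shows "\<alpha> i \<in> B_all D" "- \<alpha> i \<in> B_all D" "star D (\<alpha> i) \<in> B_all D" "- star D (\<alpha> i) \<in> B_all D"
  using B_plusI[OF assms] B_plus_B_all B_all_minus by blast+

definition homogeneous_regular where
  "homogeneous_regular r \<longleftrightarrow> fst r \<in> lterms Egens \<and> snd r \<in> lterms Egens \<and>
     (\<exists>\<nu>. weighted \<nu> (fst r) \<and> weighted \<nu> (snd r) \<and> regular \<nu>)"

lemma homogeneous_regularI:
  "s \<in> lterms Egens \<Longrightarrow> t \<in> lterms Egens \<Longrightarrow> weighted \<nu> s \<Longrightarrow> weighted \<nu> t \<Longrightarrow> regular \<nu> \<Longrightarrow>
    homogeneous_regular (s, t)"
  unfolding homogeneous_regular_def by auto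

lemma nilpotency_rels_homogeneous: "r \<in> nilpotency_rels D \<Longrightarrow> homogeneous_regular r"
  using serre_regular by (auto simp: nilpotency_rels_def homogeneous_regular_def
      intro!: exI weighted_ad_pow weighted_gen term_weight.intros)

lemma rels_star_homogeneous:
  assumes "r \<in> rels_star D (adm D)"
  shows "homogeneous_regular r"
proof -
  let ?c = "cnum D"
  obtain \<beta> \<gamma> y where adm: "(\<beta>, \<gamma>, y) \<in> adm D" and
    r: "r = (Smult (of_nat (?c \<beta>)) (ad_pow (ee (star D \<beta>)) y (ee \<gamma>)), ad_pow (ee \<beta>) (?c \<beta> * y) (ee (star D \<gamma>))) \<or>
        r = (Smult ((- 1) ^ (?c \<beta> + 1) * of_nat (?c \<beta>)) (ad_pow (ee (- star D \<beta>)) y (ee (- \<gamma>))),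
             ad_pow (ee (- \<beta>)) (?c \<beta> * y) (ee (- star D \<gamma>)))"
    using assms unfolding rels_star_def by blast
  obtain i j m where ij: "i \<le> rnk D" "j \<le> rnk D" "i \<noteq> j" "\<beta> = \<alpha> i" "\<gamma> = \<alpha> j" "cm j i = - 1"
    and c: "?c \<gamma> = 1" "kk D \<beta> * y = kk D \<gamma>"
    using adm_cases[OF adm] by metis
  define \<nu> where "\<nu> = scl D (of_nat y) (star D \<beta>) + \<gamma>"
  have \<nu>: "\<nu> = scl D (of_nat (?c \<beta> * y)) \<beta> + star D \<gamma>"
    unfolding \<nu>_def by (rule star_weight[OF c, symmetric])
  have "\<nu> = scl D (of_nat (y * ?c \<beta>)) \<beta> + \<gamma> + scl D (of_nat y * of_nat (kk D \<beta>)) a"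
    by (simp add: \<nu>_def star_def E.scale_right_distrib add_ac)
  then have reg: "regular \<nu>" "regular (- \<nu>)" using regular_pair regular_minus ij by metis+
  have w: "weighted \<nu> (ad_pow (ee (star D \<beta>)) y (ee \<gamma>))"
    unfolding \<nu>_def by (intro weighted_ad_pow weighted_gen)
  have w': "weighted \<nu> (ad_pow (ee \<beta>) (?c \<beta> * y) (ee (star D \<gamma>)))"
    unfolding \<nu> by (intro weighted_ad_pow weighted_gen)
  have "- \<nu> = scl D (of_nat y) (- star D \<beta>) + - \<gamma>" unfolding \<nu>_def by simp
  then have w1: "weighted (- \<nu>) (ad_pow (ee (- star D \<beta>)) y (ee (- \<gamma>)))"
    using weighted_ad_pow[OF weighted_gen(1) weighted_gen(1)] by metis
  have "- \<nu> = scl D (of_nat (?c \<beta> * y)) (- \<beta>) + - star D \<gamma>" unfolding \<nu> by simp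
  then have w2: "weighted (- \<nu>) (ad_pow (ee (- \<beta>)) (?c \<beta> * y) (ee (- star D \<gamma>)))"
    using weighted_ad_pow[OF weighted_gen(1) weighted_gen(1)] by metis
  show ?thesis
    using r
  proof
    assume "r = (Smult (of_nat (?c \<beta>)) (ad_pow (ee (star D \<beta>)) y (ee \<gamma>)), ad_pow (ee \<beta>) (?c \<beta> * y) (ee (star D \<gamma>)))"
    then show ?thesis
      using w w' reg B_all_simps ij
      by (auto intro!: homogeneous_regularI[of _ _ \<nu>] term_weight.intros(4))
  next
    assume "r = (Smult ((- 1) ^ (?c \<beta> + 1) * of_nat (?c \<beta>)) (ad_pow (ee (- star D \<beta>)) y (ee (- \<gamma>))),
             ad_pow (ee (- \<beta>)) (?c \<beta> * y) (ee (- star D \<gamma>)))"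
    then show ?thesis
      using w1 w2 reg B_all_simps ij
      by (auto intro!: homogeneous_regularI[of _ _ "- \<nu>"] term_weight.intros(4))
  qed
qed

lemma rels_mixed_homogeneous:
  assumes "r \<in> rels_mixed D"
  shows "homogeneous_regular r"
proof -
  obtain \<beta> \<gamma> y n where adm: "(\<beta>, \<gamma>, y) \<in> adm D" and
    r: "r = (ad_pow (ee \<beta>) n (ad_pow (ee (star D \<beta>)) (y - n) (ee \<gamma>)), Zero) \<or>
        r = (ad_pow (ee (- \<beta>)) n (ad_pow (ee (- star D \<beta>)) (y - n) (ee (- \<gamma>))), Zero)"
    using assms unfolding rels_mixed_def by blast
  obtain i j m where ij: "i \<le> rnk D" "j \<le> rnk D" "i \<noteq> j" "\<beta> = \<alpha> i" "\<gamma> = \<alpha> j" "cm j i = - 1"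
    using adm_cases[OF adm] by metis
  define \<nu> where "\<nu> = scl D (of_nat n) \<beta> + (scl D (of_nat (y - n)) (star D \<beta>) + \<gamma>)"
  have "\<nu> = scl D (of_nat (n + (y - n) * cnum D \<beta>)) \<beta> + \<gamma> + scl D (of_nat (y - n) * of_nat (kk D \<beta>)) a"
    by (simp add: \<nu>_def star_def E.scale_right_distrib E.scale_left_distrib add_ac)
  then have reg: "regular \<nu>" "regular (- \<nu>)" using regular_pair regular_minus ij by metis+
  have w: "weighted \<nu> (ad_pow (ee \<beta>) n (ad_pow (ee (star D \<beta>)) (y - n) (ee \<gamma>)))"
    unfolding \<nu>_def by (intro weighted_ad_pow weighted_gen)
  have "- \<nu> = scl D (of_nat n) (- \<beta>) + (scl D (of_nat (y - n)) (- star D \<beta>) + - \<gamma>)" unfolding \<nu>_def by simp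
  then have w': "weighted (- \<nu>) (ad_pow (ee (- \<beta>)) n (ad_pow (ee (- star D \<beta>)) (y - n) (ee (- \<gamma>))))"
    using weighted_ad_pow[OF weighted_gen(1) weighted_ad_pow[OF weighted_gen(1) weighted_gen(1)]] by metis
  show ?thesis
    using r
  proof
    assume "r = (ad_pow (ee \<beta>) n (ad_pow (ee (star D \<beta>)) (y - n) (ee \<gamma>)), Zero)"
    then show ?thesis
      using w reg B_all_simps ij by (auto intro!: homogeneous_regularI[of _ _ \<nu>] term_weight.intros(1))
  next
    assume "r = (ad_pow (ee (- \<beta>)) n (ad_pow (ee (- star D \<beta>)) (y - n) (ee (- \<gamma>))), Zero)"
    then show ?thesis
      using w' reg B_all_simps ij by (auto intro!: homogeneous_regularI[of _ _ "- \<nu>"] term_weight.intros(1))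
  qed
qed

lemma Aff_A_end:
  assumes "atype D = Aff_A"
  shows "cm 0 (rnk D) = - 1" "cm (rnk D) 0 = - 1" "rnk D \<noteq> 0"
proof -
  have "(0, rnk D, 1) \<in> dynkin_edges (atype D) (rnk D)" using assms by simp
  then show "cm 0 (rnk D) = - 1" "cm (rnk D) 0 = - 1"
    using affine_cartan_edge[OF rank_valid] by blast+
  show "rnk D \<noteq> 0" using rank_ge_2 by simp
qed

text \<open>
  The parameter does not affect weights. That the two brackets have equal weights uses
  \<open>k(\<alpha>\<^sub>0) = k(\<alpha>\<^sub>l)\<close>, a consequence of \<open>KG1\<close> read in both directions of the edge.
\<close>
lemma deformed_rels_homogeneous:
  assumes "r \<in> deformed_rels q D"
  shows "homogeneous_regular r"
proof -
  let ?l = "rnk D"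
  have A: "atype D = Aff_A" using assms by (auto simp: deformed_rels_def Let_def split: if_splits)
  note cm = Aff_A_end[OF A]
  have c: "cnum D (\<alpha> 0) = 1" "cnum D (\<alpha> ?l) = 1"
    using cnum_one[of 0 ?l] cnum_one[of ?l 0] cm by simp_all
  have k: "kk D (\<alpha> 0) = kk D (\<alpha> ?l)"
  proof -
    obtain y where "kk D (\<alpha> 0) * y = kk D (\<alpha> ?l)" "y \<ge> 1" using edge_ratio[of 0 ?l] cm by auto
    moreover obtain y' where "kk D (\<alpha> ?l) * y' = kk D (\<alpha> 0)" "y' \<ge> 1" using edge_ratio[of ?l 0] cm by auto
    ultimately show ?thesis by (metis dvd_antisym dvd_triv_left)
  qed
  define \<nu> where "\<nu> = star D (\<alpha> 0) + \<alpha> ?l"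
  have \<nu>: "\<nu> = \<alpha> 0 + star D (\<alpha> ?l)"
    using c k by (simp add: \<nu>_def star_def)
  have "\<nu> = scl D (of_nat 1) (\<alpha> 0) + \<alpha> ?l + scl D (of_nat (kk D (\<alpha> 0))) a"
    using c by (simp add: \<nu>_def star_def)
  then have "regular \<nu>" using regular_pair[of 0 ?l 1] cm by simp
  note reg = this regular_minus[OF this]
  note wBr = term_weight.intros(5)[OF weighted_gen(1) weighted_gen(1)]
  have "weighted \<nu> (Br (ee (star D (\<alpha> 0))) (ee (\<alpha> ?l)))" "weighted \<nu> (Br (ee (\<alpha> 0)) (ee (star D (\<alpha> ?l))))"
    unfolding \<nu>_def by (rule wBr) (fold \<nu>_def, unfold \<nu>, rule wBr)
  moreover have "- \<nu> = - star D (\<alpha> 0) + - \<alpha> ?l" unfolding \<nu>_def by simp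
  then have "weighted (- \<nu>) (Br (ee (- star D (\<alpha> 0))) (ee (- \<alpha> ?l)))" by (metis wBr)
  moreover have "- \<nu> = - \<alpha> 0 + - star D (\<alpha> ?l)" unfolding \<nu> by simp
  then have "weighted (- \<nu>) (Br (ee (- \<alpha> 0)) (ee (- star D (\<alpha> ?l))))" by (metis wBr)
  ultimately have
    "homogeneous_regular (Smult q (Br (ee (star D (\<alpha> 0))) (ee (\<alpha> ?l))), Br (ee (\<alpha> 0)) (ee (star D (\<alpha> ?l))))"
    "homogeneous_regular (Smult (inverse q) (Br (ee (- star D (\<alpha> 0))) (ee (- \<alpha> ?l))),
       Br (ee (- \<alpha> 0)) (ee (- star D (\<alpha> ?l))))"
    using reg B_all_simps[of 0] B_all_simps[of ?l]
    by (auto intro: homogeneous_regularI[of _ _ \<nu>] homogeneous_regularI[of _ _ "- \<nu>"] term_weight.intros(4))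
  then show ?thesis
    using assms A unfolding deformed_rels_def Let_def by auto
qed

lemma serre_rels_homogeneous:
  assumes "(s, t) \<in> serre_rels q D"
  obtains \<nu> where "s \<in> lterms Egens" "t \<in> lterms Egens" "weighted \<nu> s" "weighted \<nu> t" "regular \<nu>"
proof -
  have "rels_star D (undeformed D) \<subseteq> rels_star D (adm D)"
    unfolding rels_star_def undeformed_def by auto
  then have "homogeneous_regular (s, t)"
    using assms nilpotency_rels_homogeneous rels_star_homogeneous rels_mixed_homogeneous
      deformed_rels_homogeneous unfolding serre_rels_def by blast
  then show ?thesis using that unfolding homogeneous_regular_def by auto
qed

end

section \<open>Consistency of the Cartan elements in an extension\<close>

lemma term_eval_ad_pow: "term_eval L f (ad_pow s n t) = ((\<otimes>\<^bsub>L\<^esub>) (term_eval L f s) ^^ n) (term_eval L f t)"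
  by (induction n) simp_all

lemma term_eval_cong:
  assumes "t \<in> lterms G" "\<And>x. x \<in> G \<Longrightarrow> f x = g x"
  shows "term_eval L f t = term_eval L g t"
  using assms(1) by (induction t) (simp_all add: assms(2))

text \<open>
  A family of elements of a Lie superalgebra that satisfies the relations between root vectors, with
  the Cartan elements replaced by brackets \<open>[y \<mu>, y (-\<mu>)]\<close>. Linear relations among the latter are not
  assumed; they are the goal of this section. The constant zero function only completes the
  assignment: no generator \<open>h\<^sub>\<sigma>\<close> occurs in these relations.
\<close>
locale serre_family = quasi_elliptic D + B: lie_superalgebra B
  for D :: "'e::ab_group_add base_system" and B :: "'b lie_superalg" (structure) +
  fixes q :: complex and y :: "'e \<Rightarrow> 'b"
  assumes y_part: "\<mu> \<in> B_all D \<Longrightarrow> y \<mu> \<in> part B (root_parity D \<mu>)"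
    and y_cartan: "\<mu> \<in> B_plus D \<Longrightarrow> \<nu> \<in> B_all D \<Longrightarrow>
          (y \<mu> \<otimes> y (- \<mu>)) \<otimes> y \<nu> = J (coroot D \<mu>) \<nu> \<odot> y \<nu>"
    and y_serre: "(s, t) \<in> serre_rels q D \<Longrightarrow>
          term_eval B (case_gen (\<lambda>\<sigma>. \<zero>) y) s = term_eval B (case_gen (\<lambda>\<sigma>. \<zero>) y) t"
begin

lemma y_closed [simp]: "\<mu> \<in> B_all D \<Longrightarrow> y \<mu> \<in> carrier B"
  using y_part B.part_carrier by blast

lemma y_closed_plus [simp]: "\<mu> \<in> B_plus D \<Longrightarrow> y \<mu> \<in> carrier B" "\<mu> \<in> B_plus D \<Longrightarrow> y (- \<mu>) \<in> carrier B"
  using B_plus_B_all B_all_minus by auto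

text \<open>
  The Cartan element that acts on \<open>y \<nu>\<close> by \<open>J \<mu> \<nu>\<close>, so that it should depend linearly on \<open>\<mu>\<close>;
  the coroot elements are not linear in \<open>\<mu>\<close>.
\<close>
definition dual :: "'e \<Rightarrow> 'b" where
  "dual \<mu> = (J \<mu> \<mu> / 2) \<odot> (y \<mu> \<otimes> y (- \<mu>))"

lemma dual_closed [simp]: "\<mu> \<in> B_plus D \<Longrightarrow> dual \<mu> \<in> carrier B"
  by (simp add: dual_def)

lemma coroot_dual: "\<mu> \<in> B_plus D \<Longrightarrow> y \<mu> \<otimes> y (- \<mu>) = (2 / J \<mu> \<mu>) \<odot> dual \<mu>"
  using B_all_nonisotropic[OF B_plus_B_all] by (simp add: dual_def flip: B.smult_mult)

lemma dual_action:
  assumes "\<mu> \<in> B_plus D" "\<nu> \<in> B_all D"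
  shows "dual \<mu> \<otimes> y \<nu> = J \<mu> \<nu> \<odot> y \<nu>"
  using assms B_all_nonisotropic[OF B_plus_B_all[OF assms(1)]]
  by (simp add: dual_def B.brk_linear y_cartan J_coroot flip: B.smult_mult)

text \<open>
  Otherwise \<open>[y \<mu>, y (-\<mu>)]\<close> would be odd and could not have \<open>y \<mu>\<close> as an eigenvector with eigenvalue
  \<open>2\<close>.
\<close>
lemma parity_minus:
  assumes \<mu>: "\<mu> \<in> B_plus D" and "y \<mu> \<noteq> \<zero>"
  shows "root_parity D (- \<mu>) = root_parity D \<mu>"
proof (rule ccontr)
  assume "root_parity D (- \<mu>) \<noteq> root_parity D \<mu>"
  then have odd: "root_parity D \<mu> + root_parity D (- \<mu>) = 1"
    by (cases "root_parity D \<mu>"; cases "root_parity D (- \<mu>)") simp_all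
  have S: "\<mu> \<in> B_all D" "- \<mu> \<in> B_all D" using \<mu> B_plus_B_all B_all_minus by auto
  have "y \<mu> \<otimes> y (- \<mu>) \<in> part B 1"
    using B.bracket_part[OF y_part[OF S(1)] y_part[OF S(2)]] unfolding odd .
  moreover have "(y \<mu> \<otimes> y (- \<mu>)) \<otimes> y \<mu> = 2 \<odot> y \<mu>"
    using y_cartan[OF \<mu> S(1)] J_coroot_self[OF S(1)] by simp
  ultimately have "y \<mu> = \<zero>"
    using B.odd_eigenvector_zero[OF _ y_part[OF S(1)]] by fastforce
  then show False using assms(2) by blast
qed

lemma dual_part:
  assumes \<mu>: "\<mu> \<in> B_plus D"
  shows "dual \<mu> \<in> part B 0"
proof (cases "y \<mu> = \<zero>")
  case True
  then show ?thesis using \<mu> by (simp add: dual_def B.part_zero)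
next
  case False
  have S: "\<mu> \<in> B_all D" "- \<mu> \<in> B_all D" using \<mu> B_plus_B_all B_all_minus by auto
  have even: "root_parity D \<mu> + root_parity D (- \<mu>) = 0"
    unfolding parity_minus[OF \<mu> False] by (cases "root_parity D \<mu>") simp_all
  have "y \<mu> \<otimes> y (- \<mu>) \<in> part B 0"
    using B.bracket_part[OF y_part[OF S(1)] y_part[OF S(2)]] unfolding even .
  then show ?thesis unfolding dual_def by (rule B.part_smult)
qed

lemma vanishing:
  assumes "\<mu> \<in> B_plus D" "y \<mu> = \<zero> \<or> y (- \<mu>) = \<zero>" "\<nu> \<in> B_all D" "J \<mu> \<nu> \<noteq> 0"
  shows "y \<nu> = \<zero>"
proof -
  have "dual \<mu> = \<zero>" using assms(1,2) by (auto simp: dual_def)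
  then have "J \<mu> \<nu> \<odot> y \<nu> = \<zero>" using dual_action[OF assms(1,3)] assms(3) by simp
  then have "inverse (J \<mu> \<nu>) \<odot> (J \<mu> \<nu> \<odot> y \<nu>) = \<zero>" by simp
  then show ?thesis using assms(3,4) by (simp flip: B.smult_mult)
qed

lemma y_orthogonal:
  assumes "\<mu> \<in> B_all D" "\<nu> \<in> B_all D" "\<mu> \<noteq> \<nu>" "\<mu> + \<nu> \<noteq> 0" "Re (J (coroot D \<mu>) \<nu>) \<ge> 0"
  shows "y \<mu> \<otimes> y \<nu> = \<zero>"
proof -
  have "(ad_pow (ee \<mu>) (xnum D \<mu> \<nu>) (ee \<nu>), Zero) \<in> serre_rels q D"
    using assms unfolding serre_rels_def nilpotency_rels_def by blast
  moreover have "xnum D \<mu> \<nu> = 1" using assms(5) by (simp add: xnum_def)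
  ultimately show ?thesis using y_serre by fastforce
qed

lemma root_string:
  assumes \<mu>: "\<mu> \<in> B_plus D" and \<nu>: "\<nu> \<in> B_plus D" and ne: "\<mu> \<noteq> \<nu>" "\<mu> + \<nu> \<noteq> 0"
    and m: "J (coroot D \<mu>) \<nu> = - of_nat m" "m \<in> {1, 2, 3}" "n \<le> m"
    and nz: "y \<mu> \<noteq> \<zero>" "y \<nu> \<noteq> \<zero>"
  shows "\<exists>d. d \<noteq> 0 \<and> ((\<otimes>) (y \<mu>) ^^ n) (y \<nu>) \<otimes> ((\<otimes>) (y (- \<mu>)) ^^ n) (y (- \<nu>)) =
      d \<odot> (of_nat n \<odot> dual \<mu> \<oplus> dual \<nu>)"
proof -
  have S: "\<mu> \<in> B_all D" "- \<mu> \<in> B_all D" "\<nu> \<in> B_all D" "- \<nu> \<in> B_all D"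
    using \<mu> \<nu> B_plus_B_all B_all_minus by auto
  have ne': "\<mu> \<noteq> - \<nu>" "\<mu> + - \<nu> \<noteq> 0" "- \<mu> \<noteq> \<nu>" "- \<mu> + \<nu> \<noteq> 0"
    using ne by (auto simp: eq_neg_iff_add_eq_0 minus_equation_iff[of \<mu> \<nu>] neg_eq_iff_add_eq_0)
  have P: "J \<mu> \<mu> \<noteq> 0" "J \<nu> \<nu> \<noteq> 0" using B_all_nonisotropic S by auto
  show ?thesis
  proof (rule B.string_pairing[where \<kappa> = "2 / J \<nu> \<nu>" and P = "J \<mu> \<mu>" and r = "J \<mu> \<nu>"])
    show "y \<mu> \<in> part B (root_parity D \<mu>)" "y (- \<mu>) \<in> part B (root_parity D \<mu>)"
      "y \<nu> \<in> part B (root_parity D \<nu>)" "y (- \<nu>) \<in> part B (root_parity D \<nu>)"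
      using y_part S parity_minus[OF \<mu> nz(1)] parity_minus[OF \<nu> nz(2)] by metis+
    show "dual \<mu> \<in> part B 0" "dual \<nu> \<in> part B 0" using dual_part \<mu> \<nu> by auto
    show "J \<mu> \<mu> \<noteq> 0" "2 / J \<nu> \<nu> \<noteq> 0" using P by auto
    show "y \<mu> \<otimes> y (- \<mu>) = (2 / J \<mu> \<mu>) \<odot> dual \<mu>" "y \<nu> \<otimes> y (- \<nu>) = (2 / J \<nu> \<nu>) \<odot> dual \<nu>"
      using coroot_dual \<mu> \<nu> by auto
    show "dual \<mu> \<otimes> y \<mu> = J \<mu> \<mu> \<odot> y \<mu>" "dual \<mu> \<otimes> y (- \<mu>) = (- J \<mu> \<mu>) \<odot> y (- \<mu>)"
      "dual \<mu> \<otimes> y \<nu> = J \<mu> \<nu> \<odot> y \<nu>" "dual \<mu> \<otimes> y (- \<nu>) = (- J \<mu> \<nu>) \<odot> y (- \<nu>)"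
      "dual \<nu> \<otimes> y (- \<mu>) = (- J \<mu> \<nu>) \<odot> y (- \<mu>)"
      using dual_action[OF \<mu>] dual_action[OF \<nu>] S form_sym[of \<mu> \<nu>] by simp_all
    show "y \<mu> \<otimes> y (- \<nu>) = \<zero>" "y (- \<mu>) \<otimes> y \<nu> = \<zero>"
      using S ne' m(1) by (intro y_orthogonal; simp add: coroot_minus)+
  next
    fix k assume k: "k \<in> {1..n}"
    have "- 2 * J \<mu> \<nu> / J \<mu> \<mu> = of_nat m" using m(1) by (simp add: J_coroot)
    moreover have "string_coeff (koszul (root_parity D \<mu>) (root_parity D \<mu>)) (of_nat m) k \<noteq> 0"
      using koszul_cases m(2,3) k by (intro string_coeff_nonzero[where n = n]) auto
    ultimately show "string_coeff (koszul (root_parity D \<mu>) (root_parity D \<mu>)) (- 2 * J \<mu> \<nu> / J \<mu> \<mu>) k \<noteq> 0"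
      by simp
  qed
qed

lemma J_Lam_a_star: "i \<le> rnk D \<Longrightarrow> J (Lam_a D) (star D (\<alpha> i)) = of_nat (kk D (\<alpha> i))"
  by (simp add: star_def Lam_a_root Lam_a_avec)

text \<open>
  The pairing with \<open>Lam_a D\<close> is positive on starred roots and zero on simple roots.
\<close>
lemma star_sroot_distinct:
  assumes "i \<le> rnk D" "j \<le> rnk D"
  shows "star D (\<alpha> i) \<noteq> \<alpha> j" "star D (\<alpha> i) + \<alpha> j \<noteq> 0"
proof -
  have "J (Lam_a D) (star D (\<alpha> i)) \<noteq> J (Lam_a D) (\<alpha> j)"
    "J (Lam_a D) (star D (\<alpha> i) + \<alpha> j) \<noteq> J (Lam_a D) 0"
    using assms kk_sroot_pos[of i] by (simp_all add: J_Lam_a_star Lam_a_root)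
  then show "star D (\<alpha> i) \<noteq> \<alpha> j" "star D (\<alpha> i) + \<alpha> j \<noteq> 0" by metis+
qed

text \<open>
  Both sides are dual to the common weight of the two sides \<open>X1, X2\<close> of the relation in \<open>rels_star\<close> for the triple, and by
  \<open>root_string\<close> they are proportional to the brackets of \<open>X1, X2\<close> with the corresponding sides
  \<open>Y1, Y2\<close> of the opposite relation, hence to each other. The factor is found to be \<open>1\<close> by letting both
  act on a root vector. If one of the root vectors involved vanishes, then all of them do, and both sides
  are zero.
\<close>
lemma dual_edge:
  assumes "(\<beta>, \<gamma>, n) \<in> undeformed D"
  shows "of_nat n \<odot> dual (star D \<beta>) \<oplus> dual \<gamma> =
    of_nat (cnum D \<beta> * n) \<odot> dual \<beta> \<oplus> dual (star D \<gamma>)"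
proof -
  have "(\<beta>, \<gamma>, n) \<in> adm D" using assms by (auto simp: undeformed_def split: if_splits)
  then obtain i j m where ij: "i \<le> rnk D" "j \<le> rnk D" "i \<noteq> j" "\<beta> = \<alpha> i" "\<gamma> = \<alpha> j" "cm j i = - 1"
    and m: "cm i j = - int m" "m \<in> {1, 2, 3}" and c\<gamma>: "cnum D \<gamma> = 1" and n: "1 \<le> n"
    and cn: "cnum D \<beta> * n \<le> m" "cnum D \<beta> = 2 \<Longrightarrow> m = 2 \<and> n = 1"
    using adm_cases by metis
  define c where "c = cnum D \<beta>"
  have c: "c = 1 \<or> c = 2" using cnum_cases c_def by auto
  define S where "S = {\<beta>, \<gamma>, star D \<beta>, star D \<gamma>}"
  have S_plus: "\<mu> \<in> B_plus D" if "\<mu> \<in> S" for \<mu>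
    using that ij B_plusI unfolding S_def by auto
  note plus = S_plus[unfolded S_def, of \<beta>, simplified] S_plus[unfolded S_def, of \<gamma>, simplified]
    S_plus[unfolded S_def, of "star D \<beta>", simplified] S_plus[unfolded S_def, of "star D \<gamma>", simplified]
  have J\<beta>\<gamma>: "J \<beta> \<gamma> \<noteq> 0" "J \<gamma> \<beta> \<noteq> 0"
    using cm_zero_iff[OF ij(1,2)] ij form_sym[of \<beta> \<gamma>] by auto
  have J_S: "J \<mu> \<nu> \<noteq> 0" if "\<mu> \<in> S" "\<nu> \<in> S" for \<mu> \<nu>
    using that J\<beta>\<gamma> root_nonisotropic[OF ij(1)] root_nonisotropic[OF ij(2)]
      cnum_pos[of "\<alpha> i"] cnum_pos[of "\<alpha> j"] ij
    unfolding S_def by auto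
  let ?T1 = "of_nat n \<odot> dual (star D \<beta>) \<oplus> dual \<gamma>"
  let ?T2 = "of_nat (c * n) \<odot> dual \<beta> \<oplus> dual (star D \<gamma>)"
  have "?T1 = ?T2"
  proof (cases "\<exists>\<mu> \<in> S. y \<mu> = \<zero> \<or> y (- \<mu>) = \<zero>")
    case True
    then obtain \<mu> where "\<mu> \<in> S" "y \<mu> = \<zero> \<or> y (- \<mu>) = \<zero>" by blast
    then have "y \<nu> = \<zero>" if "\<nu> \<in> S" for \<nu>
      using vanishing S_plus J_S B_plus_B_all that by blast
    then have "dual \<nu> = \<zero>" if "\<nu> \<in> S" for \<nu>
      using that S_plus by (simp add: dual_def)
    then show ?thesis by (simp add: S_def)
  next
    case False
    then have nz: "y \<mu> \<noteq> \<zero>" if "\<mu> \<in> S" for \<mu> using that by blast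
    obtain m' where m': "J (coroot D (star D \<beta>)) \<gamma> = - of_nat m'" "m' \<in> {1, 2, 3}" "n \<le> m'"
    proof -
      have "J (coroot D (star D \<beta>)) \<gamma> = J (coroot D \<beta>) \<gamma> / of_nat c"
        using ij c by (auto simp: J_coroot c_def)
      then have *: "J (coroot D (star D \<beta>)) \<gamma> = - of_nat m / of_nat c"
        using cartan[OF ij(1,2)] ij m by simp
      show ?thesis
      proof (cases "c = 1")
        case True
        then show ?thesis using that[of m] * m cn c_def by simp
      next
        case False
        then have "c = 2" using c by blast
        then show ?thesis using that[of 1] * cn(2) c_def by simp
      qed
    qed
    have ne: "star D \<beta> \<noteq> \<gamma>" "star D \<beta> + \<gamma> \<noteq> 0" "\<beta> \<noteq> star D \<gamma>" "\<beta> + star D \<gamma> \<noteq> 0"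
      using star_sroot_distinct[OF ij(1,2)] star_sroot_distinct[OF ij(2,1)] ij(4,5)
      by (metis add.commute)+
    obtain d1 where d1: "d1 \<noteq> 0"
      "((\<otimes>) (y (star D \<beta>)) ^^ n) (y \<gamma>) \<otimes> ((\<otimes>) (y (- star D \<beta>)) ^^ n) (y (- \<gamma>)) = d1 \<odot> ?T1"
      (is "?X1 \<otimes> ?Y1 = _")
      using root_string[OF plus(3,2) ne(1,2) m'] nz S_def by auto
    have "J (coroot D \<beta>) (star D \<gamma>) = - of_nat m"
      using cartan[OF ij(1,2)] ij m c\<gamma> by (simp add: coroot_def)
    then obtain d2 where d2: "d2 \<noteq> 0"
      "((\<otimes>) (y \<beta>) ^^ (c * n)) (y (star D \<gamma>)) \<otimes> ((\<otimes>) (y (- \<beta>)) ^^ (c * n)) (y (- star D \<gamma>)) = d2 \<odot> ?T2"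
      (is "?X2 \<otimes> ?Y2 = _")
      using root_string[OF plus(1,4) ne(3,4) _ m(2), of "c * n"] cn(1) nz S_def c_def by auto
    have "(Smult (of_nat c) (ad_pow (ee (star D \<beta>)) n (ee \<gamma>)), ad_pow (ee \<beta>) (c * n) (ee (star D \<gamma>))) \<in> serre_rels q D"
      "(Smult ((- 1) ^ (c + 1) * of_nat c) (ad_pow (ee (- star D \<beta>)) n (ee (- \<gamma>))),
             ad_pow (ee (- \<beta>)) (c * n) (ee (- star D \<gamma>))) \<in> serre_rels q D"
      using assms unfolding serre_rels_def rels_star_def c_def by blast+
    from this[THEN y_serre] have XY: "of_nat c \<odot> ?X1 = ?X2" "((- 1) ^ (c + 1) * of_nat c) \<odot> ?Y1 = ?Y2"
      by (simp_all add: term_eval_ad_pow)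
    have pow_closed: "((\<otimes>) u ^^ k) v \<in> carrier B" if "u \<in> carrier B" "v \<in> carrier B" for u v k
      using that by (induction k) simp_all
    define e where "e = of_nat c * ((- 1) ^ (c + 1) * of_nat c) * d1"
    have "?X2 \<otimes> ?Y2 = (of_nat c * ((- 1) ^ (c + 1) * of_nat c)) \<odot> (?X1 \<otimes> ?Y1)"
      unfolding XY[symmetric] using plus pow_closed by (simp add: B.brk_linear mult_ac flip: B.smult_mult)
    then have eq: "e \<odot> ?T1 = d2 \<odot> ?T2"
      unfolding d1 d2 e_def using plus by (simp flip: B.smult_mult)
    have e0: "e \<noteq> 0" using c d1 by (auto simp: e_def)
    obtain \<delta> where \<delta>: "\<delta> \<in> {\<alpha> i, \<alpha> j}" "J \<delta> (scl D (of_nat (c * n)) (\<alpha> i) + \<alpha> j + scl D 0 a) \<noteq> 0"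
    proof -
      have "cm i j \<noteq> - 4" using m by auto
      then show ?thesis using pair_regular[OF ij(1-3,6), of "c * n" 0] that by blast
    qed
    have \<delta>S: "\<delta> \<in> S" "\<delta> \<in> B_all D" using \<delta> ij S_plus B_plus_B_all unfolding S_def by auto
    define w where "w = of_nat (c * n) * J \<beta> \<delta> + J \<gamma> \<delta>"
    have w0: "w \<noteq> 0" using \<delta> ij form_sym[of \<delta> \<beta>] form_sym[of \<delta> \<gamma>] by (auto simp: w_def)
    have "?T1 \<otimes> y \<delta> = w \<odot> y \<delta>"
      using plus \<delta>S \<delta>(1) ij
      by (auto simp: B.brk_linear dual_action w_def c_def B.smult_left_add B.a_comm algebra_simps simp flip: B.smult_mult)
    moreover have "?T2 \<otimes> y \<delta> = w \<odot> y \<delta>"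
      using plus \<delta>S \<delta>(1) ij c\<gamma>
      by (auto simp: B.brk_linear dual_action w_def c_def B.smult_left_add B.a_comm algebra_simps simp flip: B.smult_mult)
    moreover have "(e \<odot> ?T1) \<otimes> y \<delta> = (d2 \<odot> ?T2) \<otimes> y \<delta>" using eq by simp
    ultimately have ew: "e \<odot> (w \<odot> y \<delta>) = d2 \<odot> (w \<odot> y \<delta>)"
      using plus \<delta>S by (simp add: B.brk_smult_left)
    obtain \<phi> where \<phi>: "\<phi> \<in> functionals B" "\<phi> (y \<delta>) \<noteq> 0"
      using B.exists_functional[of "y \<delta>"] \<delta>S nz by auto
    then have "e * (w * \<phi> (y \<delta>)) = d2 * (w * \<phi> (y \<delta>))"
      using arg_cong[OF ew, of \<phi>] \<delta>S by simp
    then have "e = d2" using w0 \<phi> by simp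
    then have "inverse e \<odot> (e \<odot> ?T1) = inverse e \<odot> (e \<odot> ?T2)" using eq by simp
    then show ?thesis using e0 plus by (simp flip: B.smult_mult)
  qed
  then show ?thesis by (simp add: c_def)
qed

text \<open>
  The element dual to \<open>a\<close>, computed from the starred root of index \<open>0\<close>.
\<close>
definition null_dual :: 'b where
  "null_dual = inverse (of_nat (kk D (\<alpha> 0))) \<odot>
     (dual (star D (\<alpha> 0)) \<oplus> (- of_nat (cnum D (\<alpha> 0))) \<odot> dual (\<alpha> 0))"

lemma null_dual_closed [simp]: "null_dual \<in> carrier B"
  using B_plusI[of 0] by (simp add: null_dual_def)

text \<open>
  The identity holds for the index \<open>0\<close> by definition, and \<open>dual_edge\<close> transports it along the edges of
  the diagram.
\<close>
lemma dual_star: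
  assumes "i \<le> rnk D"
  shows "dual (star D (\<alpha> i)) = of_nat (cnum D (\<alpha> i)) \<odot> dual (\<alpha> i) \<oplus> of_nat (kk D (\<alpha> i)) \<odot> null_dual"
    (is "?P i")
proof -
  have "?P 0"
  proof -
    have k: "of_nat (kk D (\<alpha> 0)) * (inverse (of_nat (kk D (\<alpha> 0))) * z) = z" for z :: complex
      using kk_sroot_pos[of 0] by (simp flip: mult.assoc)
    show ?thesis
      using B_plusI[of 0] by (intro B.functionals_eqI) (simp_all add: null_dual_def k)
  qed
  moreover have "?P i = ?P 0"
  proof (rule dynkin_connected[OF rank_valid _ assms])
    fix i j m assume edge: "(i, j, m) \<in> dynkin_edges (atype D) (rnk D)"
      and keep: "\<not> (atype D = Aff_A \<and> i = 0 \<and> j = rnk D)"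
    note facts = dynkin_edges_facts[OF rank_valid edge]
    have cm: "cm j i = - 1" using affine_cartan_edge[OF rank_valid edge] by blast
    obtain n where n: "kk D (\<alpha> i) * n = kk D (\<alpha> j)" "n \<ge> 1"
      using edge_ratio[OF facts(1-3) cm] by blast
    have "J (\<alpha> i) (coroot D (\<alpha> j)) = - 1"
      using cartan[OF facts(2,1)] cm form_sym by (metis of_int_1 of_int_minus)
    moreover have "\<alpha> i \<noteq> \<alpha> j" using sroot_inj facts by metis
    ultimately have adm: "(\<alpha> i, \<alpha> j, n) \<in> adm D"
      using n facts(1,2) by (auto simp: adm_def simple_def)
    have "(\<alpha> i, \<alpha> j, n) \<in> undeformed D"
    proof (cases "atype D = Aff_A")
      case True
      then have "(0, rnk D, 1) \<in> dynkin_edges (atype D) (rnk D)" by simp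
      then have "\<not> (i = rnk D \<and> j = 0)"
        using dynkin_edges_facts(5)[OF rank_valid, of 0 "rnk D" 1] edge by blast
      then have "\<not> (\<alpha> i = \<alpha> (rnk D) \<and> \<alpha> j = \<alpha> 0)" "\<not> (\<alpha> i = \<alpha> 0 \<and> \<alpha> j = \<alpha> (rnk D))"
        using keep True sroot_inj facts(1,2) by blast+
      then show ?thesis using adm True by (auto simp: undeformed_def)
    qed (simp add: undeformed_def adm)
    note E = dual_edge[OF this]
    have c: "cnum D (\<alpha> j) = 1" using adm_cases[OF adm] by metis
    note plus = B_plusI[OF facts(1)] B_plusI[OF facts(2)]
    have k: "complex_of_nat (kk D (\<alpha> j)) = of_nat (kk D (\<alpha> i)) * of_nat n" by (simp flip: n(1))
    have n0: "complex_of_nat n \<noteq> 0" using n(2) by simp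
    show "?P i = ?P j"
    proof
      assume P: "?P i"
      show "?P j"
      proof (rule B.functionals_eqI)
        fix \<phi> assume "\<phi> \<in> functionals B"
        then show "\<phi> (dual (star D (\<alpha> j))) =
            \<phi> (of_nat (cnum D (\<alpha> j)) \<odot> dual (\<alpha> j) \<oplus> of_nat (kk D (\<alpha> j)) \<odot> null_dual)"
          using arg_cong[OF E, of \<phi>] arg_cong[OF P, of \<phi>] plus by (simp add: c k algebra_simps)
      qed (use plus in simp_all)
    next
      assume P: "?P j"
      show "?P i"
      proof (rule B.functionals_eqI)
        fix \<phi> assume \<phi>: "\<phi> \<in> functionals B"
        have "of_nat n * \<phi> (dual (star D (\<alpha> i))) = of_nat n * (of_nat (cnum D (\<alpha> i)) * \<phi> (dual (\<alpha> i)) +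
           of_nat (kk D (\<alpha> i)) * \<phi> null_dual)"
          using arg_cong[OF E, of \<phi>] arg_cong[OF P, of \<phi>] plus \<phi> by (simp add: c k algebra_simps)
        then show "\<phi> (dual (star D (\<alpha> i))) =
            \<phi> (of_nat (cnum D (\<alpha> i)) \<odot> dual (\<alpha> i) \<oplus> of_nat (kk D (\<alpha> i)) \<odot> null_dual)"
          using n0 plus \<phi> by simp
      qed (use plus in simp_all)
    qed
  qed
  ultimately show ?thesis by blast
qed

end

section \<open>Projection onto the span of the roots\<close>

context pre_elliptic
begin

abbreviation coord where "coord \<sigma> b \<equiv> E.representation (set (basis_list D)) \<sigma> b"

lemma coord_add: "coord (\<sigma> + \<tau>) b = coord \<sigma> b + coord \<tau> b"
  and coord_scale: "coord (scl D c \<sigma>) b = c * coord \<sigma> b"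
  using basis_independent basis_span by (simp_all add: E.representation_add E.representation_scale)

lemma coord_basis: "v \<in> set (basis_list D) \<Longrightarrow> coord v b = (if b = v then 1 else 0)"
  using basis_independent by (simp add: E.representation_basis)

lemma basis_list_mem: "i \<le> rnk D \<Longrightarrow> \<alpha> i \<in> set (basis_list D)" "a \<in> set (basis_list D)"
  by (auto simp: basis_list_def simp del: upt_Suc)

text \<open>
  The projection of the whole space onto the span of the simple roots and \<open>a\<close> along the other two basis
  vectors. The sum over the simple roots is built up step by step, in parallel with
  \<open>partial_cartan\<close> below, so that both are compared by induction.
\<close>
primrec partial_proj where
  "partial_proj 0 \<sigma> = scl D (coord \<sigma> a) a"
| "partial_proj (Suc n) \<sigma> = partial_proj n \<sigma> + scl D (coord \<sigma> (\<alpha> n)) (\<alpha> n)"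

definition proj where "proj = partial_proj (Suc (rnk D))"

lemma proj_add: "proj (\<sigma> + \<tau>) = proj \<sigma> + proj \<tau>"
proof -
  have "partial_proj n (\<sigma> + \<tau>) = partial_proj n \<sigma> + partial_proj n \<tau>" for n
    by (induction n) (simp_all add: coord_add E.scale_left_distrib add_ac)
  then show ?thesis by (simp add: proj_def)
qed

lemma proj_scale: "proj (scl D c \<sigma>) = scl D c (proj \<sigma>)"
proof -
  have "partial_proj n (scl D c \<sigma>) = scl D c (partial_proj n \<sigma>)" for n
    by (induction n) (simp_all add: coord_scale E.scale_right_distrib)
  then show ?thesis by (simp add: proj_def)
qed

lemma proj_sroot:
  assumes "i \<le> rnk D"
  shows "proj (\<alpha> i) = \<alpha> i"
proof -
  have "n \<le> Suc (rnk D) \<Longrightarrow> partial_proj n (\<alpha> i) = (if i < n then \<alpha> i else 0)" for n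
  proof (induction n)
    case 0
    then show ?case using a_not_root[OF assms] assms by (simp add: coord_basis basis_list_mem)
  next
    case (Suc n)
    have "\<alpha> n = \<alpha> i \<longleftrightarrow> n = i" using sroot_inj[of n i] assms Suc.prems by auto
    then show ?case using Suc assms by (auto simp: coord_basis basis_list_mem)
  qed
  then show ?thesis using assms by (simp add: proj_def del: partial_proj.simps)
qed

lemma proj_a: "proj a = a"
proof -
  have "n \<le> Suc (rnk D) \<Longrightarrow> partial_proj n a = a" for n
    by (induction n) (use a_not_root in \<open>auto simp: coord_basis basis_list_mem\<close>)
  then show ?thesis by (simp add: proj_def del: partial_proj.simps)
qed

lemma proj_B_plus:
  assumes "\<mu> \<in> B_plus D"
  shows "proj \<mu> = \<mu>"
  using assms
  by (rule B_plus_cases) (simp_all add: star_def proj_add proj_scale proj_sroot proj_a)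

lemma proj_coroot: "\<mu> \<in> B_plus D \<Longrightarrow> proj (coroot D \<mu>) = coroot D \<mu>"
  by (simp add: coroot_def proj_scale proj_B_plus)

end

context serre_family
begin

primrec partial_cartan :: "nat \<Rightarrow> 'e \<Rightarrow> 'b" where
  "partial_cartan 0 \<sigma> = coord \<sigma> a \<odot> null_dual"
| "partial_cartan (Suc n) \<sigma> = partial_cartan n \<sigma> \<oplus> coord \<sigma> (\<alpha> n) \<odot> dual (\<alpha> n)"

text \<open>
  The linear map that sends each simple root to its dual element and \<open>a\<close> to \<open>null_dual\<close>, and vanishes
  on the two remaining basis vectors.
\<close>
definition cartan_map :: "'e \<Rightarrow> 'b" where "cartan_map = partial_cartan (Suc (rnk D))"

lemma dual_sroot_closed [simp]: "i \<le> rnk D \<Longrightarrow> dual (\<alpha> i) \<in> carrier B"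
  by (simp add: B_plusI)

lemma partial_cartan_closed [simp]: "n \<le> Suc (rnk D) \<Longrightarrow> partial_cartan n \<sigma> \<in> carrier B"
  by (induction n) simp_all

lemma cartan_map_closed [simp]: "cartan_map \<sigma> \<in> carrier B"
  unfolding cartan_map_def by (rule partial_cartan_closed) simp

lemma cartan_map_add: "cartan_map (\<sigma> + \<tau>) = cartan_map \<sigma> \<oplus> cartan_map \<tau>"
proof -
  have "n \<le> Suc (rnk D) \<Longrightarrow> partial_cartan n (\<sigma> + \<tau>) = partial_cartan n \<sigma> \<oplus> partial_cartan n \<tau>" for n
    by (induction n) (simp_all add: coord_add B.smult_left_add B.a_ac)
  then show ?thesis by (simp add: cartan_map_def del: partial_cartan.simps)
qed

lemma cartan_map_scale: "cartan_map (scl D c \<sigma>) = c \<odot> cartan_map \<sigma>"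
proof -
  have "n \<le> Suc (rnk D) \<Longrightarrow> partial_cartan n (scl D c \<sigma>) = c \<odot> partial_cartan n \<sigma>" for n
    by (induction n) (simp_all add: coord_scale B.smult_right_add B.smult_mult)
  then show ?thesis by (simp add: cartan_map_def del: partial_cartan.simps)
qed

lemma cartan_map_sroot:
  assumes "i \<le> rnk D"
  shows "cartan_map (\<alpha> i) = dual (\<alpha> i)"
proof -
  have "n \<le> Suc (rnk D) \<Longrightarrow> partial_cartan n (\<alpha> i) = (if i < n then dual (\<alpha> i) else \<zero>)" for n
  proof (induction n)
    case 0
    then show ?case using a_not_root[OF assms] assms by (simp add: coord_basis basis_list_mem)
  next
    case (Suc n)
    have "\<alpha> n = \<alpha> i \<longleftrightarrow> n = i" using sroot_inj[of n i] assms Suc.prems by auto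
    then show ?case using Suc assms by (auto simp: coord_basis basis_list_mem)
  qed
  then show ?thesis using assms by (simp add: cartan_map_def del: partial_cartan.simps)
qed

lemma cartan_map_a: "cartan_map a = null_dual"
proof -
  have "n \<le> Suc (rnk D) \<Longrightarrow> partial_cartan n a = null_dual" for n
    by (induction n) (use a_not_root in \<open>auto simp: coord_basis basis_list_mem\<close>)
  then show ?thesis by (simp add: cartan_map_def del: partial_cartan.simps)
qed

lemma cartan_map_dual:
  assumes "\<mu> \<in> B_plus D"
  shows "cartan_map \<mu> = dual \<mu>"
  using assms
proof (cases rule: B_plus_cases)
  case (2 i)
  then show ?thesis
    by (simp add: dual_star) (simp add: star_def cartan_map_add cartan_map_scale cartan_map_sroot cartan_map_a)
qed (simp add: cartan_map_sroot)

lemma cartan_map_coroot: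
  assumes "\<mu> \<in> B_plus D"
  shows "cartan_map (coroot D \<mu>) = y \<mu> \<otimes> y (- \<mu>)"
  using assms by (simp add: coroot_dual coroot_def cartan_map_scale cartan_map_dual)

lemma null_dual_part: "null_dual \<in> part B 0"
  unfolding null_dual_def using B_plusI[of 0] by (intro B.part_add B.part_smult dual_part) simp_all

lemma cartan_map_part: "cartan_map \<sigma> \<in> part B 0"
proof -
  have "n \<le> Suc (rnk D) \<Longrightarrow> partial_cartan n \<sigma> \<in> part B 0" for n
    by (induction n) (simp_all add: B.part_add B.part_smult dual_part null_dual_part B_plusI)
  then show ?thesis by (simp add: cartan_map_def del: partial_cartan.simps)
qed

lemma null_dual_action:
  assumes "\<nu> \<in> B_all D"
  shows "null_dual \<otimes> y \<nu> = \<zero>"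
proof -
  have "null_dual \<otimes> y \<nu> = inverse (of_nat (kk D (\<alpha> 0))) \<odot>
     (J (star D (\<alpha> 0)) \<nu> \<odot> y \<nu> \<oplus> (- of_nat (cnum D (\<alpha> 0)) * J (\<alpha> 0) \<nu>) \<odot> y \<nu>)"
    unfolding null_dual_def using assms B_plusI[of 0]
    by (simp add: B.brk_linear dual_action flip: B.smult_mult)
  also have "\<dots> = \<zero>"
    using assms J_a_B_all[OF assms] by (intro B.functionals_eqI) (simp_all add: star_def algebra_simps)
  finally show ?thesis .
qed

lemma cartan_map_action:
  assumes "\<nu> \<in> B_all D"
  shows "cartan_map \<sigma> \<otimes> y \<nu> = J (proj \<sigma>) \<nu> \<odot> y \<nu>"
proof -
  have "n \<le> Suc (rnk D) \<Longrightarrow> partial_cartan n \<sigma> \<otimes> y \<nu> = J (partial_proj n \<sigma>) \<nu> \<odot> y \<nu>" for n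
    using assms
    by (induction n)
      (simp_all add: B.brk_linear null_dual_action J_a_B_all dual_action B_plusI B.smult_left_add B.smult_mult)
  then show ?thesis by (simp add: cartan_map_def proj_def del: partial_cartan.simps partial_proj.simps)
qed

lemma cartan_map_dual_commute:
  assumes "\<mu> \<in> B_plus D"
  shows "cartan_map \<sigma> \<otimes> dual \<mu> = \<zero>"
proof -
  have S: "\<mu> \<in> B_all D" "- \<mu> \<in> B_all D" using assms B_plus_B_all B_all_minus by auto
  have "cartan_map \<sigma> \<otimes> (y \<mu> \<otimes> y (- \<mu>)) =
    (J (proj \<sigma>) \<mu> \<odot> y \<mu>) \<otimes> y (- \<mu>) \<oplus> y \<mu> \<otimes> (J (proj \<sigma>) (- \<mu>) \<odot> y (- \<mu>))"
    using S by (simp only: B.even_derivation[OF cartan_map_part] y_closed cartan_map_action)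
  also have "\<dots> = \<zero>"
    using S by (intro B.functionals_eqI) (simp_all add: B.brk_linear)
  finally show ?thesis using S by (simp add: dual_def B.brk_linear)
qed

lemma cartan_map_commute: "cartan_map \<sigma> \<otimes> cartan_map \<tau> = \<zero>"
proof -
  have "cartan_map \<sigma> \<otimes> null_dual = \<zero>"
    unfolding null_dual_def using B_plusI[of 0] by (simp add: B.brk_linear cartan_map_dual_commute)
  then have "n \<le> Suc (rnk D) \<Longrightarrow> cartan_map \<sigma> \<otimes> partial_cartan n \<tau> = \<zero>" for n
    by (induction n) (simp_all add: B.brk_linear cartan_map_dual_commute B_plusI)
  then show ?thesis unfolding cartan_map_def[of] by (metis cartan_map_def order_refl)
qed

abbreviation generator_image where "generator_image \<equiv> case_gen cartan_map y"

lemma gens_cases: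
  assumes "g \<in> gens D"
  obtains \<sigma> where "g = Hg \<sigma>" | \<mu> where "g = Eg \<mu>" "\<mu> \<in> B_all D"
  using assms by (auto simp: gens_def)

lemma generator_image_part: "g \<in> gens D \<Longrightarrow> generator_image g \<in> part B (gen_parity D g)"
  by (erule gens_cases) (auto simp: cartan_map_part y_part)

text \<open>
  A vector \<open>\<sigma>\<close> outside the span of the roots and \<open>a\<close> has no counterpart in the extension that acts with
  the eigenvalues \<open>J \<sigma> \<mu>\<close>; therefore the third Cartan relation is satisfied with \<open>proj \<sigma>\<close> in place
  of \<open>\<sigma>\<close>.
\<close>
lemma generator_image_relations:
  assumes "(s, t) \<in> cartan_rels D (\<lambda>\<sigma> \<mu>. J (proj \<sigma>) \<mu>) \<union> serre_rels q D"
  shows "term_eval B generator_image s = term_eval B generator_image t"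
  using assms
proof
  assume "(s, t) \<in> cartan_rels D (\<lambda>\<sigma> \<mu>. J (proj \<sigma>) \<mu>)"
  then show ?thesis
    by (auto simp: cartan_rels_def cartan_map_add cartan_map_scale cartan_map_commute cartan_map_action
        cartan_map_coroot)
next
  assume st: "(s, t) \<in> serre_rels q D"
  then have E: "s \<in> lterms Egens" "t \<in> lterms Egens" using serre_rels_homogeneous by metis+
  have "term_eval B generator_image r = term_eval B (case_gen (\<lambda>\<sigma>. \<zero>) y) r" if "r \<in> lterms Egens" for r
    by (rule term_eval_cong[OF that]) auto
  then show ?thesis using y_serre[OF st] E by simp
qed

end

context quasi_elliptic
begin

abbreviation reduced_rels where
  "reduced_rels q \<equiv> cartan_rels D (\<lambda>\<sigma> \<mu>. J (proj \<sigma>) \<mu>) \<union> serre_rels q D"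

lemma lterms_Egens: "t \<in> lterms Egens \<Longrightarrow> t \<in> lterms (gens D)"
  by (auto simp: lterms_def gens_def)

text \<open>
  The vectors \<open>\<sigma> - proj \<sigma>\<close> act as diagonal derivations on the algebra with the reduced relations, and
  \<open>h\<^sub>\<sigma> \<mapsto> (h\<^sub>\<sigma>, \<sigma> - proj \<sigma>)\<close> respects the original relations: the eigenvalue
  \<open>J \<sigma> \<mu>\<close> of \<open>h\<^sub>\<sigma>\<close> is the sum of the contributions of \<open>proj \<sigma>\<close> and of the derivation, and in the
  relation for \<open>[E\<^sub>\<mu>, E\<^sub>-\<^sub>\<mu>]\<close> no derivation appears because coroots are fixed by \<open>proj\<close>.
\<close>
lemma derived_presentation:
  assumes st: "(s, t) \<in> lcong (gens D) (gen_parity D) (cartan_rels D J \<union> serre_rels q D)"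
    and E: "s \<in> lterms Egens" "t \<in> lterms Egens"
  shows "(s, t) \<in> lcong (gens D) (gen_parity D) (reduced_rels q)"
proof -
  let ?tp = "case_gen (\<lambda>\<sigma>. \<sigma> - proj \<sigma>) (\<lambda>\<mu>. 0)"
  interpret ext: derivation_extension "gens D" "gen_parity D" "reduced_rels q" "scl D" J gen_weight ?tp
  proof
    fix g assume "gen_parity D g = 1"
    then show "?tp g = 0" by (cases g) auto
  next
    fix s t assume "(s, t) \<in> reduced_rels q"
    then show "\<exists>\<mu>. weighted \<mu> s \<and> weighted \<mu> t"
    proof
      assume "(s, t) \<in> serre_rels q D"
      then show ?thesis using serre_rels_homogeneous by metis
    next
      assume "(s, t) \<in> cartan_rels D (\<lambda>\<sigma> \<mu>. J (proj \<sigma>) \<mu>)"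
      moreover have "weighted 0 (Br (hh \<sigma>) (hh \<tau>))" for \<sigma> \<tau>
        using term_weight.intros(5)[OF weighted_gen(2) weighted_gen(2)] by simp
      moreover have "weighted \<mu> (Br (hh \<sigma>) (ee \<mu>))" for \<sigma> \<mu>
        using term_weight.intros(5)[OF weighted_gen(2) weighted_gen(1)] by simp
      moreover have "weighted 0 (Br (ee \<mu>) (ee (- \<mu>)))" for \<mu>
        using term_weight.intros(5)[OF weighted_gen(1) weighted_gen(1), of \<mu> "- \<mu>"] by simp
      ultimately show ?thesis
        unfolding cartan_rels_def
        by (elim UnE CollectE exE conjE; simp; blast intro: weighted_gen term_weight.intros(1,3,4))
    qed
  qed simp_all
  have Et: "r \<in> lterms {g \<in> gens D. ?tp g = 0}" if "r \<in> lterms Egens" for r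
    using that by (auto simp: lterms_def gens_def)
  show ?thesis
  proof (rule ext.lcong_descends[OF st _ Et[OF E(1)] Et[OF E(2)]])
    fix s t assume rel: "(s, t) \<in> cartan_rels D J \<union> serre_rels q D"
      and lt: "s \<in> lterms (gens D)" "t \<in> lterms (gens D)"
    have inR: "ext.cls u = ext.cls v" if "(u, v) \<in> reduced_rels q" "u \<in> lterms (gens D)" "v \<in> lterms (gens D)" for u v
      using that by (intro term_class_eqI lcong.relation)
    have g: "Hg \<sigma> \<in> gens D" "\<mu> \<in> B_all D \<Longrightarrow> Eg \<mu> \<in> gens D" for \<sigma> \<mu> by (auto simp: gens_def)
    show "ext.cls (ext.reduct s) = ext.cls (ext.reduct t) \<and> ext.top s = ext.top t"
    proof (cases "(s, t) \<in> serre_rels q D")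
      case True
      then have "s \<in> lterms Egens" "t \<in> lterms Egens" using serre_rels_homogeneous by metis+
      then show ?thesis
        using ext.reduct_top_free[OF Et] inR[OF _ lt] True by simp
    next
      case False
      with rel consider
        (add) x y \<sigma> \<tau> where "s = Add (Smult x (hh \<sigma>)) (Smult y (hh \<tau>))" "t = hh (scl D x \<sigma> + scl D y \<tau>)"
        | (comm) \<sigma> \<tau> where "s = Br (hh \<sigma>) (hh \<tau>)" "t = Zero"
        | (act) \<sigma> \<mu> where "s = Br (hh \<sigma>) (ee \<mu>)" "t = Smult (J \<sigma> \<mu>) (ee \<mu>)" "\<mu> \<in> B_all D"
        | (cor) \<mu> where "s = Br (ee \<mu>) (ee (- \<mu>))" "t = hh (coroot D \<mu>)" "\<mu> \<in> B_plus D"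
        unfolding cartan_rels_def by blast
      then show ?thesis
      proof cases
        case add
        have "(s, t) \<in> reduced_rels q" unfolding add cartan_rels_def by blast
        then show ?thesis
          using inR[OF _ lt] unfolding add
          by (simp add: proj_add proj_scale E.scale_right_diff_distrib)
      next
        case comm
        have "(s, t) \<in> reduced_rels q" unfolding comm cartan_rels_def by blast
        then show ?thesis
          using inR[OF _ lt] unfolding comm by (simp add: g)
      next
        case act
        have "(s, Smult (J (proj \<sigma>) \<mu>) (ee \<mu>)) \<in> reduced_rels q"
          using act unfolding cartan_rels_def by blast
        then have "ext.cls (hh \<sigma>) \<otimes>\<^bsub>ext.L\<^esub> ext.cls (ee \<mu>) = J (proj \<sigma>) \<mu> \<odot>\<^bsub>ext.L\<^esub> ext.cls (ee \<mu>)"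
          using inR act g by fastforce
        then show ?thesis
          unfolding act using act(3)
          by (simp add: g, intro ext.L.functionals_eqI) (simp_all add: g algebra_simps)
      next
        case cor
        have \<mu>: "\<mu> \<in> B_all D" "- \<mu> \<in> B_all D" using cor B_plus_B_all B_all_minus by auto
        have "(s, t) \<in> reduced_rels q" using cor unfolding cartan_rels_def by blast
        then show ?thesis
          using inR[OF _ lt] \<mu> unfolding cor by (simp add: g proj_coroot[OF cor(3)])
      qed
    qed
  qed
qed

end

section \<open>The derived algebra and its universal property\<close>

text \<open>
  A term need not be homogeneous, but it is congruent to a sum of homogeneous terms in the same
  generators.
\<close>
lemma term_parity_decomposition:
  assumes "t \<in> lterms G'" "G' \<subseteq> G"
  shows "\<exists>t0 t1. t0 \<in> lterms G' \<and> t1 \<in> lterms G' \<and> homog p 0 t0 \<and> homog p 1 t1 \<and>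
    term_class G p R t = term_class G p R (Add t0 t1)"
proof -
  interpret L: bracket_superalgebra "presented_lsa G p R" by (rule presented_bracket_superalgebra)
  let ?c = "term_class G p R"
  have lt: "t \<in> lterms G' \<Longrightarrow> t \<in> lterms G" for t using assms(2) by (auto simp: lterms_def)
  have cl: "t \<in> lterms G' \<Longrightarrow> ?c t \<in> carrier (presented_lsa G p R)" for t
    using lt by (auto simp: presented_carrier)
  note ops = presented_ops(1)[where R = R, symmetric] presented_ops(2)[where R = R, symmetric]
    presented_ops(3)[where R = R, symmetric] presented_zero[symmetric, of G p R]
  show ?thesis
    using assms(1)
  proof (induction t)
    case Zero
    show ?case
      by (intro exI[of _ Zero]) (use cl[of Zero] in \<open>simp add: homog.intros ops\<close>)
  next
    case (Gen x)
    have c: "?c (Gen x) \<in> carrier (presented_lsa G p R)" "Gen x \<in> lterms G" using cl lt Gen by blast+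
    show ?case
    proof (cases "p x = 0")
      case True
      then have "homog p 0 (Gen x)" using homog.intros(2)[of p x] by simp
      then show ?thesis
        using Gen c by (intro exI[of _ "Gen x"] exI[of _ Zero]) (simp add: homog.intros ops)
    next
      case False
      then have "homog p 1 (Gen x)" using homog.intros(2)[of p x] by simp
      then show ?thesis
        using Gen c by (intro exI[of _ Zero] exI[of _ "Gen x"]) (simp add: homog.intros ops)
    qed
  next
    case (Add s t)
    then obtain s0 s1 t0 t1 where
      st: "s0 \<in> lterms G'" "s1 \<in> lterms G'" "t0 \<in> lterms G'" "t1 \<in> lterms G'"
        "homog p 0 s0" "homog p 1 s1" "homog p 0 t0" "homog p 1 t1"
        "?c s = ?c (Add s0 s1)" "?c t = ?c (Add t0 t1)" by auto
    have "?c (Add s t) = ?c (Add (Add s0 t0) (Add s1 t1))"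
      using st Add.prems cl lt by (simp add: ops L.a_ac)
    then show ?case
      using st by (intro exI[of _ "Add s0 t0"] exI[of _ "Add s1 t1"]) (simp add: homog.intros)
  next
    case (Smult c t)
    then obtain t0 t1 where
      t: "t0 \<in> lterms G'" "t1 \<in> lterms G'" "homog p 0 t0" "homog p 1 t1" "?c t = ?c (Add t0 t1)" by auto
    have "?c (Smult c t) = ?c (Add (Smult c t0) (Smult c t1))"
      using t Smult.prems cl lt by (simp add: ops L.smult_right_add)
    then show ?case
      using t by (intro exI[of _ "Smult c t0"] exI[of _ "Smult c t1"]) (simp add: homog.intros)
  next
    case (Br s t)
    then obtain s0 s1 t0 t1 where
      st: "s0 \<in> lterms G'" "s1 \<in> lterms G'" "t0 \<in> lterms G'" "t1 \<in> lterms G'"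
        "homog p 0 s0" "homog p 1 s1" "homog p 0 t0" "homog p 1 t1"
        "?c s = ?c (Add s0 s1)" "?c t = ?c (Add t0 t1)" by auto
    have eq: "?c (Br s t) = ?c (Add (Add (Br s0 t0) (Br s1 t1)) (Add (Br s0 t1) (Br s1 t0)))"
      using st Br.prems cl lt by (simp add: ops L.brk_linear L.a_ac)
    have "homog p 0 (Br s0 t0)" "homog p 0 (Br s1 t1)" "homog p 1 (Br s0 t1)" "homog p 1 (Br s1 t0)"
      using homog.intros(5)[OF st(5,7)] homog.intros(5)[OF st(6,8)] homog.intros(5)[OF st(5,8)]
        homog.intros(5)[OF st(6,7)] by simp_all
    then show ?case
      using st eq by (intro exI[of _ "Add (Br s0 t0) (Br s1 t1)"] exI[of _ "Add (Br s0 t1) (Br s1 t0)"])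
        (simp add: homog.intros)
  qed
qed

context quasi_elliptic
begin

context
  fixes q :: complex
begin

abbreviation "g \<equiv> gbar q D"
abbreviation "gcls \<equiv> term_class (gens D) (gen_parity D) (cartan_rels D J \<union> serre_rels q D)"

lemma gbar_bracket_superalgebra: "bracket_superalgebra g"
  unfolding gbar_presentation by (rule presented_bracket_superalgebra)

interpretation g: bracket_superalgebra "gbar q D"
  by (rule gbar_bracket_superalgebra)

lemma gcls_simps [simp]:
  "gcls Zero = \<zero>\<^bsub>g\<^esub>"
  "s \<in> lterms (gens D) \<Longrightarrow> t \<in> lterms (gens D) \<Longrightarrow> gcls (Add s t) = gcls s \<oplus>\<^bsub>g\<^esub> gcls t"
  "s \<in> lterms (gens D) \<Longrightarrow> t \<in> lterms (gens D) \<Longrightarrow> gcls (Br s t) = gcls s \<otimes>\<^bsub>g\<^esub> gcls t"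
  "t \<in> lterms (gens D) \<Longrightarrow> gcls (Smult c t) = c \<odot>\<^bsub>g\<^esub> gcls t"
  by (simp_all add: gbar_presentation presented_ops presented_zero)

lemma gcls_closed [simp]: "t \<in> lterms (gens D) \<Longrightarrow> gcls t \<in> carrier g"
  by (auto simp: gbar_presentation presented_carrier)

lemma gcls_part: "t \<in> lterms (gens D) \<Longrightarrow> homog (gen_parity D) i t \<Longrightarrow> gcls t \<in> part g i"
  by (auto simp: gbar_presentation presented_part)

lemma gens_simps [simp]: "Hg \<sigma> \<in> gens D" "Eg \<mu> \<in> gens D \<longleftrightarrow> \<mu> \<in> B_all D"
  by (auto simp: gens_def)

lemma gcls_relation:
  assumes "(s, t) \<in> cartan_rels D J \<union> serre_rels q D" "s \<in> lterms (gens D)" "t \<in> lterms (gens D)"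
  shows "gcls s = gcls t"
  using assms by (intro term_class_eqI lcong.relation)

lemma gcls_h_linear: "gcls (hh (scl D x \<sigma> + scl D y \<tau>)) = x \<odot>\<^bsub>g\<^esub> gcls (hh \<sigma>) \<oplus>\<^bsub>g\<^esub> y \<odot>\<^bsub>g\<^esub> gcls (hh \<tau>)"
proof -
  have "gcls (Add (Smult x (hh \<sigma>)) (Smult y (hh \<tau>))) = gcls (hh (scl D x \<sigma> + scl D y \<tau>))"
    by (rule gcls_relation) (auto simp: cartan_rels_def)
  then show ?thesis by simp
qed

lemma gcls_h_commute: "gcls (hh \<sigma>) \<otimes>\<^bsub>g\<^esub> gcls (hh \<tau>) = \<zero>\<^bsub>g\<^esub>"
proof -
  have "gcls (Br (hh \<sigma>) (hh \<tau>)) = gcls Zero"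
    by (rule gcls_relation) (auto simp: cartan_rels_def)
  then show ?thesis by simp
qed

lemma gcls_h_action:
  assumes "\<mu> \<in> B_all D"
  shows "gcls (hh \<sigma>) \<otimes>\<^bsub>g\<^esub> gcls (ee \<mu>) = J \<sigma> \<mu> \<odot>\<^bsub>g\<^esub> gcls (ee \<mu>)"
proof -
  have "gcls (Br (hh \<sigma>) (ee \<mu>)) = gcls (Smult (J \<sigma> \<mu>) (ee \<mu>))"
    by (rule gcls_relation) (use assms in \<open>auto simp: cartan_rels_def\<close>)
  then show ?thesis using assms by simp
qed

lemma gcls_coroot:
  assumes "\<mu> \<in> B_plus D"
  shows "gcls (ee \<mu>) \<otimes>\<^bsub>g\<^esub> gcls (ee (- \<mu>)) = gcls (hh (coroot D \<mu>))"
proof -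
  have \<mu>: "\<mu> \<in> B_all D" "- \<mu> \<in> B_all D" using assms B_plus_B_all B_all_minus by auto
  have "gcls (Br (ee \<mu>) (ee (- \<mu>))) = gcls (hh (coroot D \<mu>))"
    by (rule gcls_relation) (use assms \<mu> in \<open>auto simp: cartan_rels_def\<close>)
  then show ?thesis using \<mu> by simp
qed

lemma gcls_h_zero: "gcls (hh 0) = \<zero>\<^bsub>g\<^esub>"
  using gcls_h_linear[of 0 0 0 0] by simp

lemma gcls_h_homog: "gcls (hh \<sigma>) \<in> part g 0"
  using gcls_part[of "hh \<sigma>" 0] homog.intros(2)[of "gen_parity D" "Hg \<sigma>"] by simp

lemma gcls_decomposition:
  assumes "t \<in> lterms Egens"
  obtains t0 t1 where "t0 \<in> lterms Egens" "t1 \<in> lterms Egens" "gcls t0 \<in> part g 0" "gcls t1 \<in> part g 1"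
    "gcls t = gcls t0 \<oplus>\<^bsub>g\<^esub> gcls t1" "homog (gen_parity D) 0 t0" "homog (gen_parity D) 1 t1"
proof -
  have "Egens \<subseteq> gens D" by (auto simp: gens_def)
  from term_parity_decomposition[OF assms this] obtain t0 t1 where
    "t0 \<in> lterms Egens" "t1 \<in> lterms Egens" "homog (gen_parity D) 0 t0" "homog (gen_parity D) 1 t1"
    "gcls t = gcls (Add t0 t1)" by blast
  then show ?thesis using that[of t0 t1] gcls_part lterms_Egens by simp
qed

abbreviation root_subalgebra where "root_subalgebra \<equiv> gcls ` lterms Egens"

lemma root_subalgebra_closed:
  "\<zero>\<^bsub>g\<^esub> \<in> root_subalgebra"
  "x \<in> root_subalgebra \<Longrightarrow> y \<in> root_subalgebra \<Longrightarrow> x \<oplus>\<^bsub>g\<^esub> y \<in> root_subalgebra"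
  "x \<in> root_subalgebra \<Longrightarrow> c \<odot>\<^bsub>g\<^esub> x \<in> root_subalgebra"
  "x \<in> root_subalgebra \<Longrightarrow> y \<in> root_subalgebra \<Longrightarrow> x \<otimes>\<^bsub>g\<^esub> y \<in> root_subalgebra"
  "x \<in> root_subalgebra \<Longrightarrow> x \<in> carrier g"
proof -
  show "\<zero>\<^bsub>g\<^esub> \<in> root_subalgebra" using gcls_simps(1) by (metis imageI lterms_simps(1))
  show "x \<oplus>\<^bsub>g\<^esub> y \<in> root_subalgebra" if "x \<in> root_subalgebra" "y \<in> root_subalgebra"
    using that by (auto simp: lterms_Egens simp flip: gcls_simps(2) intro!: imageI)
  show "c \<odot>\<^bsub>g\<^esub> x \<in> root_subalgebra" if "x \<in> root_subalgebra"
    using that by (auto simp: lterms_Egens simp flip: gcls_simps(4) intro!: imageI)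
  show "x \<otimes>\<^bsub>g\<^esub> y \<in> root_subalgebra" if "x \<in> root_subalgebra" "y \<in> root_subalgebra"
    using that by (auto simp: lterms_Egens simp flip: gcls_simps(3) intro!: imageI)
  show "x \<in> carrier g" if "x \<in> root_subalgebra"
    using that by (auto simp: lterms_Egens)
qed

text \<open>
  The Cartan elements act as derivations that multiply root vectors by scalars.
\<close>
lemma h_stable:
  assumes "t \<in> lterms Egens"
  shows "gcls (hh \<sigma>) \<otimes>\<^bsub>g\<^esub> gcls t \<in> root_subalgebra"
  using assms
proof (induction t)
  case Zero
  then show ?case using root_subalgebra_closed(1) by simp
next
  case (Gen x)
  then obtain \<mu> where \<mu>: "x = Eg \<mu>" "\<mu> \<in> B_all D" by auto
  then have "gcls (hh \<sigma>) \<otimes>\<^bsub>g\<^esub> gcls (Gen x) = J \<sigma> \<mu> \<odot>\<^bsub>g\<^esub> gcls (Gen x)" using gcls_h_action by simp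
  then show ?case using root_subalgebra_closed(3) Gen by (metis imageI)
next
  case (Add s t)
  then show ?case using root_subalgebra_closed(2) by (simp add: lterms_Egens g.brk_linear)
next
  case (Smult c t)
  then show ?case using root_subalgebra_closed(3) by (simp add: lterms_Egens g.brk_linear)
next
  case (Br s t)
  let ?h = "gcls (hh \<sigma>)"
  have lt: "s \<in> lterms (gens D)" "t \<in> lterms (gens D)" using Br.prems lterms_Egens by auto
  obtain s0 s1 where s: "s0 \<in> lterms Egens" "s1 \<in> lterms Egens" "gcls s0 \<in> part g 0" "gcls s1 \<in> part g 1"
    "gcls s = gcls s0 \<oplus>\<^bsub>g\<^esub> gcls s1"
    using gcls_decomposition Br.prems by (metis lterms_simps(5))
  note J = g.brk_jacobi[OF gcls_h_homog s(3) gcls_closed[OF lt(2)], of \<sigma>]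
    g.brk_jacobi[OF gcls_h_homog s(4) gcls_closed[OF lt(2)], of \<sigma>]
  have "?h \<otimes>\<^bsub>g\<^esub> gcls (Br s t) = (?h \<otimes>\<^bsub>g\<^esub> gcls s) \<otimes>\<^bsub>g\<^esub> gcls t \<oplus>\<^bsub>g\<^esub> gcls s \<otimes>\<^bsub>g\<^esub> (?h \<otimes>\<^bsub>g\<^esub> gcls t)"
    using lt lterms_Egens[OF s(1)] lterms_Egens[OF s(2)] by (simp add: s(5) g.brk_linear J g.a_ac)
  then show ?case using Br root_subalgebra_closed(2,4) by (metis imageI lterms_simps(5))
qed

lemma h_stable_right:
  assumes "t \<in> lterms Egens"
  shows "gcls t \<otimes>\<^bsub>g\<^esub> gcls (hh \<sigma>) \<in> root_subalgebra"
proof -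
  obtain s0 s1 where s: "s0 \<in> lterms Egens" "s1 \<in> lterms Egens" "gcls s0 \<in> part g 0" "gcls s1 \<in> part g 1"
    "gcls t = gcls s0 \<oplus>\<^bsub>g\<^esub> gcls s1"
    using gcls_decomposition assms by metis
  have "gcls t \<otimes>\<^bsub>g\<^esub> gcls (hh \<sigma>) = (- 1) \<odot>\<^bsub>g\<^esub> (gcls (hh \<sigma>) \<otimes>\<^bsub>g\<^esub> gcls t)"
    using lterms_Egens[OF s(1)] lterms_Egens[OF s(2)]
    by (simp add: s(5) g.brk_linear g.smult_right_add g.brk_skew[OF s(3) gcls_h_homog] g.brk_skew[OF s(4) gcls_h_homog])
  then show ?thesis using h_stable[OF assms] root_subalgebra_closed(3) by metis
qed

lemma extended_product:
  assumes "d \<in> lterms Egens" "e \<in> lterms Egens"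
  shows "(gcls d \<oplus>\<^bsub>g\<^esub> gcls (hh \<sigma>)) \<otimes>\<^bsub>g\<^esub> (gcls e \<oplus>\<^bsub>g\<^esub> gcls (hh \<tau>)) \<in> root_subalgebra"
proof -
  have "(gcls d \<oplus>\<^bsub>g\<^esub> gcls (hh \<sigma>)) \<otimes>\<^bsub>g\<^esub> (gcls e \<oplus>\<^bsub>g\<^esub> gcls (hh \<tau>)) =
      (gcls d \<otimes>\<^bsub>g\<^esub> gcls e \<oplus>\<^bsub>g\<^esub> gcls (hh \<sigma>) \<otimes>\<^bsub>g\<^esub> gcls e) \<oplus>\<^bsub>g\<^esub> gcls d \<otimes>\<^bsub>g\<^esub> gcls (hh \<tau>)"
    using lterms_Egens[OF assms(1)] lterms_Egens[OF assms(2)]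
    by (simp add: g.brk_linear gcls_h_commute g.a_ac)
  also have "\<dots> \<in> root_subalgebra"
    using assms h_stable h_stable_right root_subalgebra_closed(2,4) by (metis imageI)
  finally show ?thesis .
qed

lemma term_split:
  assumes "t \<in> lterms (gens D)"
  shows "\<exists>e \<in> lterms Egens. \<exists>\<sigma>. gcls t = gcls e \<oplus>\<^bsub>g\<^esub> gcls (hh \<sigma>)"
  using assms
proof (induction t)
  case Zero
  then show ?case by (intro bexI[of _ Zero] exI[of _ 0]) (simp_all add: gcls_h_zero)
next
  case (Gen x)
  show ?case
  proof (cases x)
    case (Hg \<sigma>)
    then show ?thesis by (intro bexI[of _ Zero] exI[of _ \<sigma>]) simp_all
  next
    case (Eg \<mu>)
    then show ?thesis using Gen by (intro bexI[of _ "ee \<mu>"] exI[of _ 0]) (simp_all add: gcls_h_zero)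
  qed
next
  case (Add s t)
  then obtain d \<sigma> e \<tau> where *: "d \<in> lterms Egens" "e \<in> lterms Egens" "gcls s = gcls d \<oplus>\<^bsub>g\<^esub> gcls (hh \<sigma>)"
    "gcls t = gcls e \<oplus>\<^bsub>g\<^esub> gcls (hh \<tau>)" by auto
  have "gcls (Add s t) = gcls (Add d e) \<oplus>\<^bsub>g\<^esub> gcls (hh (\<sigma> + \<tau>))"
    using gcls_h_linear[of 1 \<sigma> 1 \<tau>] * Add.prems lterms_Egens[OF *(1)] lterms_Egens[OF *(2)]
    by (simp add: g.a_ac)
  then show ?case using * by (intro bexI[of _ "Add d e"] exI) simp_all
next
  case (Smult c t)
  then obtain e \<tau> where *: "e \<in> lterms Egens" "gcls t = gcls e \<oplus>\<^bsub>g\<^esub> gcls (hh \<tau>)" by auto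
  have "gcls (Smult c t) = gcls (Smult c e) \<oplus>\<^bsub>g\<^esub> gcls (hh (scl D c \<tau>))"
    using gcls_h_linear[of c \<tau> 0 0] * Smult.prems lterms_Egens[OF *(1)]
    by (simp add: g.smult_right_add)
  then show ?case using * by (intro bexI[of _ "Smult c e"] exI) simp_all
next
  case (Br s t)
  then obtain d \<sigma> e \<tau> where *: "d \<in> lterms Egens" "e \<in> lterms Egens" "gcls s = gcls d \<oplus>\<^bsub>g\<^esub> gcls (hh \<sigma>)"
    "gcls t = gcls e \<oplus>\<^bsub>g\<^esub> gcls (hh \<tau>)" by auto
  then have "gcls (Br s t) \<in> root_subalgebra"
    using extended_product[OF *(1,2)] Br.prems by simp
  then obtain r where "r \<in> lterms Egens" "gcls (Br s t) = gcls r" by blast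
  then show ?case
    using lterms_Egens[of r] by (intro bexI[of _ r] exI[of _ 0]) (simp_all add: gcls_h_zero)
qed

lemma bracket_in_root_subalgebra:
  assumes "x \<in> carrier g" "y \<in> carrier g"
  shows "x \<otimes>\<^bsub>g\<^esub> y \<in> root_subalgebra"
proof -
  obtain s t where st: "x = gcls s" "y = gcls t" "s \<in> lterms (gens D)" "t \<in> lterms (gens D)"
    using assms by (auto simp: gbar_presentation presented_carrier)
  obtain d \<sigma> e \<tau> where *: "d \<in> lterms Egens" "e \<in> lterms Egens" "gcls s = gcls d \<oplus>\<^bsub>g\<^esub> gcls (hh \<sigma>)"
    "gcls t = gcls e \<oplus>\<^bsub>g\<^esub> gcls (hh \<tau>)" using term_split st by metis
  then show ?thesis using extended_product[OF *(1,2)] st by simp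
qed

text \<open>
  This makes the derived algebra perfect: the inner bracket is a coroot element, and it lies in
  the derived algebra.
\<close>
lemma ee_as_bracket:
  assumes "\<mu> \<in> B_all D"
  obtains \<nu> c where "\<nu> \<in> B_plus D"
    "gcls (ee \<mu>) = c \<odot>\<^bsub>g\<^esub> ((gcls (ee \<nu>) \<otimes>\<^bsub>g\<^esub> gcls (ee (- \<nu>))) \<otimes>\<^bsub>g\<^esub> gcls (ee \<mu>))"
proof -
  obtain \<nu> where \<nu>: "\<nu> \<in> B_plus D" "J (coroot D \<nu>) \<mu> \<noteq> 0"
    using B_all_regular[OF assms] unfolding regular_def by blast
  then have "gcls (ee \<mu>) = inverse (J (coroot D \<nu>) \<mu>) \<odot>\<^bsub>g\<^esub>
      ((gcls (ee \<nu>) \<otimes>\<^bsub>g\<^esub> gcls (ee (- \<nu>))) \<otimes>\<^bsub>g\<^esub> gcls (ee \<mu>))"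
    using assms by (simp add: gcls_coroot gcls_h_action flip: g.smult_mult)
  then show ?thesis using that \<nu> by blast
qed

lemma root_subalgebra_least:
  assumes zero: "\<zero>\<^bsub>g\<^esub> \<in> H"
    and add: "\<And>x y. x \<in> H \<Longrightarrow> y \<in> H \<Longrightarrow> x \<oplus>\<^bsub>g\<^esub> y \<in> H"
    and smult: "\<And>c x. x \<in> H \<Longrightarrow> c \<odot>\<^bsub>g\<^esub> x \<in> H"
    and bracket: "\<And>x y. x \<in> root_subalgebra \<Longrightarrow> y \<in> root_subalgebra \<Longrightarrow> x \<otimes>\<^bsub>g\<^esub> y \<in> H"
  shows "root_subalgebra \<subseteq> H"
proof
  fix x assume "x \<in> root_subalgebra"
  then obtain t where t: "x = gcls t" "t \<in> lterms Egens" by blast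
  have "gcls t \<in> H" using t(2)
  proof (induction t)
    case (Gen x)
    then obtain \<mu> where \<mu>: "x = Eg \<mu>" "\<mu> \<in> B_all D" by auto
    obtain \<nu> c where \<nu>: "\<nu> \<in> B_plus D"
      "gcls (ee \<mu>) = c \<odot>\<^bsub>g\<^esub> ((gcls (ee \<nu>) \<otimes>\<^bsub>g\<^esub> gcls (ee (- \<nu>))) \<otimes>\<^bsub>g\<^esub> gcls (ee \<mu>))"
      using ee_as_bracket[OF \<mu>(2)] .
    have "ee \<mu> \<in> lterms Egens" "ee \<nu> \<in> lterms Egens" "ee (- \<nu>) \<in> lterms Egens"
      using \<mu> \<nu>(1) B_plus_B_all B_all_minus by auto
    then have "(gcls (ee \<nu>) \<otimes>\<^bsub>g\<^esub> gcls (ee (- \<nu>))) \<otimes>\<^bsub>g\<^esub> gcls (ee \<mu>) \<in> H"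
      by (intro bracket root_subalgebra_closed(4) imageI)
    then show ?case using smult \<nu>(2) \<mu>(1) by metis
  qed (use zero add smult bracket in \<open>auto simp: lterms_Egens\<close>)
  then show "x \<in> H" using t by simp
qed

text \<open>
  Every element is a sum of an element of the root subalgebra and a Cartan element, and Cartan elements
  commute; so the Cartan part disappears in brackets.
\<close>
lemma derived_carrier: "D1_set g = root_subalgebra"
proof
  have "submodule root_subalgebra complex_ring g"
    by (rule g.submoduleI') (use root_subalgebra_closed in auto)
  then show "D1_set g \<subseteq> root_subalgebra"
    unfolding D1_set_def using bracket_in_root_subalgebra by blast
  show "root_subalgebra \<subseteq> D1_set g"
    unfolding D1_set_def
  proof (rule Inter_greatest)
    fix H assume "H \<in> {H. submodule H complex_ring g \<and> {x \<otimes>\<^bsub>g\<^esub> y | x y. x \<in> carrier g \<and> y \<in> carrier g} \<subseteq> H}"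
    then have H: "submodule H complex_ring g" "\<And>x y. x \<in> carrier g \<Longrightarrow> y \<in> carrier g \<Longrightarrow> x \<otimes>\<^bsub>g\<^esub> y \<in> H"
      by blast+
    show "root_subalgebra \<subseteq> H"
      using g.submodule_simps[OF H(1)] H(2) root_subalgebra_closed(5) by (intro root_subalgebra_least) auto
  qed
qed

lemma D1_simps [simp]:
  "carrier (D1 g) = root_subalgebra" "\<zero>\<^bsub>D1 g\<^esub> = \<zero>\<^bsub>g\<^esub>" "x \<oplus>\<^bsub>D1 g\<^esub> y = x \<oplus>\<^bsub>g\<^esub> y" "x \<otimes>\<^bsub>D1 g\<^esub> y = x \<otimes>\<^bsub>g\<^esub> y"
  "c \<odot>\<^bsub>D1 g\<^esub> x = c \<odot>\<^bsub>g\<^esub> x" "part (D1 g) i = part g i \<inter> root_subalgebra"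
  by (simp_all add: D1_def derived_carrier)

lemma derived_perfect:
  assumes "lie_superalgebra (D1 g)"
  shows "D1_set (D1 g) = carrier (D1 g)"
proof
  interpret U: lie_superalgebra "D1 g" by fact
  have "submodule (carrier (D1 g)) complex_ring (D1 g)"
    by (rule U.submoduleI') (use root_subalgebra_closed in auto)
  then show "D1_set (D1 g) \<subseteq> carrier (D1 g)"
    unfolding D1_set_def using U.bracket_closed by blast
  show "carrier (D1 g) \<subseteq> D1_set (D1 g)"
    unfolding D1_set_def
  proof (rule Inter_greatest)
    fix H assume "H \<in> {H. submodule H complex_ring (D1 g) \<and>
        {x \<otimes>\<^bsub>D1 g\<^esub> y | x y. x \<in> carrier (D1 g) \<and> y \<in> carrier (D1 g)} \<subseteq> H}"
    then have H: "submodule H complex_ring (D1 g)"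
      "\<And>x y. x \<in> root_subalgebra \<Longrightarrow> y \<in> root_subalgebra \<Longrightarrow> x \<otimes>\<^bsub>g\<^esub> y \<in> H"
      unfolding D1_simps by blast+
    show "carrier (D1 g) \<subseteq> H"
      unfolding D1_simps
      using U.submodule_simps(2-4)[OF H(1)] H(2) unfolding D1_simps by (intro root_subalgebra_least) auto
  qed
qed

end

end

theorem theorem5p4:
  fixes D :: "'e::ab_group_add base_system"
    and q :: complex
    and A :: "'a lie_superalg"
    and \<rho> :: "'e gen lterm set \<Rightarrow> 'a"
  assumes "quasi_elliptic D"
    and "q \<noteq> 0"
    and "central_extension (D1 (gbar q D)) A \<rho>"
  shows "is_UCE TYPE('b) (D1 (gbar q D)) A \<rho>"
proof -
  interpret quasi_elliptic D by fact
  let ?U = "D1 (gbar q D)"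
  note UA = assms(3)[unfolded central_extension_def]
  interpret U: lie_superalgebra ?U using UA by blast
  interpret A: lie_superalgebra A using UA by blast
  have rho_hom: "\<rho> \<in> lsa_hom ?U A" using UA by blast
  let ?c = "gcls q"
  have c_closed: "?c t \<in> carrier ?U" if "t \<in> lterms Egens" for t using that by simp
  have "\<exists>M \<in> lsa_hom ?U B. \<forall>u \<in> carrier ?U. W (M u) = \<rho> u"
    if "central_extension B A W" for B :: "'b lie_superalg" and W
  proof -
    interpret B: lie_superalgebra B using that unfolding central_extension_def by blast
    interpret central_extension_of B A W by unfold_locales (rule that)
    define x where "x \<mu> = \<rho> (?c (ee \<mu>))" for \<mu>
    have \<rho>_eval: "\<rho> (?c t) = term_eval A (\<lambda>g. x (gen_weight g)) t" if "t \<in> lterms Egens" for t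
      using that
    proof (induction t)
      case Zero
      have "\<rho> \<zero>\<^bsub>?U\<^esub> = \<zero>\<^bsub>A\<^esub>"
        using lsa_homD(3)[OF rho_hom U.zero_closed, of 0] lsa_homD(1)[OF rho_hom U.zero_closed]
        by (simp del: D1_simps)
      then show ?case by simp
    next
      case (Gen g)
      then show ?case by (auto simp: x_def)
    next
      case (Add s t)
      then show ?case using lsa_homD(2)[OF rho_hom c_closed[of s] c_closed[of t]] by (simp add: lterms_Egens)
    next
      case (Smult c t)
      then show ?case using lsa_homD(3)[OF rho_hom c_closed[of t], of c] by (simp add: lterms_Egens)
    next
      case (Br s t)
      then show ?case using lsa_homD(4)[OF rho_hom c_closed[of s] c_closed[of t]] by (simp add: lterms_Egens)
    qed
    have x_part: "x \<mu> \<in> part A (root_parity D \<mu>)" if "\<mu> \<in> B_all D" for \<mu>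
    proof -
      have "homog (gen_parity D) (root_parity D \<mu>) (ee \<mu>)"
        using homog.intros(2)[of "gen_parity D" "Eg \<mu>"] by simp
      then have "?c (ee \<mu>) \<in> part ?U (root_parity D \<mu>)"
        using that gcls_part[of "ee \<mu>"] by auto
      then show ?thesis unfolding x_def by (rule lsa_homD(5)[OF rho_hom])
    qed
    have x_cartan: "(x \<mu> \<otimes>\<^bsub>A\<^esub> x (- \<mu>)) \<otimes>\<^bsub>A\<^esub> x \<nu> = J (coroot D \<mu>) \<nu> \<odot>\<^bsub>A\<^esub> x \<nu>"
      if "\<mu> \<in> B_plus D" "\<nu> \<in> B_all D" for \<mu> \<nu>
    proof -
      have S: "\<mu> \<in> B_all D" "- \<mu> \<in> B_all D" using that B_plus_B_all B_all_minus by auto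
      let ?s = "Br (Br (ee \<mu>) (ee (- \<mu>))) (ee \<nu>)" and ?t = "Smult (J (coroot D \<mu>) \<nu>) (ee \<nu>)"
      have "?s \<in> lterms Egens" "?t \<in> lterms Egens" using S that(2) by simp_all
      moreover have "?c ?s = ?c ?t"
        using S that by (simp add: gcls_coroot gcls_h_action)
      ultimately show ?thesis using \<rho>_eval[of ?s] \<rho>_eval[of ?t] by simp
    qed
    have S_plus: "\<mu> \<in> B_plus D \<Longrightarrow> \<mu> \<in> B_all D \<and> - \<mu> \<in> B_all D" for \<mu>
      using B_plus_B_all B_all_minus by blast
    have n_self: "\<mu> \<in> B_plus D \<Longrightarrow> J (coroot D \<mu>) \<mu> \<noteq> 0" for \<mu>
      using J_coroot_self S_plus by simp
    have n_nonzero: "\<exists>\<mu> \<in> B_plus D. J (coroot D \<mu>) \<nu> \<noteq> 0" if "\<nu> \<in> B_all D" for \<nu>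
      using B_all_regular[OF that] unfolding regular_def .
    have n_minus: "\<mu> \<in> B_plus D \<Longrightarrow> J (coroot D \<mu>) (- \<nu>) = - J (coroot D \<mu>) \<nu>" for \<mu> \<nu>
      by simp
    note data = x_part S_plus x_cartan n_self n_minus n_nonzero
    obtain y where y: "\<And>\<mu>. \<mu> \<in> B_all D \<Longrightarrow> y \<mu> \<in> part B (root_parity D \<mu>)"
      "\<And>\<mu>. \<mu> \<in> B_all D \<Longrightarrow> W (y \<mu>) = x \<mu>"
      "\<And>\<mu> \<nu>. \<mu> \<in> B_plus D \<Longrightarrow> \<nu> \<in> B_all D \<Longrightarrow>
        (y \<mu> \<otimes>\<^bsub>B\<^esub> y (- \<mu>)) \<otimes>\<^bsub>B\<^esub> y \<nu> = J (coroot D \<mu>) \<nu> \<odot>\<^bsub>B\<^esub> y \<nu>"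
      by (rule cartan_lift[OF data]) (assumption+, rule that, blast+)
    have y_serre: "term_eval B (case_gen (\<lambda>\<sigma>. \<zero>\<^bsub>B\<^esub>) y) s = term_eval B (case_gen (\<lambda>\<sigma>. \<zero>\<^bsub>B\<^esub>) y) t"
      if st: "(s, t) \<in> serre_rels q D" for s t
    proof -
      obtain \<nu> where E: "s \<in> lterms Egens" "t \<in> lterms Egens" "weighted \<nu> s" "weighted \<nu> t" "regular \<nu>"
        using serre_rels_homogeneous[OF st] .
      obtain \<mu> where \<mu>: "\<mu> \<in> B_plus D" "J (coroot D \<mu>) \<nu> \<noteq> 0" using E(5) regular_def by blast
      have "?c s = ?c t" using gcls_relation[of s t] st E lterms_Egens by blast
      then have eq: "term_eval A (\<lambda>g. x (gen_weight g)) s = term_eval A (\<lambda>g. x (gen_weight g)) t"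
        using \<rho>_eval E by metis
      show ?thesis
        by (rule lifted_relation[OF data y(1,2) y(3)[OF \<mu>(1)] _ E(1-4) \<mu> _ eq]) auto
    qed
    interpret F: serre_family D B q y
      by unfold_locales (fact y(1), fact y(3), fact y_serre)
    let ?f = "case_gen F.cartan_map y"
    have well_defined: "term_eval B ?f s = term_eval B ?f t"
      if "?c s = ?c t" "s \<in> lterms Egens" "t \<in> lterms Egens" for s t
    proof (rule B.term_eval_lcong)
      have "(s, t) \<in> lcong (gens D) (gen_parity D) (cartan_rels D J \<union> serre_rels q D)"
        using that lterms_Egens by (simp add: term_class_eq_iff)
      then show "(s, t) \<in> lcong (gens D) (gen_parity D) (reduced_rels q)"
        using that derived_presentation by blast
    qed (use F.generator_image_part F.generator_image_relations in auto)
    \<comment> \<open>An element of the derived algebra is represented by many terms in root vectors, with equal values in \<open>B\<close>.\<close>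
    define M where "M u = term_eval B ?f (SOME t. t \<in> lterms Egens \<and> ?c t = u)" for u
    have M: "M (?c t) = term_eval B ?f t" if "t \<in> lterms Egens" for t
    proof -
      have "(SOME s. s \<in> lterms Egens \<and> ?c s = ?c t) \<in> lterms Egens \<and>
          ?c (SOME s. s \<in> lterms Egens \<and> ?c s = ?c t) = ?c t"
        by (rule someI[of "\<lambda>s. s \<in> lterms Egens \<and> ?c s = ?c t" t]) (use that in simp)
      then show ?thesis unfolding M_def using well_defined that by blast
    qed
    have f_part: "?f g \<in> part B (gen_parity D g)" if "g \<in> gens D" for g
      using F.generator_image_part[OF that] .
    have f_closed: "term_eval B ?f t \<in> carrier B" if "t \<in> lterms Egens" for t
      using B.term_eval_closed[of "gens D" ?f t] f_part B.part_carrier lterms_Egens[OF that] by blast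
    have rep: "\<exists>t \<in> lterms Egens. u = ?c t" if "u \<in> carrier ?U" for u
      using that by auto
    have "M \<in> lsa_hom ?U B"
      unfolding lsa_hom_def
    proof (intro CollectI conjI allI ballI Pi_I subsetI)
      fix u assume "u \<in> carrier ?U"
      then obtain t where t: "t \<in> lterms Egens" "u = ?c t" using rep by blast
      then show "M u \<in> carrier B" using M f_closed by simp
      fix c show "M (c \<odot>\<^bsub>?U\<^esub> u) = c \<odot>\<^bsub>B\<^esub> M u"
        using t M[of t] M[of "Smult c t"] lterms_Egens by simp
    next
      fix u v assume "u \<in> carrier ?U" "v \<in> carrier ?U"
      then obtain s t where st: "s \<in> lterms Egens" "u = ?c s" "t \<in> lterms Egens" "v = ?c t" using rep by metis
      show "M (u \<oplus>\<^bsub>?U\<^esub> v) = M u \<oplus>\<^bsub>B\<^esub> M v" "M (u \<otimes>\<^bsub>?U\<^esub> v) = M u \<otimes>\<^bsub>B\<^esub> M v"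
        using st M[of s] M[of t] M[of "Add s t"] M[of "Br s t"] lterms_Egens by simp_all
    next
      \<comment> \<open>A representing term of a homogeneous element can be chosen homogeneous, as the other summand is zero.\<close>
      fix i w assume "w \<in> M ` part ?U i"
      then obtain u where u: "u \<in> part ?U i" "w = M u" by blast
      then obtain t where t: "t \<in> lterms Egens" "u = ?c t" using rep U.part_carrier by blast
      obtain t0 t1 where *: "t0 \<in> lterms Egens" "t1 \<in> lterms Egens" "?c t0 \<in> part (gbar q D) 0"
        "?c t1 \<in> part (gbar q D) 1" "?c t = ?c t0 \<oplus>\<^bsub>gbar q D\<^esub> ?c t1"
        "homog (gen_parity D) 0 t0" "homog (gen_parity D) 1 t1"
        using gcls_decomposition[OF t(1)] .
      have pt: "?c t0 \<in> part ?U 0" "?c t1 \<in> part ?U 1" using * by simp_all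
      have sum: "u = ?c t0 \<oplus>\<^bsub>?U\<^esub> ?c t1" using t * by simp
      note ev = B.term_eval_part[of "gens D" ?f "gen_parity D", OF f_part]
      have "\<exists>r \<in> lterms Egens. u = ?c r \<and> homog (gen_parity D) i r"
        using U.homogeneous_summand[OF pt, of i] u(1) * sum by auto
      then show "w \<in> part B i" using u(2) M ev lterms_Egens by auto
    qed
    moreover have "W (M u) = \<rho> u" if u: "u \<in> carrier ?U" for u
    proof -
      obtain t where t: "t \<in> lterms Egens" "u = ?c t" using rep[OF u] by blast
      have "?f g \<in> carrier B" if "g \<in> Egens" for g
      proof -
        have "g \<in> gens D" using that by (auto simp only: gens_def)
        then show ?thesis by (rule B.part_carrier[OF f_part])
      qed
      then have "W (M u) = term_eval A (\<lambda>g. W (?f g)) t"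
        unfolding t(2) M[OF t(1)] using t(1) by (rule W_term_eval)
      also have "\<dots> = term_eval A (\<lambda>g. x (gen_weight g)) t"
        by (rule term_eval_cong[OF t(1)]) (use y(2) in auto)
      also have "\<dots> = \<rho> u" using \<rho>_eval[OF t(1)] t(2) by simp
      finally show ?thesis .
    qed
    ultimately show ?thesis by blast
  qed
  then show ?thesis
    unfolding is_UCE_def
    by (intro conjI allI impI assms(3) derived_perfect[OF U.lie_superalgebra_axioms, symmetric])
qed

end
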